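(* Consider a well-posed Volterra integral equation of the second kind, either $$u(x)-\int_0^{x}K(x,y)u(y)\,dy=g(x)\qquad\text{or}\qquad u(x)-\int_0^{1-x}K(x,y)u(y)\,dy=g(x),$$ with kernel square integrable on the respective integration triangle, written in coefficient space of $\tilde{\mathbf P}^{(1,0)}(x)$ as $(\mathbb 1-\mathrm{A}_K)\mathbf u=\mathbf g$ on $\ell^2$, where $$\mathrm{A}_K=\mathrm{S}_{(0,0)}^{(1,0)}\,\mathrm{R}\,\mathrm{L}_{(1,0)}^{(0,0)}\,\mathrm{Q}_y\,K(\mathbb{1}-\mathrm{J}_x,\mathrm{J}_y)\,\mathrm{E}_y\qquad\text{or}\qquad \mathrm{A}_K=(\mathbb 1-\mathrm{J})\,\mathrm{Q}_y\,K(\mathrm{J}_x,\mathrm{J}_y)\,\mathrm{E}_y$$ respectively. Then the sparse spectral method, which approximates $\mathbf u$ by the solution $\mathbf u_n$ of the $n\times n$ truncated system $\mathcal P_n(\mathbb 1-\mathrm{A}_K)\mathcal P_n^{\mathsf T}\mathbf u_n=\mathcal P_n\mathbf g$, converges to the solution $\mathbf u$ as $n\to\infty$, like $\|\mathbf u-\mathcal P_n\mathbf u\|\to0$; that is, for all sufficiently large $n$ the truncated system is uniquely solvable and $\|\mathbf u-\mathbf u_n\|\le C\|\mathbf u-\mathcal P_n\mathbf u\|\to 0$ with a constant $C$ independent of $n$.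
   Context: $T^2=\{(x,y):0\le x,\ 0\le y\le 1-x\}$. For $\alpha,\beta\ge 0$, $\tilde P_n^{(\alpha,\beta)}(x)=P_n^{(\alpha,\beta)}(2x-1)$, $n\ge0$, are the Jacobi polynomials (standard normalization) shifted to $[0,1]$, orthogonal with weight $(1-x)^\alpha x^\beta$. A function on $[0,1]$ is expanded as $f(x)=\sum_n f_n\tilde P^{(\alpha,\beta)}_n(x)=\tilde{\mathbf P}^{(\alpha,\beta)}(x)^{\mathsf T}\mathbf f$, with coefficient vector $\mathbf f=(f_0,f_1,\dots)^{\mathsf T}$. On $T^2$ one uses the triangle Jacobi polynomials with parameters $(0,0,0)$, $P_{k,n}(x,y)=(1-x)^k\tilde P_{n-k}^{(2k+1,0)}(x)\,\tilde P_k^{(0,0)}\!\left(\frac{y}{1-x}\right)$, $0\le k\le n$, and coefficient vectors $\mathbf f_\vartriangle$ in this basis. Operators on coefficient vectors: - $\mathrm{J}$ maps the $\tilde{\mathbf P}^{(1,0)}$ coefficients of $f(x)$ to those of $xf(x)$; $\mathbb 1$ is the identity. - $\mathrm{E}_y$ maps the $\tilde{\mathbf P}^{(1,0)}$ coefficients of a one-variable function $f$ to the triangle coefficients of $(x,y)\mapsto f(y)$. - $\mathrm{J}_x,\mathrm{J}_y$ map the triangle coefficients of $f$ to those of $xf(x,y)$ and $yf(x,y)$; $K(\mathrm{J}_x,\mathrm{J}_y)$ and $K(\mathbb 1-\mathrm{J}_x,\mathrm{J}_y)$ denote the operators on triangle coefficients of multiplication by $K(x,y)$ and $K(1-x,y)$.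 - $\mathrm{Q}_y$ maps the triangle coefficients of $f(x,y)$ to the $\tilde{\mathbf P}^{(1,0)}$ coefficients of $\frac{1}{1-x}\int_0^{1-x}f(x,y)\,dy$. - $\mathrm{L}_{(1,0)}^{(0,0)}$ maps the $\tilde{\mathbf P}^{(1,0)}$ coefficients of $f$ to the $\tilde{\mathbf P}^{(0,0)}$ coefficients of $(1-x)f(x)$. - $\mathrm{R}$ is the reflection operator $(\mathrm{R}\mathbf f)_n=(-1)^nf_n$, mapping the $\tilde{\mathbf P}^{(0,0)}$ coefficients of $f(x)$ to those of $f(1-x)$. - $\mathrm{S}_{(0,0)}^{(1,0)}$ maps the $\tilde{\mathbf P}^{(0,0)}$ coefficients of a function to its $\tilde{\mathbf P}^{(1,0)}$ coefficients. The analysis operator $\mathcal E:L^2(0,1)\to\ell^2$ sends a function to its coefficient vector in the complete basis of orthogonal Jacobi polynomials; it and its inverse, the synthesis operator $\mathcal E^{-1}$, are taken to be bounded by definition. $\mathcal P_n:\ell^2\to\ell^2$ truncates a coefficient vector to its first $n$ entries, and $\mathcal P_n^{\mathsf T}$ is its transpose; the truncated system is regarded as an $n\times n$ linear system on the range of $\mathcal P_n$. $\|\cdot\|$ is the $\ell^2$ norm. Well-posed means that the coefficient equation has a unique solution $\mathbf u\in\ell^2$ for each $\mathbf g\in\ell^2$, depending continuously on $\mathbf g$.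
   Formalization: Analysis and synthesis operators are not bounded for the standard normalization of P^(1,0); the theorem is proved for P^(1,0) rescaled by factors c_n (e.g. orthonormal) that make both bounded, with L^2(0,1) carrying the weight 1-x. *)

theory Defs
  imports "HOL-Analysis.Analysis"
begin

section \<open>Jacobi polynomials and expansions\<close>

definition jacobi :: "real \<Rightarrow> real \<Rightarrow> nat \<Rightarrow> real \<Rightarrow> real" where
  "jacobi \<alpha> \<beta> n z =
     (\<Sum>s\<le>n. ((real n + \<alpha>) gchoose (n - s)) * ((real n + \<beta>) gchoose s)
            * ((z - 1) / 2) ^ s * ((z + 1) / 2) ^ (n - s))"

definition jacobi01 :: "real \<Rightarrow> real \<Rightarrow> nat \<Rightarrow> real \<Rightarrow> real" where
  "jacobi01 \<alpha> \<beta> n x = jacobi \<alpha> \<beta> n (2 * x - 1)"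

definition jacobi_measure :: "real \<Rightarrow> real \<Rightarrow> real measure" where
  "jacobi_measure \<alpha> \<beta> =
     density (restrict_space lborel {0..1}) (\<lambda>x. ennreal ((1 - x) powr \<alpha> * x powr \<beta>))"

definition T2 :: "(real \<times> real) set" where
  "T2 = {(x, y). 0 \<le> x \<and> 0 \<le> y \<and> y \<le> 1 - x}"

abbreviation triangle_measure :: "(real \<times> real) measure" where
  "triangle_measure \<equiv> restrict_space lborel T2"

text \<open>The index \<open>(k, n)\<close> of a triangle polynomial satisfies \<open>k \<le> n\<close>; \<open>n\<close> is the total degree.\<close>

definition triangle_index :: "(nat \<times> nat) set" where
  "triangle_index = {(k, n). k \<le> n}"

definition triangle_jacobi :: "nat \<times> nat \<Rightarrow> real \<times> real \<Rightarrow> real" where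
  "triangle_jacobi = (\<lambda>(k, n) (x, y).
     (1 - x) ^ k * jacobi01 (2 * real k + 1) 0 (n - k) x * jacobi01 0 0 k (y / (1 - x)))"

text \<open>
  Coefficients of \<open>f\<close> in a basis \<open>p\<close> that is orthogonal for the measure \<open>M\<close>, and the
  operator on coefficient vectors that represents a linear map \<open>F\<close> of functions: the \<open>i\<close>-th
  column of its matrix consists of the \<open>q\<close> coefficients of \<open>F (p i)\<close>.
\<close>

definition coeff :: "'a measure \<Rightarrow> ('i \<Rightarrow> 'a \<Rightarrow> real) \<Rightarrow> ('a \<Rightarrow> real) \<Rightarrow> 'i \<Rightarrow> real" where
  "coeff M p f i = (\<integral>x. f x * p i x \<partial>M) / (\<integral>x. (p i x)\<^sup>2 \<partial>M)"

definition coeff_op ::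
  "'i set \<Rightarrow> ('i \<Rightarrow> 'a \<Rightarrow> real) \<Rightarrow> 'b measure \<Rightarrow> ('j \<Rightarrow> 'b \<Rightarrow> real) \<Rightarrow>
     (('a \<Rightarrow> real) \<Rightarrow> ('b \<Rightarrow> real)) \<Rightarrow> ('i \<Rightarrow> real) \<Rightarrow> ('j \<Rightarrow> real)" where
  "coeff_op I p N q F v = (\<lambda>j. \<Sum>\<^sub>\<infinity>i\<in>I. coeff N q (F (p i)) j * v i)"


section \<open>The operators\<close>

text \<open>
  The solution is expanded in the (1,0) Jacobi polynomials, where the \<open>n\<close>-th one may carry a
  normalisation factor \<open>c n\<close>; \<open>c = (\<lambda>n. 1)\<close> is the standard normalisation. The factor is kept
  because whether the analysis operator into the plain sequence space is bounded with bounded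
  inverse depends on it.
\<close>

definition basis10 :: "(nat \<Rightarrow> real) \<Rightarrow> nat \<Rightarrow> real \<Rightarrow> real" where
  "basis10 c n x = c n * jacobi01 1 0 n x"

definition op_J :: "(nat \<Rightarrow> real) \<Rightarrow> (nat \<Rightarrow> real) \<Rightarrow> (nat \<Rightarrow> real)" where
  "op_J c = coeff_op UNIV (basis10 c) (jacobi_measure 1 0) (basis10 c) (\<lambda>f x. x * f x)"

definition op_E :: "(nat \<Rightarrow> real) \<Rightarrow> (nat \<Rightarrow> real) \<Rightarrow> (nat \<times> nat \<Rightarrow> real)" where
  "op_E c = coeff_op UNIV (basis10 c) triangle_measure triangle_jacobi (\<lambda>f (x, y). f y)"

definition op_mult ::
  "(real \<Rightarrow> real \<Rightarrow> real) \<Rightarrow> (nat \<times> nat \<Rightarrow> real) \<Rightarrow> (nat \<times> nat \<Rightarrow> real)" where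
  "op_mult K = coeff_op triangle_index triangle_jacobi triangle_measure triangle_jacobi
     (\<lambda>f (x, y). K x y * f (x, y))"

definition op_Q :: "(nat \<Rightarrow> real) \<Rightarrow> (nat \<times> nat \<Rightarrow> real) \<Rightarrow> (nat \<Rightarrow> real)" where
  "op_Q c = coeff_op triangle_index triangle_jacobi (jacobi_measure 1 0) (basis10 c)
     (\<lambda>f x. 1 / (1 - x) * (LBINT y:{0..1 - x}. f (x, y)))"

definition op_L :: "(nat \<Rightarrow> real) \<Rightarrow> (nat \<Rightarrow> real) \<Rightarrow> (nat \<Rightarrow> real)" where
  "op_L c = coeff_op UNIV (basis10 c) (jacobi_measure 0 0) (jacobi01 0 0) (\<lambda>f x. (1 - x) * f x)"

definition op_R :: "(nat \<Rightarrow> real) \<Rightarrow> (nat \<Rightarrow> real)" where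
  "op_R v = (\<lambda>n. (-1) ^ n * v n)"

definition op_S :: "(nat \<Rightarrow> real) \<Rightarrow> (nat \<Rightarrow> real) \<Rightarrow> (nat \<Rightarrow> real)" where
  "op_S c = coeff_op UNIV (jacobi01 0 0) (jacobi_measure 1 0) (basis10 c) (\<lambda>f. f)"

text \<open>The integral over \<open>[0, x]\<close>, respectively over \<open>[0, 1 - x]\<close>, in coefficient space.\<close>

definition volterra_x ::
  "(nat \<Rightarrow> real) \<Rightarrow> (real \<Rightarrow> real \<Rightarrow> real) \<Rightarrow> (nat \<Rightarrow> real) \<Rightarrow> (nat \<Rightarrow> real)" where
  "volterra_x c K u = op_S c (op_R (op_L c (op_Q c (op_mult (\<lambda>x y. K (1 - x) y) (op_E c u)))))"

definition volterra_1mx ::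
  "(nat \<Rightarrow> real) \<Rightarrow> (real \<Rightarrow> real \<Rightarrow> real) \<Rightarrow> (nat \<Rightarrow> real) \<Rightarrow> (nat \<Rightarrow> real)" where
  "volterra_1mx c K u = (let w = op_Q c (op_mult K (op_E c u)) in w - op_J c w)"


section \<open>Function and sequence spaces\<close>

definition square_integrable :: "'a measure \<Rightarrow> ('a \<Rightarrow> real) \<Rightarrow> bool" where
  "square_integrable M f \<longleftrightarrow> f \<in> borel_measurable M \<and> integrable M (\<lambda>x. (f x)\<^sup>2)"

definition L2_norm_on :: "'a measure \<Rightarrow> ('a \<Rightarrow> real) \<Rightarrow> real" where
  "L2_norm_on M f = sqrt (\<integral>x. (f x)\<^sup>2 \<partial>M)"

definition ell2 :: "(nat \<Rightarrow> real) set" where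
  "ell2 = {v. summable (\<lambda>n. (v n)\<^sup>2)}"

definition ell2_norm :: "(nat \<Rightarrow> real) \<Rightarrow> real" where
  "ell2_norm v = sqrt (\<Sum>n. (v n)\<^sup>2)"

text \<open>
  The analysis operator for the (1,0) basis acts on the square integrable functions on the unit
  interval with respect to the orthogonality weight \<open>1 - x\<close>, the space in which the basis is
  orthogonal and complete. The predicate says that it is bounded, onto the space of square
  summable sequences, and has a bounded inverse (the synthesis operator); functions are
  understood up to null sets. It holds for orthonormal polynomials, \<open>c n = sqrt (2 * n + 2)\<close>,
  and for every normalisation comparable to that one.
\<close>

definition analysis :: "(nat \<Rightarrow> real) \<Rightarrow> (real \<Rightarrow> real) \<Rightarrow> (nat \<Rightarrow> real)" where
  "analysis c f = coeff (jacobi_measure 1 0) (basis10 c) f"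

definition analysis_synthesis_bounded :: "(nat \<Rightarrow> real) \<Rightarrow> bool" where
  "analysis_synthesis_bounded c \<longleftrightarrow>
     (\<exists>B. \<forall>f. square_integrable (jacobi_measure 1 0) f \<longrightarrow>
        analysis c f \<in> ell2 \<and> ell2_norm (analysis c f) \<le> B * L2_norm_on (jacobi_measure 1 0) f) \<and>
     (\<forall>v\<in>ell2. \<exists>f. square_integrable (jacobi_measure 1 0) f \<and> analysis c f = v) \<and>
     (\<exists>B. \<forall>f. square_integrable (jacobi_measure 1 0) f \<longrightarrow>
        L2_norm_on (jacobi_measure 1 0) f \<le> B * ell2_norm (analysis c f))"


section \<open>Well-posedness and truncation\<close>

text \<open>
  The operator acts on all sequences, but the equation is posed on square summable ones, so
  well-posedness includes that the operator maps this space into itself.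
\<close>

definition well_posed :: "((nat \<Rightarrow> real) \<Rightarrow> (nat \<Rightarrow> real)) \<Rightarrow> bool" where
  "well_posed A \<longleftrightarrow>
     (\<forall>u\<in>ell2. A u \<in> ell2) \<and>
     (\<forall>g\<in>ell2. \<exists>!u. u \<in> ell2 \<and> u - A u = g) \<and>
     (\<forall>u\<in>ell2. \<forall>e>0. \<exists>d>0. \<forall>u'\<in>ell2.
        ell2_norm ((u' - A u') - (u - A u)) < d \<longrightarrow> ell2_norm (u' - u) < e)"

definition trunc :: "nat \<Rightarrow> (nat \<Rightarrow> real) \<Rightarrow> (nat \<Rightarrow> real)" where
  "trunc n v = (\<lambda>i. if i < n then v i else 0)"

text \<open>Vectors of length \<open>n\<close> are sequences in the range of \<open>trunc n\<close>.\<close>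

definition truncated_solution ::
  "((nat \<Rightarrow> real) \<Rightarrow> (nat \<Rightarrow> real)) \<Rightarrow> (nat \<Rightarrow> real) \<Rightarrow> nat \<Rightarrow> (nat \<Rightarrow> real) \<Rightarrow> bool" where
  "truncated_solution A g n v \<longleftrightarrow> v \<in> range (trunc n) \<and> trunc n (v - A v) = trunc n g"

definition sparse_solution ::
  "((nat \<Rightarrow> real) \<Rightarrow> (nat \<Rightarrow> real)) \<Rightarrow> (nat \<Rightarrow> real) \<Rightarrow> nat \<Rightarrow> (nat \<Rightarrow> real)" where
  "sparse_solution A g n = (THE v. truncated_solution A g n v)"

end

theory Submission
  imports Defs "HOL-Computational_Algebra.Polynomial" "HOL-Real_Asymp.Real_Asymp"
begin

text \<open>
  In coefficient space \<open>A\<close> acts as an integral operator \<open>f \<mapsto> \<integral> k(x, y) f(y) dy\<close> on the square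
  integrable functions for the weight \<open>1 - x\<close>. With \<open>k\<close> supported on \<open>y \<le> x\<close> it is Hilbert-Schmidt.
  With \<open>k\<close> supported on \<open>y \<le> 1 - x\<close> it need not be compact, because the square integrability of the
  kernel does not see the weights; being defined everywhere it is at least bounded. In both cases the
  truncated systems are stable because \<open>A (1 - P) A\<close> tends to 0 in norm, where \<open>P\<close> truncates. In the
  second case this holds since, up to a Hilbert-Schmidt operator, \<open>A\<close> maps functions living near 1 to
  functions living near 0, and \<open>P\<close>, the orthogonal projection onto polynomials of low degree, hardly
  moves mass from 0 to 1: multiplication by \<open>x ^ k\<close> commutes with \<open>P\<close> up to an operator of rank
  \<open>2 k\<close> with range spanned by Jacobi polynomials of high degree, which do not concentrate at 1.
\<close>

section \<open>Square integrable functions\<close>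

definition L2_inner :: "'a measure \<Rightarrow> ('a \<Rightarrow> real) \<Rightarrow> ('a \<Rightarrow> real) \<Rightarrow> real" where
  "L2_inner M f g = (\<integral>x. f x * g x \<partial>M)"

lemma square_integrable_measurable:
  "square_integrable M f \<Longrightarrow> f \<in> borel_measurable M"
  by (simp add: square_integrable_def)

lemma square_integrable_mult:
  assumes "square_integrable M f" "square_integrable M g"
  shows "integrable M (\<lambda>x. f x * g x)"
proof (rule Bochner_Integration.integrable_bound)
  show "integrable M (\<lambda>x. (f x)\<^sup>2 + (g x)\<^sup>2)"
    using assms by (simp add: square_integrable_def)
  show "(\<lambda>x. f x * g x) \<in> borel_measurable M"
    using assms by (auto simp: square_integrable_def intro: borel_measurable_times)
  have "\<bar>a * b\<bar> \<le> a\<^sup>2 + b\<^sup>2" for a b :: real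
  proof -
    have "2 * (\<bar>a\<bar> * \<bar>b\<bar>) \<le> a\<^sup>2 + b\<^sup>2" "0 \<le> \<bar>a\<bar> * \<bar>b\<bar>"
      using sum_squares_bound[of "\<bar>a\<bar>" "\<bar>b\<bar>"] by (simp_all add: mult.assoc)
    then show ?thesis unfolding abs_mult by linarith
  qed
  then show "AE x in M. norm (f x * g x) \<le> norm ((f x)\<^sup>2 + (g x)\<^sup>2)"
    by (auto simp: real_norm_def)
qed

lemma square_integrable_cmult:
  "square_integrable M f \<Longrightarrow> square_integrable M (\<lambda>x. a * f x)"
  by (auto simp: square_integrable_def power_mult_distrib intro: borel_measurable_times)

lemma square_integrable_add:
  assumes "square_integrable M f" "square_integrable M g"
  shows "square_integrable M (\<lambda>x. f x + g x)"
proof -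
  have "integrable M (\<lambda>x. (f x)\<^sup>2 + (g x)\<^sup>2 + 2 * (f x * g x))"
    using assms square_integrable_mult[OF assms] by (simp add: square_integrable_def)
  then show ?thesis
    using assms by (auto simp: square_integrable_def power2_sum mult.assoc intro: borel_measurable_add)
qed

lemma square_integrable_diff:
  assumes "square_integrable M f" "square_integrable M g"
  shows "square_integrable M (\<lambda>x. f x - g x)"
  using square_integrable_add[OF assms(1) square_integrable_cmult[OF assms(2), of "-1"]] by simp

lemma square_integrable_zero [simp]: "square_integrable M (\<lambda>x. 0)"
  by (simp add: square_integrable_def)

lemma square_integrable_sum:
  "(\<And>i. i \<in> F \<Longrightarrow> square_integrable M (f i)) \<Longrightarrow> square_integrable M (\<lambda>x. \<Sum>i\<in>F. f i x)"
  by (induction F rule: infinite_finite_induct) (auto intro: square_integrable_add)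

lemma square_integrable_bounded_mult:
  assumes "square_integrable M f" "h \<in> borel_measurable M" "AE x in M. \<bar>h x\<bar> \<le> B"
  shows "square_integrable M (\<lambda>x. h x * f x)"
  unfolding square_integrable_def
proof
  have [measurable]: "f \<in> borel_measurable M" "h \<in> borel_measurable M"
    using assms by (auto simp: square_integrable_def)
  show "(\<lambda>x. h x * f x) \<in> borel_measurable M" by measurable
  show "integrable M (\<lambda>x. (h x * f x)\<^sup>2)"
  proof (rule Bochner_Integration.integrable_bound)
    show "integrable M (\<lambda>x. B\<^sup>2 * (f x)\<^sup>2)"
      using assms(1) by (simp add: square_integrable_def)
    show "AE x in M. norm ((h x * f x)\<^sup>2) \<le> norm (B\<^sup>2 * (f x)\<^sup>2)"
      using assms(3)
    proof eventually_elim
      case (elim x)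
      then have "\<bar>h x\<bar>\<^sup>2 \<le> B\<^sup>2" by (intro power_mono) auto
      then show "norm ((h x * f x)\<^sup>2) \<le> norm (B\<^sup>2 * (f x)\<^sup>2)"
        by (simp add: power_mult_distrib mult_right_mono)
    qed
  qed measurable
qed

lemma L2_inner_commute: "L2_inner M f g = L2_inner M g f"
  by (simp add: L2_inner_def mult.commute)

lemma L2_inner_add_left:
  assumes "square_integrable M f" "square_integrable M g" "square_integrable M h"
  shows "L2_inner M (\<lambda>x. f x + g x) h = L2_inner M f h + L2_inner M g h"
  using square_integrable_mult[OF assms(1,3)] square_integrable_mult[OF assms(2,3)]
  by (simp add: L2_inner_def distrib_right)

lemma L2_inner_diff_left:
  assumes "square_integrable M f" "square_integrable M g" "square_integrable M h"
  shows "L2_inner M (\<lambda>x. f x - g x) h = L2_inner M f h - L2_inner M g h"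
  using square_integrable_mult[OF assms(1,3)] square_integrable_mult[OF assms(2,3)]
  by (simp add: L2_inner_def left_diff_distrib)

lemma L2_inner_cmult_left: "L2_inner M (\<lambda>x. a * f x) g = a * L2_inner M f g"
  by (simp add: L2_inner_def mult.assoc)

lemma L2_inner_sum_left:
  assumes "\<And>i. i \<in> F \<Longrightarrow> square_integrable M (f i)" "square_integrable M h"
  shows "L2_inner M (\<lambda>x. \<Sum>i\<in>F. f i x) h = (\<Sum>i\<in>F. L2_inner M (f i) h)"
proof -
  have "integrable M (\<lambda>x. f i x * h x)" if "i \<in> F" for i
    using square_integrable_mult assms that by blast
  then show ?thesis by (simp add: L2_inner_def sum_distrib_right)
qed

lemma L2_inner_self_nonneg [simp]: "0 \<le> L2_inner M f f"
  by (simp add: L2_inner_def)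

lemma L2_norm_on_alt: "L2_norm_on M f = sqrt (L2_inner M f f)"
  by (simp add: L2_norm_on_def L2_inner_def power2_eq_square)

lemma L2_norm_on_power2: "(L2_norm_on M f)\<^sup>2 = L2_inner M f f"
  by (simp add: L2_norm_on_alt)

lemma L2_norm_on_nonneg [simp]: "0 \<le> L2_norm_on M f"
  by (simp add: L2_norm_on_alt)

lemma L2_norm_on_zero [simp]: "L2_norm_on M (\<lambda>x. 0) = 0"
  by (simp add: L2_norm_on_def)

lemma L2_norm_on_cmult: "L2_norm_on M (\<lambda>x. a * f x) = \<bar>a\<bar> * L2_norm_on M f"
  by (simp add: L2_norm_on_def power_mult_distrib real_sqrt_mult)

lemma L2_inner_Cauchy_Schwarz_square:
  assumes f: "square_integrable M f" and g: "square_integrable M g"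
  shows "(L2_inner M f g)\<^sup>2 \<le> L2_inner M f f * L2_inner M g g"
proof -
  let ?a = "L2_inner M f f" and ?b = "L2_inner M f g" and ?c = "L2_inner M g g"
  have q: "0 \<le> s\<^sup>2 * ?a - 2 * s * t * ?b + t\<^sup>2 * ?c" for s t
  proof -
    have sq: "square_integrable M (\<lambda>x. s * f x)" "square_integrable M (\<lambda>x. t * g x)"
      using f g by (auto intro: square_integrable_cmult)
    have "0 \<le> L2_inner M (\<lambda>x. s * f x - t * g x) (\<lambda>x. s * f x - t * g x)" by simp
    also have "\<dots> = L2_inner M (\<lambda>x. s * f x) (\<lambda>x. s * f x - t * g x)
        - L2_inner M (\<lambda>x. t * g x) (\<lambda>x. s * f x - t * g x)"
      by (intro L2_inner_diff_left square_integrable_diff sq)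
    also have "\<dots> = s * (s * ?a - t * ?b) - t * (s * ?b - t * ?c)"
      using sq f g by (simp add: L2_inner_cmult_left L2_inner_commute[of M _ "\<lambda>x. s * f x - t * g x"]
          L2_inner_diff_left L2_inner_commute[of M g f])
    finally show ?thesis by (simp add: power2_eq_square algebra_simps)
  qed
  have "0 \<le> ?c * (?a * ?c - ?b\<^sup>2)"
    using q[of ?c ?b] by (simp add: power2_eq_square algebra_simps)
  moreover have "?b = 0" if "?c = 0"
  proof (rule ccontr)
    assume "?b \<noteq> 0"
    then show False
      using q[of 1 "(?a + 1) / (2 * ?b)"] that by simp
  qed
  moreover have "0 \<le> ?c" by simp
  ultimately show ?thesis
    by (cases "?c = 0") (simp_all add: zero_le_mult_iff less_le)
qed

lemma L2_inner_Cauchy_Schwarz: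
  assumes "square_integrable M f" "square_integrable M g"
  shows "\<bar>L2_inner M f g\<bar> \<le> L2_norm_on M f * L2_norm_on M g"
  using real_sqrt_le_mono[OF L2_inner_Cauchy_Schwarz_square[OF assms]]
  by (simp add: L2_norm_on_alt real_sqrt_mult)

lemma L2_norm_on_triangle:
  assumes f: "square_integrable M f" and g: "square_integrable M g"
  shows "L2_norm_on M (\<lambda>x. f x + g x) \<le> L2_norm_on M f + L2_norm_on M g"
proof (rule power2_le_imp_le)
  let ?h = "\<lambda>x. f x + g x"
  have h: "square_integrable M ?h" using f g by (rule square_integrable_add)
  have "L2_inner M ?h k = L2_inner M f k + L2_inner M g k" if "square_integrable M k" for k
    using f g that by (rule L2_inner_add_left)
  from this[OF h] this[OF f] this[OF g]
  have "L2_inner M ?h ?h = L2_inner M f f + 2 * L2_inner M f g + L2_inner M g g"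
    by (simp only: L2_inner_commute[of M f ?h] L2_inner_commute[of M g ?h] L2_inner_commute[of M g f])
  then have "(L2_norm_on M ?h)\<^sup>2 = L2_inner M f f + 2 * L2_inner M f g + L2_inner M g g"
    by (simp only: L2_norm_on_power2)
  also have "\<dots> \<le> (L2_norm_on M f + L2_norm_on M g)\<^sup>2"
    using L2_inner_Cauchy_Schwarz[OF f g] by (simp add: power2_sum L2_norm_on_power2)
  finally show "(L2_norm_on M (\<lambda>x. f x + g x))\<^sup>2 \<le> (L2_norm_on M f + L2_norm_on M g)\<^sup>2" .
qed simp

lemma L2_norm_on_triangle_diff:
  assumes f: "square_integrable M f" and g: "square_integrable M g"
  shows "L2_norm_on M (\<lambda>x. f x - g x) \<le> L2_norm_on M f + L2_norm_on M g"
  using L2_norm_on_triangle[OF f square_integrable_cmult[OF g, of "-1"]] L2_norm_on_cmult[of M "-1" g]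
  by simp

lemma L2_norm_on_triangle_sum:
  assumes "\<And>i. i \<in> F \<Longrightarrow> square_integrable M (f i)"
  shows "L2_norm_on M (\<lambda>x. \<Sum>i\<in>F. f i x) \<le> (\<Sum>i\<in>F. L2_norm_on M (f i))"
  using assms
proof (induction F rule: infinite_finite_induct)
  case (insert i F)
  have "L2_norm_on M (\<lambda>x. f i x + (\<Sum>i\<in>F. f i x)) \<le> L2_norm_on M (f i) + L2_norm_on M (\<lambda>x. \<Sum>i\<in>F. f i x)"
    using insert by (intro L2_norm_on_triangle square_integrable_sum) auto
  with insert show ?case by simp
qed auto

lemma L2_norm_on_mono:
  assumes "square_integrable M g" "f \<in> borel_measurable M" "AE x in M. \<bar>f x\<bar> \<le> \<bar>g x\<bar>"
  shows "L2_norm_on M f \<le> L2_norm_on M g"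
  unfolding L2_norm_on_def
proof (intro real_sqrt_le_mono integral_mono_AE')
  show "integrable M (\<lambda>x. (g x)\<^sup>2)" using assms(1) by (simp add: square_integrable_def)
  show "AE x in M. (f x)\<^sup>2 \<le> (g x)\<^sup>2"
    using assms(3) by (rule AE_mp) (auto simp: abs_le_square_iff)
qed auto

lemma L2_norm_on_bounded_mult:
  assumes f: "square_integrable M f" and h: "h \<in> borel_measurable M"
    and B: "AE x in M. \<bar>h x\<bar> \<le> B" "0 \<le> B"
  shows "L2_norm_on M (\<lambda>x. h x * f x) \<le> B * L2_norm_on M f"
proof -
  have "L2_norm_on M (\<lambda>x. h x * f x) \<le> L2_norm_on M (\<lambda>x. B * f x)"
  proof (rule L2_norm_on_mono)
    show "square_integrable M (\<lambda>x. B * f x)" using f by (rule square_integrable_cmult)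
    show "(\<lambda>x. h x * f x) \<in> borel_measurable M"
      using square_integrable_bounded_mult[OF f h B(1)] by (rule square_integrable_measurable)
    show "AE x in M. \<bar>h x * f x\<bar> \<le> \<bar>B * f x\<bar>"
      using B(1) by eventually_elim (use B(2) in \<open>simp add: abs_mult mult_right_mono\<close>)
  qed
  then show ?thesis using B(2) by (simp add: L2_norm_on_cmult)
qed

section \<open>Orthogonal families\<close>

lemma coeff_eq_inner: "coeff M p f i = L2_inner M f (p i) / L2_inner M (p i) (p i)"
  by (simp add: coeff_def L2_inner_def power2_eq_square)

locale orthogonal_family =
  fixes M :: "'a measure" and p :: "'i \<Rightarrow> 'a \<Rightarrow> real" and I :: "'i set"
  assumes square_integrable_p: "i \<in> I \<Longrightarrow> square_integrable M (p i)"
    and orthogonal: "i \<in> I \<Longrightarrow> j \<in> I \<Longrightarrow> i \<noteq> j \<Longrightarrow> L2_inner M (p i) (p j) = 0"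
    and inner_pos: "i \<in> I \<Longrightarrow> 0 < L2_inner M (p i) (p i)"
begin

lemma square_integrable_comb:
  "F \<subseteq> I \<Longrightarrow> square_integrable M (\<lambda>x. \<Sum>i\<in>F. a i * p i x)"
  by (intro square_integrable_sum square_integrable_cmult square_integrable_p) auto

lemma inner_comb:
  assumes "finite F" "F \<subseteq> I" "j \<in> I"
  shows "L2_inner M (\<lambda>x. \<Sum>i\<in>F. a i * p i x) (p j)
    = (if j \<in> F then a j * L2_inner M (p j) (p j) else 0)"
proof -
  have "L2_inner M (\<lambda>x. \<Sum>i\<in>F. a i * p i x) (p j) = (\<Sum>i\<in>F. a i * L2_inner M (p i) (p j))"
    using assms by (subst L2_inner_sum_left)
      (auto intro!: square_integrable_cmult square_integrable_p sum.cong simp: L2_inner_cmult_left)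
  also have "\<dots> = (\<Sum>i\<in>F. if i = j then a j * L2_inner M (p j) (p j) else 0)"
    using assms orthogonal by (intro sum.cong) auto
  finally show ?thesis using assms(1) by simp
qed

lemma coeff_comb:
  assumes "finite F" "F \<subseteq> I" "j \<in> I"
  shows "coeff M p (\<lambda>x. \<Sum>i\<in>F. a i * p i x) j = (if j \<in> F then a j else 0)"
  using inner_comb[OF assms, of a] inner_pos[OF assms(3)] by (simp add: coeff_eq_inner)

definition proj :: "'i set \<Rightarrow> ('a \<Rightarrow> real) \<Rightarrow> 'a \<Rightarrow> real" where
  "proj F f x = (\<Sum>i\<in>F. coeff M p f i * p i x)"

lemma square_integrable_proj: "F \<subseteq> I \<Longrightarrow> square_integrable M (proj F f)"
  unfolding proj_def by (rule square_integrable_comb)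

lemma coeff_diff:
  assumes "square_integrable M f" "square_integrable M g" "i \<in> I"
  shows "coeff M p (\<lambda>x. f x - g x) i = coeff M p f i - coeff M p g i"
  using assms square_integrable_p by (simp add: coeff_eq_inner L2_inner_diff_left diff_divide_distrib)

lemma coeff_add:
  assumes "square_integrable M f" "square_integrable M g" "i \<in> I"
  shows "coeff M p (\<lambda>x. f x + g x) i = coeff M p f i + coeff M p g i"
  using assms square_integrable_p by (simp add: coeff_eq_inner L2_inner_add_left add_divide_distrib)

lemma coeff_cmult: "coeff M p (\<lambda>x. a * f x) i = a * coeff M p f i"
  by (simp add: coeff_eq_inner L2_inner_cmult_left)

lemma coeff_proj:
  assumes "finite F" "F \<subseteq> I" "j \<in> I"
  shows "coeff M p (proj F f) j = (if j \<in> F then coeff M p f j else 0)"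
  unfolding proj_def[abs_def] by (rule coeff_comb[OF assms])

lemma inner_residual_comb:
  assumes "finite F" "F \<subseteq> I" "square_integrable M f"
  shows "L2_inner M (\<lambda>x. f x - proj F f x) (\<lambda>x. \<Sum>i\<in>F. a i * p i x) = 0"
proof -
  have sq: "square_integrable M (\<lambda>x. f x - proj F f x)"
    using assms square_integrable_proj square_integrable_diff by blast
  have z: "L2_inner M (\<lambda>x. f x - proj F f x) (p i) = 0" if "i \<in> F" for i
  proof -
    have "i \<in> I" using that assms by auto
    then have "coeff M p (\<lambda>x. f x - proj F f x) i = 0"
      using that assms square_integrable_proj by (simp add: coeff_diff coeff_proj)
    then show ?thesis using inner_pos[OF \<open>i \<in> I\<close>] by (simp add: coeff_eq_inner)
  qed
  have "L2_inner M (\<lambda>x. \<Sum>i\<in>F. a i * p i x) (\<lambda>x. f x - proj F f x)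
      = (\<Sum>i\<in>F. a i * L2_inner M (p i) (\<lambda>x. f x - proj F f x))"
    using assms(2) sq by (subst L2_inner_sum_left)
      (auto intro!: square_integrable_cmult square_integrable_p simp: L2_inner_cmult_left)
  also have "\<dots> = 0" using z by (intro sum.neutral) (simp add: L2_inner_commute)
  finally show ?thesis by (simp add: L2_inner_commute)
qed

lemma norm_proj:
  assumes "finite F" "F \<subseteq> I"
  shows "L2_inner M (proj F f) (proj F f) = (\<Sum>i\<in>F. (coeff M p f i)\<^sup>2 * L2_inner M (p i) (p i))"
proof -
  have "L2_inner M (proj F f) (proj F f) = (\<Sum>i\<in>F. coeff M p f i * L2_inner M (p i) (proj F f))"
    unfolding proj_def[of F f] using assms
    by (subst L2_inner_sum_left)
      (auto intro!: square_integrable_comb square_integrable_cmult square_integrable_p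
        simp: L2_inner_cmult_left)
  also have "\<dots> = (\<Sum>i\<in>F. (coeff M p f i)\<^sup>2 * L2_inner M (p i) (p i))"
  proof (intro sum.cong refl)
    fix i assume i: "i \<in> F"
    then have "i \<in> I" using assms(2) by auto
    then have "coeff M p (proj F f) i = coeff M p f i" using coeff_proj[OF assms, of i f] i by simp
    then have "L2_inner M (p i) (proj F f) = coeff M p f i * L2_inner M (p i) (p i)"
      using inner_pos[of i] i assms
      by (auto simp: coeff_eq_inner[of M p "proj F f"] L2_inner_commute field_simps)
    then show "coeff M p f i * L2_inner M (p i) (proj F f) = (coeff M p f i)\<^sup>2 * L2_inner M (p i) (p i)"
      by (simp add: power2_eq_square)
  qed
  finally show ?thesis .
qed

lemma Pythagoras_proj:
  assumes "finite F" "F \<subseteq> I" "square_integrable M f"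
  shows "L2_inner M f f
    = L2_inner M (proj F f) (proj F f) + L2_inner M (\<lambda>x. f x - proj F f x) (\<lambda>x. f x - proj F f x)"
proof -
  let ?P = "proj F f" and ?R = "\<lambda>x. f x - proj F f x"
  have sq: "square_integrable M ?P" "square_integrable M ?R"
    using assms square_integrable_proj square_integrable_diff by blast+
  have orth: "L2_inner M ?R ?P = 0"
    using inner_residual_comb[OF assms, of "coeff M p f"] by (simp add: proj_def[abs_def])
  have "L2_inner M ?R ?R = L2_inner M f ?R - L2_inner M ?P ?R"
    using assms sq by (intro L2_inner_diff_left)
  also have "\<dots> = L2_inner M ?R f" using orth by (simp add: L2_inner_commute)
  also have "\<dots> = L2_inner M f f - L2_inner M ?P f" using assms sq by (intro L2_inner_diff_left)
  finally have 1: "L2_inner M ?R ?R = L2_inner M f f - L2_inner M ?P f" .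
  have "L2_inner M ?R ?P = L2_inner M f ?P - L2_inner M ?P ?P"
    using assms sq by (intro L2_inner_diff_left)
  with orth 1 show ?thesis by (simp add: L2_inner_commute)
qed

lemma Bessel:
  assumes "finite F" "F \<subseteq> I" "square_integrable M f"
  shows "(\<Sum>i\<in>F. (coeff M p f i)\<^sup>2 * L2_inner M (p i) (p i)) \<le> L2_inner M f f"
  using Pythagoras_proj[OF assms] norm_proj[OF assms(1,2), of f] by simp

lemma norm_proj_le:
  assumes "finite F" "F \<subseteq> I" "square_integrable M f"
  shows "L2_norm_on M (proj F f) \<le> L2_norm_on M f"
  unfolding L2_norm_on_alt using Pythagoras_proj[OF assms] by (intro real_sqrt_le_mono) simp

lemma norm_residual_le:
  assumes "finite F" "F \<subseteq> I" "square_integrable M f"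
  shows "L2_norm_on M (\<lambda>x. f x - proj F f x) \<le> L2_norm_on M f"
  unfolding L2_norm_on_alt using Pythagoras_proj[OF assms] by (intro real_sqrt_le_mono) simp

lemma coeff_norm_le:
  assumes "i \<in> I" "square_integrable M f"
  shows "\<bar>coeff M p f i\<bar> * L2_norm_on M (p i) \<le> L2_norm_on M f"
proof (rule power2_le_imp_le)
  show "(\<bar>coeff M p f i\<bar> * L2_norm_on M (p i))\<^sup>2 \<le> (L2_norm_on M f)\<^sup>2"
    using Bessel[of "{i}" f] assms by (simp add: L2_norm_on_power2 power_mult_distrib)
qed simp

lemma proj_comb:
  assumes "finite F" "G \<subseteq> F" "F \<subseteq> I"
  shows "proj F (\<lambda>x. \<Sum>i\<in>G. a i * p i x) x = (\<Sum>i\<in>G. a i * p i x)"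
proof -
  have "proj F (\<lambda>x. \<Sum>i\<in>G. a i * p i x) x = (\<Sum>j\<in>F. (if j \<in> G then a j else 0) * p j x)"
    unfolding proj_def using assms finite_subset
    by (intro sum.cong refl) (subst coeff_comb, auto intro: finite_subset)
  also have "\<dots> = (\<Sum>j\<in>G. a j * p j x)"
    using assms by (intro sum.mono_neutral_cong_right) auto
  finally show ?thesis .
qed

lemma proj_best:
  assumes "finite F" "G \<subseteq> F" "F \<subseteq> I" "square_integrable M f"
  shows "L2_norm_on M (\<lambda>x. f x - proj F f x) \<le> L2_norm_on M (\<lambda>x. f x - (\<Sum>i\<in>G. a i * p i x))"
proof -
  let ?g = "\<lambda>x. \<Sum>i\<in>G. a i * p i x"
  have sg: "square_integrable M ?g" using assms by (intro square_integrable_comb) auto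
  have "proj F (\<lambda>x. f x - ?g x) x = proj F f x - ?g x" for x
  proof -
    have "coeff M p (\<lambda>x. f x - ?g x) i = coeff M p f i - coeff M p ?g i" if "i \<in> F" for i
      using that assms(3,4) sg by (intro coeff_diff) auto
    then have "proj F (\<lambda>x. f x - ?g x) x = proj F f x - proj F ?g x"
      unfolding proj_def by (simp add: left_diff_distrib sum_subtractf)
    then show ?thesis using proj_comb[OF assms(1-3)] by simp
  qed
  then have "(\<lambda>x. (f x - ?g x) - proj F (\<lambda>x. f x - ?g x) x) = (\<lambda>x. f x - proj F f x)"
    by auto
  moreover have "L2_norm_on M (\<lambda>x. (f x - ?g x) - proj F (\<lambda>x. f x - ?g x) x)
      \<le> L2_norm_on M (\<lambda>x. f x - ?g x)"
    using assms(1,3) square_integrable_diff[OF assms(4) sg] by (rule norm_residual_le)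
  ultimately show ?thesis by simp
qed

definition approximable :: "('a \<Rightarrow> real) \<Rightarrow> bool" where
  "approximable f \<longleftrightarrow> (\<forall>e>0. \<exists>F a. finite F \<and> F \<subseteq> I \<and>
     L2_norm_on M (\<lambda>x. f x - (\<Sum>i\<in>F. a i * p i x)) < e)"

lemma approximable_comb:
  assumes F: "finite F" "F \<subseteq> I" and g: "g \<in> borel_measurable M" and ae: "AE x in M. g x = (\<Sum>i\<in>F. a i * p i x)"
  shows "approximable g"
  unfolding approximable_def
proof (intro allI impI exI[of _ F] exI[of _ a] conjI F)
  fix e :: real assume "0 < e"
  have "(\<lambda>x. \<Sum>i\<in>F. a i * p i x) \<in> borel_measurable M"
    using square_integrable_comb[OF F(2)] by (rule square_integrable_measurable)
  then have "L2_norm_on M (\<lambda>x. g x - (\<Sum>i\<in>F. a i * p i x)) \<le> L2_norm_on M (\<lambda>x. 0)"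
    using ae g by (intro L2_norm_on_mono) auto
  with \<open>0 < e\<close> show "L2_norm_on M (\<lambda>x. g x - (\<Sum>i\<in>F. a i * p i x)) < e" by simp
qed

lemma approximable_limit:
  assumes f: "square_integrable M f"
    and g: "\<And>e. 0 < e \<Longrightarrow> \<exists>g. square_integrable M g \<and> approximable g \<and> L2_norm_on M (\<lambda>x. f x - g x) < e"
  shows "approximable f"
  unfolding approximable_def
proof (intro allI impI)
  fix e :: real assume "0 < e"
  then obtain g where g: "square_integrable M g" "approximable g" "L2_norm_on M (\<lambda>x. f x - g x) < e / 2"
    using g[of "e / 2"] by auto
  from \<open>0 < e\<close> have "0 < e / 2" by simp
  with g(2) obtain F a where F: "finite F" "F \<subseteq> I" "L2_norm_on M (\<lambda>x. g x - (\<Sum>i\<in>F. a i * p i x)) < e / 2"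
    unfolding approximable_def by meson
  have "L2_norm_on M (\<lambda>x. (f x - g x) + (g x - (\<Sum>i\<in>F. a i * p i x)))
      \<le> L2_norm_on M (\<lambda>x. f x - g x) + L2_norm_on M (\<lambda>x. g x - (\<Sum>i\<in>F. a i * p i x))"
    using f g(1) square_integrable_comb[OF F(2)] by (intro L2_norm_on_triangle square_integrable_diff)
  then have "L2_norm_on M (\<lambda>x. f x - (\<Sum>i\<in>F. a i * p i x)) < e" using g(3) F(3) by simp
  with F show "\<exists>F a. finite F \<and> F \<subseteq> I \<and> L2_norm_on M (\<lambda>x. f x - (\<Sum>i\<in>F. a i * p i x)) < e"
    by (intro exI[of _ F] exI[of _ a]) simp
qed

lemma Parseval:
  assumes f: "square_integrable M f" and g: "square_integrable M g" and dense: "approximable f"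
  shows "((\<lambda>i. L2_inner M g (p i) * coeff M p f i) has_sum L2_inner M g f) I"
  unfolding has_sum_def
proof (rule tendstoI)
  fix e :: real assume e: "e > 0"
  define e' where "e' = e / (L2_norm_on M g + 1)"
  have e': "e' > 0" using e by (simp add: e'_def add_nonneg_pos)
  obtain G a where G: "finite G" "G \<subseteq> I" "L2_norm_on M (\<lambda>x. f x - (\<Sum>i\<in>G. a i * p i x)) < e'"
  proof -
    from dense e' obtain G where "\<exists>a. finite G \<and> G \<subseteq> I \<and> L2_norm_on M (\<lambda>x. f x - (\<Sum>i\<in>G. a i * p i x)) < e'"
      unfolding approximable_def by meson
    then obtain a where "finite G \<and> G \<subseteq> I \<and> L2_norm_on M (\<lambda>x. f x - (\<Sum>i\<in>G. a i * p i x)) < e'" ..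
    then show ?thesis using that[of G a] by simp
  qed
  have est: "dist (\<Sum>i\<in>F. L2_inner M g (p i) * coeff M p f i) (L2_inner M g f) < e"
    if F: "finite F" "G \<subseteq> F" "F \<subseteq> I" for F
  proof -
    have sP: "square_integrable M (proj F f)" and sR: "square_integrable M (\<lambda>x. f x - proj F f x)"
      using square_integrable_proj[OF F(3)] square_integrable_diff[OF f square_integrable_proj[OF F(3)]]
      by simp_all
    have "L2_inner M (proj F f) g = (\<Sum>i\<in>F. L2_inner M (\<lambda>x. coeff M p f i * p i x) g)"
      unfolding proj_def[abs_def] using F(3) g
      by (intro L2_inner_sum_left square_integrable_cmult square_integrable_p) auto
    then have "L2_inner M (proj F f) g = (\<Sum>i\<in>F. coeff M p f i * L2_inner M (p i) g)"
      by (simp only: L2_inner_cmult_left)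
    then have 1: "L2_inner M (proj F f) g = (\<Sum>i\<in>F. L2_inner M g (p i) * coeff M p f i)"
      by (simp add: mult.commute L2_inner_commute[of M g])
    have 2: "\<bar>L2_inner M (\<lambda>x. f x - proj F f x) g\<bar> \<le> L2_norm_on M (\<lambda>x. f x - proj F f x) * L2_norm_on M g"
      using sR g by (rule L2_inner_Cauchy_Schwarz)
    have "L2_norm_on M (\<lambda>x. f x - proj F f x) \<le> L2_norm_on M (\<lambda>x. f x - (\<Sum>i\<in>G. a i * p i x))"
      by (rule proj_best[OF F f])
    with G(3) have "L2_norm_on M (\<lambda>x. f x - proj F f x) \<le> e'" by simp
    then have 3: "L2_norm_on M (\<lambda>x. f x - proj F f x) * L2_norm_on M g \<le> e' * L2_norm_on M g"
      by (intro mult_right_mono) simp_all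
    have "L2_norm_on M g + 1 \<noteq> 0" using L2_norm_on_nonneg[of M g] by linarith
    then have "e' * (L2_norm_on M g + 1) = e" by (simp add: e'_def)
    then have 4: "e' * L2_norm_on M g + e' = e" by (simp add: distrib_left)
    have 5: "L2_inner M (\<lambda>x. f x - proj F f x) g = L2_inner M g f - L2_inner M (proj F f) g"
      unfolding L2_inner_diff_left[OF f sP g] L2_inner_commute[of M g f] ..
    show ?thesis
      using 2 3 4 e' unfolding 5 1 dist_real_def by linarith
  qed
  then show "\<forall>\<^sub>F F in finite_subsets_at_top I.
      dist (\<Sum>i\<in>F. L2_inner M g (p i) * coeff M p f i) (L2_inner M g f) < e"
    unfolding eventually_finite_subsets_at_top using G by (intro exI[of _ G]) auto
qed

end

section \<open>Square summable sequences\<close>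

lemma ell2_iff_square_integrable: "v \<in> ell2 \<longleftrightarrow> square_integrable (count_space UNIV) v"
  by (simp add: ell2_def square_integrable_def integrable_count_space_nat_iff)

lemma ell2_norm_eq_L2_norm:
  assumes "v \<in> ell2"
  shows "ell2_norm v = L2_norm_on (count_space UNIV) v"
proof -
  have "integrable (count_space UNIV) (\<lambda>n. (v n)\<^sup>2)"
    using assms by (simp add: ell2_def integrable_count_space_nat_iff)
  then show ?thesis
    by (simp add: ell2_norm_def L2_norm_on_def integral_count_space_nat)
qed

lemma ell2_add: "u \<in> ell2 \<Longrightarrow> v \<in> ell2 \<Longrightarrow> (\<lambda>i. u i + v i) \<in> ell2"
  by (simp add: ell2_iff_square_integrable square_integrable_add)

lemma ell2_diff': "u \<in> ell2 \<Longrightarrow> v \<in> ell2 \<Longrightarrow> (\<lambda>i. u i - v i) \<in> ell2"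
  by (simp add: ell2_iff_square_integrable square_integrable_diff)

lemma ell2_diff: "u \<in> ell2 \<Longrightarrow> v \<in> ell2 \<Longrightarrow> u - v \<in> ell2"
  using ell2_diff' by (simp add: fun_diff_def)

lemma ell2_cmult: "u \<in> ell2 \<Longrightarrow> (\<lambda>i. a * u i) \<in> ell2"
  by (simp add: ell2_iff_square_integrable square_integrable_cmult)

lemma ell2_zero [simp]: "(\<lambda>i. 0) \<in> ell2"
  by (simp add: ell2_def)

lemma ell2_norm_nonneg: "u \<in> ell2 \<Longrightarrow> 0 \<le> ell2_norm u"
  by (simp add: ell2_norm_eq_L2_norm)

lemma ell2_norm_zero [simp]: "ell2_norm (\<lambda>i. 0) = 0"
  by (simp add: ell2_norm_def)

lemma ell2_norm_triangle:
  "u \<in> ell2 \<Longrightarrow> v \<in> ell2 \<Longrightarrow> ell2_norm (\<lambda>i. u i + v i) \<le> ell2_norm u + ell2_norm v"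
  using L2_norm_on_triangle[of "count_space UNIV" u v]
  by (simp add: ell2_norm_eq_L2_norm ell2_add) (simp add: ell2_iff_square_integrable)

lemma ell2_norm_triangle_diff:
  "u \<in> ell2 \<Longrightarrow> v \<in> ell2 \<Longrightarrow> ell2_norm (\<lambda>i. u i - v i) \<le> ell2_norm u + ell2_norm v"
  using L2_norm_on_triangle_diff[of "count_space UNIV" u v]
  by (simp add: ell2_norm_eq_L2_norm ell2_diff') (simp add: ell2_iff_square_integrable)

lemma ell2_norm_cmult: "u \<in> ell2 \<Longrightarrow> ell2_norm (\<lambda>i. a * u i) = \<bar>a\<bar> * ell2_norm u"
  by (simp add: ell2_norm_eq_L2_norm ell2_cmult L2_norm_on_cmult)

lemma ell2_norm_power2: "u \<in> ell2 \<Longrightarrow> (ell2_norm u)\<^sup>2 = (\<Sum>i. (u i)\<^sup>2)"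
  by (simp add: ell2_norm_def ell2_def suminf_nonneg)

lemma sum_power2_le_ell2_norm:
  assumes "u \<in> ell2" "finite F"
  shows "(\<Sum>i\<in>F. (u i)\<^sup>2) \<le> (ell2_norm u)\<^sup>2"
proof -
  have "summable (\<lambda>i. (u i)\<^sup>2)" using assms by (simp add: ell2_def)
  then have "(\<Sum>i\<in>F. (u i)\<^sup>2) \<le> (\<Sum>i. (u i)\<^sup>2)" using assms(2) by (intro sum_le_suminf) auto
  then show ?thesis by (simp only: ell2_norm_power2[OF assms(1)])
qed

lemma abs_le_ell2_norm: "u \<in> ell2 \<Longrightarrow> \<bar>u i\<bar> \<le> ell2_norm u"
  using sum_power2_le_ell2_norm[of u "{i}"] ell2_norm_nonneg[of u]
    power2_le_imp_le[of "\<bar>u i\<bar>" "ell2_norm u"] by simp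

lemma ell2_norm_leI:
  assumes "\<And>n. (\<Sum>i<n. (u i)\<^sup>2) \<le> C\<^sup>2" "0 \<le> C"
  shows "u \<in> ell2" "ell2_norm u \<le> C"
proof -
  show u: "u \<in> ell2"
    unfolding ell2_def mem_Collect_eq using assms(1) by (intro summableI_nonneg_bounded) auto
  have "(ell2_norm u)\<^sup>2 \<le> C\<^sup>2"
    unfolding ell2_norm_power2[OF u] using u assms(1) by (intro suminf_le_const) (simp_all add: ell2_def)
  then show "ell2_norm u \<le> C" using assms(2) by (rule power2_le_imp_le)
qed

lemma ell2_norm_mono:
  assumes "v \<in> ell2" "\<And>i. \<bar>u i\<bar> \<le> \<bar>v i\<bar>"
  shows "u \<in> ell2" "ell2_norm u \<le> ell2_norm v"
proof -
  have "(\<Sum>i<n. (u i)\<^sup>2) \<le> (ell2_norm v)\<^sup>2" for n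
  proof -
    have "(\<Sum>i<n. (u i)\<^sup>2) \<le> (\<Sum>i<n. (v i)\<^sup>2)"
      using assms(2) by (intro sum_mono) (simp add: abs_le_square_iff)
    also have "\<dots> \<le> (ell2_norm v)\<^sup>2" using assms(1) by (intro sum_power2_le_ell2_norm) auto
    finally show ?thesis .
  qed
  from ell2_norm_leI[OF this ell2_norm_nonneg[OF assms(1)]]
  show "u \<in> ell2" "ell2_norm u \<le> ell2_norm v" by auto
qed

lemma ell2_norm_eq_0:
  assumes "u \<in> ell2" "ell2_norm u \<le> 0"
  shows "u = (\<lambda>i. 0)"
  using abs_le_ell2_norm[OF assms(1)] assms(2) by (intro ext) (meson abs_le_zero_iff order_trans)

definition tail :: "nat \<Rightarrow> (nat \<Rightarrow> real) \<Rightarrow> nat \<Rightarrow> real" where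
  "tail n v = (\<lambda>i. if i < n then 0 else v i)"

lemma diff_trunc: "v - trunc n v = tail n v"
  by (auto simp: tail_def trunc_def)

lemma ell2_trunc [simp]: "trunc n v \<in> ell2"
  unfolding ell2_def trunc_def mem_Collect_eq by (rule summable_finite[of "{..<n}"]) auto

lemma ell2_norm_trunc_le: "v \<in> ell2 \<Longrightarrow> ell2_norm (trunc n v) \<le> ell2_norm v"
  by (rule ell2_norm_mono) (auto simp: trunc_def)

lemma ell2_tail: "v \<in> ell2 \<Longrightarrow> tail n v \<in> ell2"
  by (rule ell2_norm_mono) (auto simp: tail_def)

lemma ell2_norm_tail_le: "v \<in> ell2 \<Longrightarrow> ell2_norm (tail n v) \<le> ell2_norm v"
  by (rule ell2_norm_mono) (auto simp: tail_def)

lemma ell2_norm_tail_tendsto_0: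
  assumes "v \<in> ell2"
  shows "(\<lambda>n. ell2_norm (tail n v)) \<longlonglongrightarrow> 0"
proof -
  let ?f = "\<lambda>i. (v i)\<^sup>2"
  have s: "summable ?f" using assms by (simp add: ell2_def)
  have "ell2_norm (tail n v) = sqrt (suminf ?f - sum ?f {..<n})" for n
  proof -
    have "(\<lambda>i. (tail n v i)\<^sup>2) = (\<lambda>i. ?f i - (if i \<in> {..<n} then ?f i else 0))"
      by (auto simp: tail_def)
    moreover have "(\<lambda>i. ?f i - (if i \<in> {..<n} then ?f i else 0)) sums (suminf ?f - sum ?f {..<n})"
      using s by (intro sums_diff summable_sums sums_If_finite_set) auto
    ultimately show ?thesis unfolding ell2_norm_def by (simp add: sums_iff)
  qed
  moreover have "(\<lambda>n. sqrt (suminf ?f - sum ?f {..<n})) \<longlonglongrightarrow> sqrt (suminf ?f - suminf ?f)"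
    using s by (intro tendsto_intros summable_LIMSEQ)
  ultimately show ?thesis by simp
qed

section \<open>Finite linear systems\<close>

lemma underdetermined_system:
  fixes M :: "'e \<Rightarrow> 'i \<Rightarrow> real"
  assumes "finite E" "finite J" "card E < card J"
  shows "\<exists>x. (\<exists>i\<in>J. x i \<noteq> 0) \<and> (\<forall>e\<in>E. (\<Sum>i\<in>J. M e i * x i) = 0)"
  using assms
proof (induction E arbitrary: J M rule: finite_induct)
  case empty
  then obtain i where "i \<in> J" by fastforce
  then show ?case by (intro exI[of _ "\<lambda>_. 1"]) auto
next
  case (insert e E)
  show ?case
  proof (cases "\<forall>i\<in>J. M e i = 0")
    case True
    have "card E < card J" using insert by simp
    then obtain x where "\<exists>i\<in>J. x i \<noteq> 0" "\<forall>e\<in>E. (\<Sum>i\<in>J. M e i * x i) = 0"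
      using insert.IH[OF insert.prems(1)] by blast
    then show ?thesis using True by (intro exI[of _ x]) auto
  next
    case False
    then obtain k where k: "k \<in> J" "M e k \<noteq> 0" by blast
    define M' where "M' e' i = M e' i - M e' k / M e k * M e i" for e' i
    have "card E < card (J - {k})" using insert k by simp
    then obtain x where x: "\<exists>i\<in>J - {k}. x i \<noteq> 0" "\<forall>e\<in>E. (\<Sum>i\<in>J - {k}. M' e i * x i) = 0"
      using insert.IH[of "J - {k}" M'] insert.prems(1) by blast
    define y where "y = x(k := - (\<Sum>i\<in>J - {k}. M e i * x i) / M e k)"
    have split: "(\<Sum>i\<in>J. M e' i * y i) = M e' k * y k + (\<Sum>i\<in>J - {k}. M e' i * x i)" for e'
    proof -
      have "(\<Sum>i\<in>J. M e' i * y i) = M e' k * y k + (\<Sum>i\<in>J - {k}. M e' i * y i)"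
        using insert.prems(1) k by (simp add: sum.remove)
      also have "(\<Sum>i\<in>J - {k}. M e' i * y i) = (\<Sum>i\<in>J - {k}. M e' i * x i)"
        by (intro sum.cong) (auto simp: y_def)
      finally show ?thesis .
    qed
    have "(\<Sum>i\<in>J. M e i * y i) = 0" using k by (simp add: split) (simp add: y_def)
    moreover have "(\<Sum>i\<in>J. M e' i * y i) = 0" if "e' \<in> E" for e'
    proof -
      have "(\<Sum>i\<in>J - {k}. M' e' i * x i)
          = (\<Sum>i\<in>J - {k}. M e' i * x i) - M e' k / M e k * (\<Sum>i\<in>J - {k}. M e i * x i)"
        by (simp add: M'_def left_diff_distrib sum_subtractf sum_distrib_left mult.assoc)
      then show ?thesis using x that k by (simp add: split) (simp add: y_def)
    qed
    moreover have "\<exists>i\<in>J. y i \<noteq> 0" using x(1) by (auto simp: y_def)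
    ultimately show ?thesis by (intro exI[of _ y]) auto
  qed
qed

lemma injective_square_system_solvable:
  fixes M :: "nat \<Rightarrow> nat \<Rightarrow> real"
  assumes inj: "\<And>x. (\<And>j. j < n \<Longrightarrow> (\<Sum>i<n. M j i * x i) = 0) \<Longrightarrow> (\<And>i. i < n \<Longrightarrow> x i = 0)"
  shows "\<exists>x. \<forall>j<n. (\<Sum>i<n. M j i * x i) = b j"
proof -
  have "\<exists>x. (\<exists>i\<in>{..<Suc n}. x i \<noteq> 0) \<and>
      (\<forall>j\<in>{..<n}. (\<Sum>i<Suc n. ((M j)(n := - b j)) i * x i) = 0)"
    by (intro underdetermined_system) auto
  then obtain x where x: "\<exists>i<Suc n. x i \<noteq> 0"
    "\<And>j. j < n \<Longrightarrow> (\<Sum>i<Suc n. ((M j)(n := - b j)) i * x i) = 0"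
    by auto
  have eq: "(\<Sum>i<n. M j i * x i) = b j * x n" if "j < n" for j
  proof -
    have "(\<Sum>i<n. ((M j)(n := - b j)) i * x i) = (\<Sum>i<n. M j i * x i)"
      by (intro sum.cong) auto
    then show ?thesis using x(2)[OF that] by simp
  qed
  have "x n \<noteq> 0"
  proof
    assume 0: "x n = 0"
    then have "x i = 0" if "i < n" for i using inj[OF _ that, of x] eq by simp
    with 0 x(1) show False by (auto simp: less_Suc_eq)
  qed
  then have "(\<Sum>i<n. M j i * (x i / x n)) = b j" if "j < n" for j
    using eq[OF that] by (simp add: sum_divide_distrib[symmetric])
  then show ?thesis by (intro exI[of _ "\<lambda>i. x i / x n"]) auto
qed

section \<open>Linear operators on square summable sequences\<close>

locale ell2_operator =
  fixes A :: "(nat \<Rightarrow> real) \<Rightarrow> nat \<Rightarrow> real"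
  assumes ell2_op: "u \<in> ell2 \<Longrightarrow> A u \<in> ell2"
    and op_add: "u \<in> ell2 \<Longrightarrow> v \<in> ell2 \<Longrightarrow> A (\<lambda>i. u i + v i) = (\<lambda>i. A u i + A v i)"
    and op_cmult: "u \<in> ell2 \<Longrightarrow> A (\<lambda>i. a * u i) = (\<lambda>i. a * A u i)"
begin

lemma op_diff:
  assumes "u \<in> ell2" "v \<in> ell2"
  shows "A (\<lambda>i. u i - v i) = (\<lambda>i. A u i - A v i)"
proof -
  have "A (\<lambda>i. u i + (-1) * v i) = (\<lambda>i. A u i + (-1) * A v i)"
    using op_add[OF assms(1) ell2_cmult[OF assms(2), of "-1"]] op_cmult[OF assms(2), of "-1"] by simp
  then show ?thesis by simp
qed

lemma op_zero: "A (\<lambda>i. 0) = (\<lambda>i. 0)"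
  using op_cmult[of "\<lambda>i. 0" 0] by simp

lemma op_sum:
  assumes "finite F" "\<And>k. k \<in> F \<Longrightarrow> u k \<in> ell2"
  shows "(\<lambda>i. \<Sum>k\<in>F. u k i) \<in> ell2 \<and> A (\<lambda>i. \<Sum>k\<in>F. u k i) = (\<lambda>i. \<Sum>k\<in>F. A (u k) i)"
  using assms by (induction F rule: finite_induct) (simp_all add: op_zero ell2_add op_add)

end

lemma trunc_eq_sum_unit: "trunc n v = (\<lambda>i. \<Sum>k<n. v k * (if i = k then 1 else 0))"
proof
  fix i
  have "(\<Sum>k<n. v k * (if i = k then 1 else 0)) = (\<Sum>k<n. if k = i then v k else 0)"
    by (intro sum.cong) auto
  then show "trunc n v i = (\<Sum>k<n. v k * (if i = k then 1 else 0))"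
    by (simp add: trunc_def)
qed

lemma unit_in_ell2: "(\<lambda>i. if i = k then 1 else 0) \<in> ell2"
  unfolding ell2_def mem_Collect_eq by (rule summable_finite[of "{k}"]) auto

text \<open>
  For \<open>v\<close> in the range of \<open>trunc n\<close> put \<open>r = v - trunc n (A v)\<close> and \<open>w = r + A v\<close> (the Sloan
  iterate). Then \<open>trunc n w = v\<close> and \<open>w - A w = r - A (tail n (A v))\<close>, so that smallness of
  \<open>A (tail n (A v))\<close> is enough for stability; \<open>tail n (A v)\<close> itself need not be small.
\<close>

lemma (in ell2_operator) truncation_stable:
  assumes below: "\<And>u. u \<in> ell2 \<Longrightarrow> ell2_norm u \<le> D * ell2_norm (\<lambda>i. u i - A u i)"
    and D: "0 \<le> D"
    and small: "\<And>u. u \<in> ell2 \<Longrightarrow> ell2_norm (A (tail n (A u))) \<le> e * ell2_norm u"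
    and e: "D * e \<le> 1 / 2"
    and v: "v \<in> range (trunc n)"
  shows "ell2_norm v \<le> 2 * D * ell2_norm (trunc n (\<lambda>i. v i - A v i))"
proof -
  define r where "r = trunc n (\<lambda>i. v i - A v i)"
  define w where "w = (\<lambda>i. r i + A v i)"
  have v2: "v \<in> ell2" using v by auto
  have vn: "v i = 0" if "\<not> i < n" for i using v that by (auto simp: trunc_def)
  have r2: "r \<in> ell2" by (simp add: r_def)
  have t2: "tail n (A v) \<in> ell2" using v2 by (intro ell2_tail ell2_op)
  have w2: "w \<in> ell2" using r2 v2 by (simp add: w_def ell2_add ell2_op)
  have w: "w = (\<lambda>i. v i + tail n (A v) i)"
    using vn by (auto simp: w_def r_def trunc_def tail_def)
  have "A w = (\<lambda>i. A v i + A (tail n (A v)) i)"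
    unfolding w using v2 t2 by (rule op_add)
  then have "(\<lambda>i. w i - A w i) = (\<lambda>i. r i - A (tail n (A v)) i)"
    by (auto simp: w_def)
  then have "ell2_norm (\<lambda>i. w i - A w i) \<le> ell2_norm r + ell2_norm (A (tail n (A v)))"
    using ell2_norm_triangle_diff[OF r2 ell2_op[OF t2]] by simp
  also have "\<dots> \<le> ell2_norm r + e * ell2_norm v"
    using small[OF v2] by simp
  finally have "D * ell2_norm (\<lambda>i. w i - A w i) \<le> D * (ell2_norm r + e * ell2_norm v)"
    using D by (rule mult_left_mono)
  moreover have "D * e * ell2_norm v \<le> 1 / 2 * ell2_norm v"
    using e ell2_norm_nonneg[OF v2] by (rule mult_right_mono)
  moreover have "ell2_norm v \<le> ell2_norm w"
    using w2 vn by (intro ell2_norm_mono(2)) (auto simp: w tail_def)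
  ultimately have "ell2_norm v \<le> D * ell2_norm r + 1 / 2 * ell2_norm v"
    using below[OF w2] by (simp add: algebra_simps)
  then show ?thesis by (simp add: r_def)
qed

lemma (in ell2_operator) truncated_solution_ex1:
  assumes stable: "\<And>v. v \<in> range (trunc n) \<Longrightarrow>
      ell2_norm v \<le> C * ell2_norm (trunc n (\<lambda>i. v i - A v i))"
  shows "\<exists>!v. truncated_solution A g n v"
proof -
  define unit :: "nat \<Rightarrow> nat \<Rightarrow> real" where "unit k = (\<lambda>i. if i = k then 1 else 0)" for k
  have unit: "unit k \<in> ell2" for k by (simp add: unit_def unit_in_ell2)
  define M where "M j k = unit k j - A (unit k) j" for j k
  have Mx: "trunc n x j - A (trunc n x) j = (\<Sum>k<n. M j k * x k)" for x j
  proof -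
    have "trunc n x = (\<lambda>i. \<Sum>k<n. x k * unit k i)"
      by (simp add: trunc_eq_sum_unit unit_def)
    moreover have "A (\<lambda>i. \<Sum>k<n. x k * unit k i) = (\<lambda>i. \<Sum>k<n. x k * A (unit k) i)"
      using op_sum[of "{..<n}" "\<lambda>k i. x k * unit k i"] unit op_cmult[OF unit]
      by (simp add: ell2_cmult)
    ultimately show ?thesis
      by (simp add: M_def sum_subtractf[symmetric] algebra_simps)
  qed
  have inj: "x i = 0" if z: "\<And>j. j < n \<Longrightarrow> (\<Sum>k<n. M j k * x k) = 0" and i: "i < n" for x i
  proof -
    have "trunc n (\<lambda>i. trunc n x i - A (trunc n x) i) = (\<lambda>i. 0)"
      using z unfolding Mx by (auto simp: trunc_def)
    then have "ell2_norm (trunc n x) \<le> 0" using stable[of "trunc n x"] by simp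
    then have "trunc n x i = 0" using ell2_norm_eq_0[OF ell2_trunc] by metis
    then show ?thesis using i by (simp add: trunc_def)
  qed
  have "\<exists>x. \<forall>j<n. (\<Sum>k<n. M j k * x k) = g j"
    by (rule injective_square_system_solvable) (use inj in blast)
  then obtain x where x: "\<forall>j<n. (\<Sum>k<n. M j k * x k) = g j" ..
  have "truncated_solution A g n (trunc n x)"
  proof -
    have "trunc n x j - A (trunc n x) j = g j" if "j < n" for j using x Mx that by simp
    then have "trunc n (trunc n x - A (trunc n x)) = trunc n g"
      unfolding trunc_def[of n "trunc n x - A (trunc n x)"] trunc_def[of n g] by auto
    then show ?thesis by (simp add: truncated_solution_def)
  qed
  moreover have "v = v'" if v: "truncated_solution A g n v" and v': "truncated_solution A g n v'" for v v'
  proof -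
    obtain x x' where xx: "v = trunc n x" "v' = trunc n x'"
      using v v' by (auto simp: truncated_solution_def)
    have "(\<Sum>k<n. M j k * (x k - x' k)) = 0" if "j < n" for j
    proof -
      have "trunc n (v - A v) j = trunc n (v' - A v') j"
        using v v' by (simp add: truncated_solution_def)
      then show ?thesis
        using that Mx[of x j] Mx[of x' j]
        by (simp add: xx right_diff_distrib sum_subtractf) (simp add: trunc_def)
    qed
    then have "x i - x' i = 0" if "i < n" for i using inj[OF _ that, of "\<lambda>k. x k - x' k"] by blast
    then show ?thesis by (auto simp: xx trunc_def)
  qed
  ultimately show ?thesis by blast
qed

lemma (in ell2_operator) truncation_error:
  assumes stable: "\<And>v. v \<in> range (trunc n) \<Longrightarrow>
      ell2_norm v \<le> C * ell2_norm (trunc n (\<lambda>i. v i - A v i))"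
    and C: "0 \<le> C"
    and bounded: "\<And>u. u \<in> ell2 \<Longrightarrow> ell2_norm (A u) \<le> B * ell2_norm u"
    and u: "u \<in> ell2" "u - A u = g" and v: "truncated_solution A g n v"
  shows "ell2_norm (u - v) \<le> (1 + C * B) * ell2_norm (u - trunc n u)"
proof -
  have v2: "v \<in> ell2" using v by (auto simp: truncated_solution_def)
  define d where "d = (\<lambda>i. v i - trunc n u i)"
  have "d \<in> range (trunc n)"
  proof (rule image_eqI)
    show "d = trunc n d" using v by (auto simp: d_def truncated_solution_def trunc_def)
  qed simp
  have t2: "tail n u \<in> ell2" using u by (simp add: ell2_tail)
  have eq: "trunc n (\<lambda>i. d i - A d i) = trunc n (\<lambda>i. (-1) * A (tail n u) i)"
  proof -
    have Ad: "A d i = A v i - A (trunc n u) i" for i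
      unfolding d_def using v2 by (simp add: op_diff)
    have "u = (\<lambda>i. trunc n u i + tail n u i)" by (auto simp: trunc_def tail_def)
    then have "A u = (\<lambda>i. A (trunc n u) i + A (tail n u) i)"
      using op_add[OF ell2_trunc t2] by metis
    then have Au: "A u i = A (trunc n u) i + A (tail n u) i" for i by (rule fun_cong)
    have "trunc n (v - A v) = trunc n (u - A u)"
      using v u by (simp add: truncated_solution_def)
    then have vu: "v i - A v i = u i - A u i" if "i < n" for i
      using that by (auto simp: trunc_def fun_eq_iff split: if_splits)
    have "d i - A d i = (-1) * A (tail n u) i" if "i < n" for i
    proof -
      have "trunc n u i = u i" using that by (simp add: trunc_def)
      moreover have "d i = v i - trunc n u i" by (simp add: d_def)
      ultimately show ?thesis using vu[OF that] Au[of i] Ad[of i] by linarith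
    qed
    then show ?thesis
      unfolding trunc_def[of n "\<lambda>i. d i - A d i"] trunc_def[of n "\<lambda>i. (-1) * A (tail n u) i"]
      by auto
  qed
  have "ell2_norm (trunc n (\<lambda>i. (-1) * A (tail n u) i)) \<le> ell2_norm (\<lambda>i. (-1) * A (tail n u) i)"
    by (intro ell2_norm_trunc_le ell2_cmult ell2_op t2)
  also have "\<dots> = ell2_norm (A (tail n u))"
    using ell2_norm_cmult[OF ell2_op[OF t2], of "-1"] by simp
  also have "\<dots> \<le> B * ell2_norm (tail n u)" using t2 by (rule bounded)
  finally have "C * ell2_norm (trunc n (\<lambda>i. d i - A d i)) \<le> C * (B * ell2_norm (tail n u))"
    unfolding eq using C by (rule mult_left_mono)
  then have "ell2_norm d \<le> C * (B * ell2_norm (tail n u))"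
    using stable[OF \<open>d \<in> range (trunc n)\<close>] by simp
  then have d: "ell2_norm d \<le> C * (B * ell2_norm (tail n u))" .
  have "u - v = (\<lambda>i. tail n u i - d i)" by (auto simp: d_def tail_def trunc_def)
  then have "ell2_norm (u - v) \<le> ell2_norm (tail n u) + ell2_norm d"
    using ell2_norm_triangle_diff[OF t2, of d] v2 by (simp add: d_def ell2_diff')
  with d show ?thesis by (simp add: diff_trunc algebra_simps)
qed

theorem (in ell2_operator) truncation_converges:
  assumes below: "\<And>u. u \<in> ell2 \<Longrightarrow> ell2_norm u \<le> D * ell2_norm (\<lambda>i. u i - A u i)"
    and D: "0 \<le> D"
    and bounded: "\<And>u. u \<in> ell2 \<Longrightarrow> ell2_norm (A u) \<le> B * ell2_norm u"
    and small: "\<And>e. 0 < e \<Longrightarrow>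
      \<forall>\<^sub>F n in sequentially. \<forall>u\<in>ell2. ell2_norm (A (tail n (A u))) \<le> e * ell2_norm u"
    and u: "u \<in> ell2" "u - A u = g"
  shows "(\<exists>C. \<forall>\<^sub>F n in sequentially.
            (\<exists>!v. truncated_solution A g n v) \<and>
            ell2_norm (u - sparse_solution A g n) \<le> C * ell2_norm (u - trunc n u)) \<and>
         (\<lambda>n. ell2_norm (u - trunc n u)) \<longlonglongrightarrow> 0 \<and>
         (\<lambda>n. ell2_norm (u - sparse_solution A g n)) \<longlonglongrightarrow> 0"
proof -
  define C where "C = 1 + 2 * D * B"
  define e where "e = 1 / (2 * D + 2)"
  have "0 < 2 * D + 2" using D by simp
  then have "0 < e" "D * e \<le> 1 / 2" by (simp_all add: e_def pos_divide_le_eq)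
  have main: "\<forall>\<^sub>F n in sequentially.
            (\<exists>!v. truncated_solution A g n v) \<and>
            ell2_norm (u - sparse_solution A g n) \<le> C * ell2_norm (u - trunc n u)"
    using small[OF \<open>0 < e\<close>]
  proof eventually_elim
    case (elim n)
    have st: "ell2_norm v \<le> 2 * D * ell2_norm (trunc n (\<lambda>i. v i - A v i))"
      if "v \<in> range (trunc n)" for v
    proof (rule truncation_stable[OF below D _ \<open>D * e \<le> 1 / 2\<close> that])
      show "ell2_norm (A (tail n (A u))) \<le> e * ell2_norm u" if "u \<in> ell2" for u
        using elim that by blast
    qed
    have ex: "\<exists>!v. truncated_solution A g n v" using st by (rule truncated_solution_ex1)
    then have "truncated_solution A g n (sparse_solution A g n)"
      unfolding sparse_solution_def by (rule theI')
    with u have "ell2_norm (u - sparse_solution A g n) \<le> (1 + 2 * D * B) * ell2_norm (u - trunc n u)"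
      using D by (intro truncation_error[OF st _ bounded]) simp_all
    with ex show ?case unfolding C_def ..
  qed
  have lim: "(\<lambda>n. ell2_norm (u - trunc n u)) \<longlonglongrightarrow> 0"
    using ell2_norm_tail_tendsto_0[OF u(1)] by (simp add: diff_trunc)
  have "(\<lambda>n. ell2_norm (u - sparse_solution A g n)) \<longlonglongrightarrow> 0"
  proof (rule tendsto_sandwich)
    show "\<forall>\<^sub>F n in sequentially. 0 \<le> ell2_norm (u - sparse_solution A g n)"
      using main
    proof eventually_elim
      case (elim n)
      then have "\<exists>!v. truncated_solution A g n v" ..
      then have "truncated_solution A g n (sparse_solution A g n)"
        unfolding sparse_solution_def by (rule theI')
      then have "sparse_solution A g n \<in> ell2" by (auto simp: truncated_solution_def)
      then show ?case using u by (intro ell2_norm_nonneg ell2_diff)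
    qed
    show "\<forall>\<^sub>F n in sequentially.
        ell2_norm (u - sparse_solution A g n) \<le> C * ell2_norm (u - trunc n u)"
      using main by (rule eventually_mono) (erule conjunct2)
    show "(\<lambda>n. C * ell2_norm (u - trunc n u)) \<longlonglongrightarrow> 0"
      by (rule tendsto_mult_right_zero[OF lim])
  qed (rule tendsto_const)
  with main lim show ?thesis by (intro conjI exI[of _ C])
qed

section \<open>Uniform boundedness\<close>

lemma ell2_geometric_limit:
  assumes x: "\<And>n. x n \<in> ell2"
    and step: "\<And>n. ell2_norm (\<lambda>i. x (Suc n) i - x n i) \<le> (1 / 3) ^ Suc n"
  shows "\<exists>y\<in>ell2. \<forall>n. ell2_norm (\<lambda>i. y i - x n i) \<le> (1 / 3) ^ n / 2"
proof -
  have dist: "ell2_norm (\<lambda>i. x (n + k) i - x n i) \<le> ((1 / 3) ^ n - (1 / 3) ^ (n + k)) / 2" for n k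
  proof (induction k)
    case (Suc k)
    have "ell2_norm (\<lambda>i. (x (Suc (n + k)) i - x (n + k) i) + (x (n + k) i - x n i))
        \<le> ell2_norm (\<lambda>i. x (Suc (n + k)) i - x (n + k) i) + ell2_norm (\<lambda>i. x (n + k) i - x n i)"
      using x by (intro ell2_norm_triangle ell2_diff')
    then show ?case using step[of "n + k"] Suc by simp
  qed simp
  have comp: "\<bar>x l i - x n i\<bar> \<le> (1 / 3) ^ n / 2" if "n \<le> l" for n l i
  proof -
    have "\<bar>x l i - x n i\<bar> \<le> ell2_norm (\<lambda>i. x l i - x n i)"
      by (intro abs_le_ell2_norm[of "\<lambda>i. x l i - x n i"] ell2_diff' x)
    also have "\<dots> \<le> ((1 / 3) ^ n - (1 / 3) ^ l) / 2" using dist[of n "l - n"] that by simp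
    also have "\<dots> \<le> (1 / 3) ^ n / 2" by simp
    finally show ?thesis .
  qed
  have "convergent (\<lambda>l. x l i)" for i
  proof (rule Cauchy_convergent, rule metric_CauchyI)
    fix e :: real assume e: "e > 0"
    have "(\<lambda>n. (1 / 3 :: real) ^ n) \<longlonglongrightarrow> 0" by (rule LIMSEQ_power_zero) simp
    from order_tendstoD(2)[OF this e] obtain N where N: "(1 / 3 :: real) ^ N < e"
      by (auto simp: eventually_sequentially)
    show "\<exists>M. \<forall>m\<ge>M. \<forall>n\<ge>M. dist (x m i) (x n i) < e"
    proof (intro exI allI impI)
      fix m n assume "N \<le> m" "N \<le> n"
      from comp[OF this(1), of i] comp[OF this(2), of i] N
      show "dist (x m i) (x n i) < e" unfolding dist_real_def by linarith
    qed
  qed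
  then have lim: "(\<lambda>l. x l i) \<longlonglongrightarrow> lim (\<lambda>l. x l i)" for i by (simp add: convergent_LIMSEQ_iff)
  define y where "y i = lim (\<lambda>l. x l i)" for i
  have near: "(\<lambda>i. y i - x n i) \<in> ell2 \<and> ell2_norm (\<lambda>i. y i - x n i) \<le> (1 / 3) ^ n / 2" for n
  proof -
    have "(\<Sum>i<m. (y i - x n i)\<^sup>2) \<le> ((1 / 3) ^ n / 2)\<^sup>2" for m
    proof (rule LIMSEQ_le_const2)
      show "(\<lambda>l. \<Sum>i<m. (x l i - x n i)\<^sup>2) \<longlonglongrightarrow> (\<Sum>i<m. (y i - x n i)\<^sup>2)"
        unfolding y_def by (intro tendsto_intros lim)
      show "\<exists>N. \<forall>l\<ge>N. (\<Sum>i<m. (x l i - x n i)\<^sup>2) \<le> ((1 / 3) ^ n / 2)\<^sup>2"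
      proof (intro exI allI impI)
        fix l assume "n \<le> l"
        have "(\<Sum>i<m. (x l i - x n i)\<^sup>2) \<le> (ell2_norm (\<lambda>i. x l i - x n i))\<^sup>2"
          using x by (intro sum_power2_le_ell2_norm ell2_diff') auto
        also have "\<dots> \<le> ((1 / 3) ^ n / 2)\<^sup>2"
        proof (rule power_mono)
          have "ell2_norm (\<lambda>i. x l i - x n i) \<le> ((1 / 3) ^ n - (1 / 3) ^ l) / 2"
            using dist[of n "l - n"] \<open>n \<le> l\<close> by simp
          also have "\<dots> \<le> (1 / 3) ^ n / 2" by simp
          finally show "ell2_norm (\<lambda>i. x l i - x n i) \<le> (1 / 3) ^ n / 2" .
          show "0 \<le> ell2_norm (\<lambda>i. x l i - x n i)"
            using x by (intro ell2_norm_nonneg ell2_diff')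
        qed
        finally show "(\<Sum>i<m. (x l i - x n i)\<^sup>2) \<le> ((1 / 3) ^ n / 2)\<^sup>2" .
      qed
    qed
    then show ?thesis using ell2_norm_leI[of "\<lambda>i. y i - x n i" "(1 / 3) ^ n / 2"] by simp
  qed
  have "(\<lambda>i. (y i - x 0 i) + x 0 i) \<in> ell2" using near x by (intro ell2_add) auto
  then have "y \<in> ell2" by simp
  with near show ?thesis by blast
qed

text \<open>
  The proof follows Sokal's elementary argument for the uniform boundedness principle: signed
  multiples of almost maximising vectors are added up so that no cancellation occurs.
\<close>

theorem (in ell2_operator) bounded_of_bounded_rows:
  assumes rows: "\<And>j. \<exists>C. \<forall>u\<in>ell2. \<bar>A u j\<bar> \<le> C * ell2_norm u"
  shows "\<exists>B\<ge>0. \<forall>u\<in>ell2. ell2_norm (A u) \<le> B * ell2_norm u"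
proof (rule ccontr)
  assume unbounded: "\<not> ?thesis"
  define s where "s m u = ell2_norm (trunc m (A u))" for m u
  have s_nonneg: "0 \<le> s m u" for m u by (simp add: s_def ell2_norm_nonneg)
  have s_le: "s m u \<le> ell2_norm (A u)" if "u \<in> ell2" for m u
    unfolding s_def using that by (intro ell2_norm_trunc_le ell2_op)
  have s_add: "s m (\<lambda>i. u i + v i) \<le> s m u + s m v" if "u \<in> ell2" "v \<in> ell2" for m u v
  proof -
    have "trunc m (A (\<lambda>i. u i + v i)) = (\<lambda>i. trunc m (A u) i + trunc m (A v) i)"
      using that by (auto simp: op_add trunc_def)
    then show ?thesis unfolding s_def using ell2_norm_triangle[OF ell2_trunc ell2_trunc] by simp
  qed
  have s_cmult: "s m (\<lambda>i. a * u i) = \<bar>a\<bar> * s m u" if "u \<in> ell2" for m u a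
  proof -
    have "trunc m (A (\<lambda>i. a * u i)) = (\<lambda>i. a * trunc m (A u) i)"
      using that by (auto simp: op_cmult trunc_def)
    then show ?thesis unfolding s_def using ell2_norm_cmult[OF ell2_trunc] by simp
  qed
  obtain C where C: "\<bar>A u j\<bar> \<le> C j * ell2_norm u" if "u \<in> ell2" for u j
    using rows by metis
  have s_bound: "s m u \<le> (\<Sum>j<m. \<bar>C j\<bar>)" if u: "u \<in> ell2" "ell2_norm u \<le> 1" for m u
  proof -
    have "(\<Sum>i<n. (trunc m (A u) i)\<^sup>2) \<le> (\<Sum>j<m. \<bar>C j\<bar>)\<^sup>2" for n
    proof -
      have "(\<Sum>i<n. (trunc m (A u) i)\<^sup>2) \<le> (\<Sum>i<m. (\<bar>A u i\<bar>)\<^sup>2)"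
      proof -
        have "(\<Sum>i<n. (trunc m (A u) i)\<^sup>2) = (\<Sum>i\<in>{..<n} \<inter> {..<m}. (A u i)\<^sup>2)"
          by (intro sum.mono_neutral_cong_right) (auto simp: trunc_def)
        also have "\<dots> \<le> (\<Sum>i<m. (A u i)\<^sup>2)" by (intro sum_mono2) auto
        finally show ?thesis by simp
      qed
      also have "\<dots> \<le> (\<Sum>i<m. \<bar>A u i\<bar>)\<^sup>2"
        using L2_set_le_sum[of "{..<m}" "\<lambda>i. \<bar>A u i\<bar>"] by (intro sqrt_le_D) (simp add: L2_set_def)
      also have "\<dots> \<le> (\<Sum>j<m. \<bar>C j\<bar>)\<^sup>2"
      proof (intro power_mono sum_mono sum_nonneg)
        fix j
        have "\<bar>A u j\<bar> \<le> \<bar>C j\<bar> * ell2_norm u"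
          using C[OF u(1), of j] mult_right_mono[OF abs_ge_self ell2_norm_nonneg[OF u(1)], of "C j"] by linarith
        also have "\<dots> \<le> \<bar>C j\<bar> * 1" using u(2) by (intro mult_left_mono) auto
        finally show "\<bar>A u j\<bar> \<le> \<bar>C j\<bar>" by simp
      qed simp
      finally show ?thesis .
    qed
    then show ?thesis unfolding s_def
      by (intro ell2_norm_leI(2)) (auto intro: sum_nonneg)
  qed
  have large: "\<exists>m. \<exists>y\<in>ell2. ell2_norm y \<le> 1 \<and> B < s m y" if "0 \<le> B" for B
  proof -
    have "\<not> (\<forall>u\<in>ell2. ell2_norm (A u) \<le> B * ell2_norm u)"
      using unbounded that by blast
    then obtain u where u: "u \<in> ell2" "B * ell2_norm u < ell2_norm (A u)"
      by (auto simp: not_le)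
    have pos: "0 < ell2_norm u"
    proof (rule ccontr)
      assume "\<not> 0 < ell2_norm u"
      then have "u = (\<lambda>i. 0)" using u(1) by (intro ell2_norm_eq_0) auto
      then show False using u(2) op_zero by simp
    qed
    have "\<exists>m. B * ell2_norm u < s m u"
    proof (rule ccontr)
      assume "\<nexists>m. B * ell2_norm u < s m u"
      then have le: "s m u \<le> B * ell2_norm u" for m by (meson not_le)
      have "(\<Sum>i<n. (A u i)\<^sup>2) \<le> (B * ell2_norm u)\<^sup>2" for n
      proof -
        have "(\<Sum>i<n. (A u i)\<^sup>2) = (\<Sum>i<n. (trunc n (A u) i)\<^sup>2)" by (simp add: trunc_def)
        also have "\<dots> \<le> (s n u)\<^sup>2" unfolding s_def by (intro sum_power2_le_ell2_norm) auto
        also have "\<dots> \<le> (B * ell2_norm u)\<^sup>2" using le s_nonneg by (intro power_mono)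
        finally show ?thesis .
      qed
      then have "ell2_norm (A u) \<le> B * ell2_norm u"
        using that pos by (intro ell2_norm_leI(2)) auto
      then show False using u(2) by simp
    qed
    then obtain m where m: "B * ell2_norm u < s m u" ..
    let ?y = "\<lambda>i. (1 / ell2_norm u) * u i"
    have "?y \<in> ell2" using u(1) by (rule ell2_cmult)
    moreover have "ell2_norm ?y = 1" using ell2_norm_cmult[OF u(1), of "1 / ell2_norm u"] pos by simp
    moreover have "B < s m ?y" using s_cmult[OF u(1), of m "1 / ell2_norm u"] m pos
      by (simp add: pos_less_divide_eq)
    ultimately show ?thesis by (intro exI[of _ m] bexI[of _ ?y]) simp_all
  qed
  have "\<exists>m y. y \<in> ell2 \<and> ell2_norm y \<le> 1 \<and> 4 ^ n < s m y \<and>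
      (\<forall>z\<in>ell2. s m z \<le> 3 / 2 * s m y * ell2_norm z)" for n
  proof -
    obtain m y0 where y0: "y0 \<in> ell2" "ell2_norm y0 \<le> 1" "3 / 2 * 4 ^ n < s m y0"
      using large[of "3 / 2 * 4 ^ n"] by auto
    define S where "S = s m ` {y \<in> ell2. ell2_norm y \<le> 1}"
    have bdd: "bdd_above S" unfolding S_def using s_bound by (intro bdd_aboveI2) auto
    have up: "s m y0 \<le> Sup S" using bdd y0 by (intro cSup_upper) (auto simp: S_def)
    have "0 < Sup S" using up y0(3) zero_less_power[of "4 :: real" n] by linarith
    then have "2 / 3 * Sup S < Sup S" by simp
    then obtain t where "t \<in> S" "2 / 3 * Sup S < t"
      using less_cSup_iff[of S "2 / 3 * Sup S"] bdd y0 unfolding S_def by blast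
    then obtain y where y: "y \<in> ell2" "ell2_norm y \<le> 1" "2 / 3 * Sup S < s m y"
      by (auto simp: S_def)
    have "s m z \<le> 3 / 2 * s m y * ell2_norm z" if z: "z \<in> ell2" for z
    proof (cases "ell2_norm z \<le> 0")
      case True
      then have "z = (\<lambda>i. 0)" using z by (intro ell2_norm_eq_0)
      then have "s m z = 0" using s_cmult[of z m 0] z by simp
      then show ?thesis using \<open>z = (\<lambda>i. 0)\<close> by simp
    next
      case False
      let ?z = "\<lambda>i. (1 / ell2_norm z) * z i"
      have "?z \<in> ell2" using z by (rule ell2_cmult)
      moreover have "ell2_norm ?z \<le> 1" using ell2_norm_cmult[OF z, of "1 / ell2_norm z"] False by simp
      ultimately have "s m ?z \<le> Sup S" using bdd by (intro cSup_upper) (auto simp: S_def)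
      then have "s m z / ell2_norm z \<le> Sup S" using s_cmult[OF z, of m "1 / ell2_norm z"] False by simp
      also have "\<dots> \<le> 3 / 2 * s m y" using y(3) by simp
      finally show ?thesis using False by (simp add: pos_divide_le_eq)
    qed
    moreover have "4 ^ n < s m y" using y0(3) y(3) up by linarith
    ultimately show ?thesis using y by blast
  qed
  then obtain m y where y: "\<And>n. y n \<in> ell2" "\<And>n. ell2_norm (y n) \<le> 1" "\<And>n. 4 ^ n < s (m n) (y n)"
    and max: "\<And>n z. z \<in> ell2 \<Longrightarrow> s (m n) z \<le> 3 / 2 * s (m n) (y n) * ell2_norm z"
    by metis
  define next_x where "next_x n x = (let p = (\<lambda>i. x i + (1 / 3) ^ Suc n * y n i);
      q = (\<lambda>i. x i + - ((1 / 3) ^ Suc n) * y n i) in if s (m n) q \<le> s (m n) p then p else q)" for n x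
  define x where "x = rec_nat (\<lambda>i. 0) next_x"
  have x_Suc: "x (Suc n) = next_x n (x n)" for n by (simp add: x_def)
  have sq: "x n \<in> ell2" for n
  proof (induction n)
    case (Suc n)
    have mem: "(\<lambda>i. x n i + a * y n i) \<in> ell2" for a using Suc y(1) by (intro ell2_add ell2_cmult)
    show ?case unfolding x_Suc next_x_def Let_def by (split if_split) (intro conjI impI mem)
  qed (simp add: x_def)
  have step: "ell2_norm (\<lambda>i. x (Suc n) i - x n i) \<le> (1 / 3) ^ Suc n"
    and big: "(1 / 3) ^ Suc n * s (m n) (y n) \<le> s (m n) (x (Suc n))" for n
  proof -
    let ?t = "(1 / 3 :: real) ^ Suc n"
    have t: "0 \<le> ?t" by simp
    let ?p = "\<lambda>i. x n i + ?t * y n i" and ?q = "\<lambda>i. x n i + - ?t * y n i"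
    have pq: "?p \<in> ell2" "?q \<in> ell2" using sq y(1) by (intro ell2_add ell2_cmult; simp)+
    have "x (Suc n) = ?p \<or> x (Suc n) = ?q" by (auto simp: x_Suc next_x_def Let_def)
    then have "(\<lambda>i. x (Suc n) i - x n i) = (\<lambda>i. ?t * y n i) \<or> (\<lambda>i. x (Suc n) i - x n i) = (\<lambda>i. - ?t * y n i)"
      by auto
    then have "ell2_norm (\<lambda>i. x (Suc n) i - x n i) = ?t * ell2_norm (y n)"
      using ell2_norm_cmult[OF y(1), of ?t n] ell2_norm_cmult[OF y(1), of "- ?t" n] t
      by (auto simp del: power_Suc)
    also have "\<dots> \<le> ?t * 1" using y(2) t by (intro mult_left_mono)
    finally show "ell2_norm (\<lambda>i. x (Suc n) i - x n i) \<le> ?t" by simp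
    have "(\<lambda>i. ?p i + (-1) * ?q i) = (\<lambda>i. (2 * ?t) * y n i)" by auto
    then have "2 * ?t * s (m n) (y n) = s (m n) (\<lambda>i. ?p i + (-1) * ?q i)"
      using s_cmult[OF y(1), of "m n" "2 * ?t" n] t by simp
    also have "\<dots> \<le> s (m n) ?p + s (m n) ?q"
      using s_add[OF pq(1) ell2_cmult[OF pq(2), of "-1"], of "m n"] s_cmult[OF pq(2), of "m n" "-1"] by simp
    also have "\<dots> \<le> 2 * s (m n) (x (Suc n))"
      by (auto simp: x_Suc next_x_def Let_def simp del: power_Suc mult_minus_left)
    finally show "?t * s (m n) (y n) \<le> s (m n) (x (Suc n))" by (simp del: power_Suc)
  qed
  obtain X where X: "X \<in> ell2" "\<And>n. ell2_norm (\<lambda>i. X i - x n i) \<le> (1 / 3) ^ n / 2"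
    using ell2_geometric_limit[OF sq step] by blast
  have grow: "(4 / 3) ^ n \<le> 12 * ell2_norm (A X)" for n
  proof -
    let ?t = "(1 / 3 :: real) ^ Suc n" and ?d = "\<lambda>i. X i - x (Suc n) i"
    have d: "?d \<in> ell2" using X(1) sq by (rule ell2_diff')
    have "s (m n) ?d \<le> 3 / 2 * s (m n) (y n) * ell2_norm ?d" using d by (rule max)
    also have "\<dots> \<le> 3 / 2 * s (m n) (y n) * (?t / 2)"
      using X(2)[of "Suc n"] s_nonneg by (intro mult_left_mono) simp_all
    finally have 1: "s (m n) ?d \<le> 3 / 4 * (?t * s (m n) (y n))" by simp
    have "x (Suc n) = (\<lambda>i. X i + (-1) * ?d i)" by auto
    then have "s (m n) (x (Suc n)) \<le> s (m n) X + s (m n) ?d"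
      using s_add[OF X(1) ell2_cmult[OF d, of "-1"], of "m n"] s_cmult[OF d, of "m n" "-1"] by simp
    with 1 big[of n] s_le[OF X(1), of "m n"] have "?t * s (m n) (y n) \<le> 4 * ell2_norm (A X)" by linarith
    moreover have "?t * 4 ^ n \<le> ?t * s (m n) (y n)" using y(3)[of n] by (intro mult_left_mono) auto
    moreover have "?t * 4 ^ n = (4 / 3) ^ n / 3" by (simp add: power_divide)
    ultimately show ?thesis by linarith
  qed
  obtain n where "12 * ell2_norm (A X) < (4 / 3) ^ n" using real_arch_pow[of "4 / 3"] by auto
  with grow[of n] show False by simp
qed

section \<open>Hilbert--Schmidt matrices\<close>

lemma Hilbert_Schmidt_bound:
  assumes C: "\<And>J m. (\<Sum>j<J. \<Sum>i<m. (a j i)\<^sup>2) \<le> C" "0 \<le> C"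
    and u: "u \<in> ell2" and v: "\<And>j. (\<lambda>i. a j i * u i) sums v j"
  shows "v \<in> ell2" "ell2_norm v \<le> sqrt C * ell2_norm u"
proof -
  have "(\<Sum>j<J. (v j)\<^sup>2) \<le> (sqrt C * ell2_norm u)\<^sup>2" for J
  proof (rule LIMSEQ_le_const2)
    show "(\<lambda>m. \<Sum>j<J. (\<Sum>i<m. a j i * u i)\<^sup>2) \<longlonglongrightarrow> (\<Sum>j<J. (v j)\<^sup>2)"
      using v unfolding sums_def by (intro tendsto_intros)
    show "\<exists>N. \<forall>m\<ge>N. (\<Sum>j<J. (\<Sum>i<m. a j i * u i)\<^sup>2) \<le> (sqrt C * ell2_norm u)\<^sup>2"
    proof (intro exI allI impI)
      fix m :: nat
      have "(\<Sum>j<J. (\<Sum>i<m. a j i * u i)\<^sup>2) \<le> (\<Sum>j<J. (\<Sum>i<m. (a j i)\<^sup>2) * (\<Sum>i<m. (u i)\<^sup>2))"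
        by (intro sum_mono Cauchy_Schwarz_ineq_sum)
      also have "\<dots> = (\<Sum>j<J. \<Sum>i<m. (a j i)\<^sup>2) * (\<Sum>i<m. (u i)\<^sup>2)"
        by (simp add: sum_distrib_right)
      also have "\<dots> \<le> C * (ell2_norm u)\<^sup>2"
        using C u by (intro mult_mono sum_power2_le_ell2_norm sum_nonneg) auto
      also have "\<dots> = (sqrt C * ell2_norm u)\<^sup>2" using C(2) by (simp add: power_mult_distrib)
      finally show "(\<Sum>j<J. (\<Sum>i<m. a j i * u i)\<^sup>2) \<le> (sqrt C * ell2_norm u)\<^sup>2" .
    qed
  qed
  from ell2_norm_leI[OF this] show "v \<in> ell2" "ell2_norm v \<le> sqrt C * ell2_norm u"
    using C(2) ell2_norm_nonneg[OF u] by auto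
qed

lemma double_sum_tail:
  fixes b :: "nat \<Rightarrow> nat \<Rightarrow> real"
  assumes nonneg: "\<And>j i. 0 \<le> b j i" and C: "\<And>J m. (\<Sum>j<J. \<Sum>i<m. b j i) \<le> C" and e: "0 < e"
  shows "\<forall>\<^sub>F n in sequentially. \<forall>J m. (\<Sum>j<J. \<Sum>i<m. if j < n then 0 else b j i) \<le> e"
proof -
  have row: "summable (b j)" for j
  proof (rule summableI_nonneg_bounded)
    fix m
    have "(\<Sum>i<m. b j i) \<le> (\<Sum>j<Suc j. \<Sum>i<m. b j i)"
      by (intro member_le_sum sum_nonneg nonneg) auto
    then show "(\<Sum>i<m. b j i) \<le> C" using C[where J = "Suc j" and m = m] by linarith
  qed (rule nonneg)
  define R where "R j = (\<Sum>i. b j i)" for j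
  have R_nonneg: "0 \<le> R j" for j unfolding R_def using row nonneg by (intro suminf_nonneg)
  have "(\<Sum>j<J. R j) \<le> C" for J
  proof (rule LIMSEQ_le_const2)
    show "(\<lambda>m. \<Sum>j<J. \<Sum>i<m. b j i) \<longlonglongrightarrow> (\<Sum>j<J. R j)"
      unfolding R_def by (intro tendsto_sum summable_LIMSEQ row)
    show "\<exists>N. \<forall>m\<ge>N. (\<Sum>j<J. \<Sum>i<m. b j i) \<le> C" using C by simp
  qed
  then have R: "summable R" using R_nonneg by (intro summableI_nonneg_bounded)
  have "(\<lambda>n. suminf R - (\<Sum>j<n. R j)) \<longlonglongrightarrow> suminf R - suminf R"
    using R by (intro tendsto_intros summable_LIMSEQ)
  then have "\<forall>\<^sub>F n in sequentially. suminf R - (\<Sum>j<n. R j) < e"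
    using e by (intro order_tendstoD(2)) simp_all
  then show ?thesis
  proof eventually_elim
    case (elim n)
    show ?case
    proof (intro allI)
      fix J m
      have "(\<Sum>j<J. \<Sum>i<m. if j < n then 0 else b j i) \<le> (\<Sum>j<J. if j < n then 0 else R j)"
        unfolding R_def using row nonneg by (intro sum_mono) (auto intro: sum_le_suminf)
      also have "\<dots> \<le> (\<Sum>j<max J n. if j < n then 0 else R j)"
        using R_nonneg by (intro sum_mono2) auto
      also have "\<dots> = (\<Sum>j<max J n. R j) - (\<Sum>j<n. R j)"
      proof -
        have "(\<Sum>j<max J n. if j < n then 0 else R j) = (\<Sum>j\<in>{..<max J n} - {..<n}. R j)"
          by (intro sum.mono_neutral_cong_right) auto
        then show ?thesis by (subst (asm) sum_diff) auto
      qed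
      also have "\<dots> \<le> suminf R - (\<Sum>j<n. R j)"
        using R R_nonneg by (intro diff_right_mono sum_le_suminf) auto
      finally show "(\<Sum>j<J. \<Sum>i<m. if j < n then 0 else b j i) \<le> e" using elim by linarith
    qed
  qed
qed

lemma Hilbert_Schmidt_tail:
  assumes C: "\<And>J m. (\<Sum>j<J. \<Sum>i<m. (a j i)\<^sup>2) \<le> C"
    and T: "\<And>u j. u \<in> ell2 \<Longrightarrow> (\<lambda>i. a j i * u i) sums T u j" and e: "0 < e"
  shows "\<forall>\<^sub>F n in sequentially. \<forall>u\<in>ell2. ell2_norm (tail n (T u)) \<le> e * ell2_norm u"
    and "\<forall>\<^sub>F n in sequentially. \<forall>u\<in>ell2. ell2_norm (T (tail n u)) \<le> e * ell2_norm u"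
proof -
  have e2: "0 < e\<^sup>2" using e by simp
  have "\<forall>\<^sub>F n in sequentially. \<forall>J m. (\<Sum>j<J. \<Sum>i<m. if j < n then 0 else (a j i)\<^sup>2) \<le> e\<^sup>2"
    using C e2 by (intro double_sum_tail[of "\<lambda>j i. (a j i)\<^sup>2" C]) (rule zero_le_power2)
  then show "\<forall>\<^sub>F n in sequentially. \<forall>u\<in>ell2. ell2_norm (tail n (T u)) \<le> e * ell2_norm u"
  proof eventually_elim
    case (elim n)
    show ?case
    proof
      fix u :: "nat \<Rightarrow> real" assume u: "u \<in> ell2"
      let ?b = "\<lambda>j i. if j < n then 0 else a j i"
      have "(\<lambda>i. ?b j i * u i) sums tail n (T u) j" for j
        using T[OF u, of j] by (auto simp: tail_def)
      moreover have "(\<Sum>j<J. \<Sum>i<m. (?b j i)\<^sup>2) \<le> e\<^sup>2" for J m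
      proof -
        have "(\<Sum>j<J. \<Sum>i<m. (?b j i)\<^sup>2) = (\<Sum>j<J. \<Sum>i<m. if j < n then 0 else (a j i)\<^sup>2)"
          by (intro sum.cong) auto
        also have "\<dots> \<le> e\<^sup>2" using elim by blast
        finally show ?thesis .
      qed
      ultimately have "ell2_norm (tail n (T u)) \<le> sqrt (e\<^sup>2) * ell2_norm u"
        using u by (intro Hilbert_Schmidt_bound(2)) auto
      then show "ell2_norm (tail n (T u)) \<le> e * ell2_norm u" using e by simp
    qed
  qed
  have "(\<Sum>i<m. \<Sum>j<J. (a j i)\<^sup>2) \<le> C" for J m
    using C[of m J] sum.swap[of "\<lambda>i j. (a j i)\<^sup>2" "{..<J}" "{..<m}"] by simp
  then have "\<forall>\<^sub>F n in sequentially. \<forall>J m. (\<Sum>i<J. \<Sum>j<m. if i < n then 0 else (a j i)\<^sup>2) \<le> e\<^sup>2"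
    using e2 by (intro double_sum_tail[of "\<lambda>i j. (a j i)\<^sup>2" C]) (rule zero_le_power2)
  then show "\<forall>\<^sub>F n in sequentially. \<forall>u\<in>ell2. ell2_norm (T (tail n u)) \<le> e * ell2_norm u"
  proof eventually_elim
    case (elim n)
    show ?case
    proof
      fix u :: "nat \<Rightarrow> real" assume u: "u \<in> ell2"
      let ?b = "\<lambda>j i. if i < n then 0 else a j i"
      have "(\<lambda>i. ?b j i * u i) = (\<lambda>i. a j i * tail n u i)" for j by (auto simp: tail_def)
      then have "(\<lambda>i. ?b j i * u i) sums T (tail n u) j" for j
        using T[OF ell2_tail[OF u]] by simp
      moreover have "(\<Sum>j<J. \<Sum>i<m. (?b j i)\<^sup>2) \<le> e\<^sup>2" for J m
      proof -
        have "(\<Sum>j<J. \<Sum>i<m. (?b j i)\<^sup>2) = (\<Sum>j<J. \<Sum>i<m. if i < n then 0 else (a j i)\<^sup>2)"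
          by (intro sum.cong) auto
        also have "\<dots> = (\<Sum>i<m. \<Sum>j<J. if i < n then 0 else (a j i)\<^sup>2)" by (rule sum.swap)
        also have "\<dots> \<le> e\<^sup>2" using elim by blast
        finally show ?thesis .
      qed
      ultimately have "ell2_norm (T (tail n u)) \<le> sqrt (e\<^sup>2) * ell2_norm u"
        using u by (intro Hilbert_Schmidt_bound(2)) auto
      then show "ell2_norm (T (tail n u)) \<le> e * ell2_norm u" using e by simp
    qed
  qed
qed

section \<open>Jacobi polynomials\<close>

definition jac_weight :: "nat \<Rightarrow> real measure" where
  "jac_weight a = density lborel (\<lambda>x. ennreal (indicator {0..1} x * (1 - x) ^ a))"

lemma sets_jac_weight [measurable_cong, simp]: "sets (jac_weight a) = sets borel"
  by (simp add: jac_weight_def)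

lemma space_jac_weight [simp]: "space (jac_weight a) = UNIV"
  by (simp add: jac_weight_def)

lemma borel_measurable_jac_weight [simp]: "borel_measurable (jac_weight a) = borel_measurable borel"
  by (rule measurable_cong_sets) simp_all

lemma jac_weight_nonneg: "0 \<le> indicator {0..1} x * (1 - x :: real) ^ a"
  by (auto simp: indicator_def)

lemma integral_jac_weight:
  assumes [measurable]: "f \<in> borel_measurable borel"
  shows "(\<integral>x. f x \<partial>jac_weight a) = (\<integral>x. indicator {0..1} x * (1 - x) ^ a * f x \<partial>lborel)"
  unfolding jac_weight_def by (subst integral_density) (auto simp: jac_weight_nonneg)

lemma integrable_jac_weight:
  assumes [measurable]: "f \<in> borel_measurable borel"
  shows "integrable (jac_weight a) f \<longleftrightarrow> integrable lborel (\<lambda>x. indicator {0..1} x * (1 - x) ^ a * f x)"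
  unfolding jac_weight_def by (subst integrable_density) (auto simp: jac_weight_nonneg)

lemma nn_integral_jac_weight:
  assumes [measurable]: "f \<in> borel_measurable borel"
  shows "(\<integral>\<^sup>+x. f x \<partial>jac_weight a) = (\<integral>\<^sup>+x. ennreal (indicator {0..1} x * (1 - x) ^ a) * f x \<partial>lborel)"
  unfolding jac_weight_def by (subst nn_integral_density) auto

lemma AE_jac_weight: "AE x in jac_weight a. x \<in> {0..1}"
  unfolding jac_weight_def by (subst AE_density) (auto simp: indicator_def)

lemma borel_measurable_poly [measurable]: "poly (p :: real poly) \<in> borel_measurable borel"
  by (intro borel_measurable_continuous_onI continuous_intros)

lemma integrable_continuous_Icc:
  fixes f :: "real \<Rightarrow> real"
  assumes "continuous_on {0..1} f"
  shows "integrable lborel (\<lambda>x. indicator {0..1} x * f x)"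
  using borel_integrable_atLeastAtMost'[OF assms] by (simp add: set_integrable_def)

lemma integrable_jac_weight_poly: "integrable (jac_weight a) (poly p)"
proof -
  have "integrable lborel (\<lambda>x. indicator {0..1} x * ((1 - x) ^ a * poly p x))"
    by (intro integrable_continuous_Icc continuous_intros)
  then show ?thesis by (simp add: integrable_jac_weight mult.assoc)
qed

lemma square_integrable_poly [simp]: "square_integrable (jac_weight a) (poly p)"
proof -
  have "poly (p * p) = (\<lambda>x. (poly p x)\<^sup>2)" by (simp add: fun_eq_iff power2_eq_square)
  then show ?thesis using integrable_jac_weight_poly[of a "p * p"] by (simp add: square_integrable_def)
qed

lemma beta_integral_nat:
  "(\<integral>x. indicator {0..1} x * (x ^ i * (1 - x) ^ j) \<partial>lborel) = (fact i * fact j / fact (i + j + 1) :: real)"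
proof (induction j arbitrary: i)
  case 0
  have "(\<integral>x. indicator {0..1} x *\<^sub>R x ^ i \<partial>lborel) = (1 :: real) ^ Suc i / Suc i - 0 ^ Suc i / Suc i"
  proof (rule integral_FTC_atLeastAtMost)
    fix x :: real
    have "((\<lambda>x. x ^ Suc i / Suc i) has_real_derivative x ^ i) (at x within {0..1})"
      by (rule DERIV_cong[OF DERIV_cdivide[OF DERIV_pow]]) simp
    then show "((\<lambda>x. x ^ Suc i / Suc i) has_vector_derivative x ^ i) (at x within {0..1})"
      by (simp only: has_real_derivative_iff_has_vector_derivative)
  qed (auto intro!: continuous_intros)
  moreover have "fact i / fact (Suc i) = (1 :: real) / real (Suc i)"
    by (simp add: fact_Suc del: of_nat_Suc)
  ultimately show ?case by simp
next
  case (Suc j)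
  let ?I = "\<lambda>i j. \<integral>x. indicator {0..1} x * (x ^ i * (1 - x :: real) ^ j) \<partial>lborel"
  have int: "integrable lborel (\<lambda>x. indicator {0..1} x * (x ^ i * (1 - x :: real) ^ j))" for i j
    by (intro integrable_continuous_Icc continuous_intros)
  have "(\<integral>x. indicator {0..1} x *\<^sub>R
      (real (Suc i) * (x ^ i * (1 - x) ^ Suc j) - real (Suc j) * (x ^ Suc i * (1 - x) ^ j)) \<partial>lborel)
      = 1 ^ Suc i * (1 - 1 :: real) ^ Suc j - 0 ^ Suc i * (1 - 0) ^ Suc j"
  proof (rule integral_FTC_atLeastAtMost)
    fix x :: real
    have "((\<lambda>x. x ^ Suc i * (1 - x) ^ Suc j) has_real_derivative
        real (Suc i) * x ^ i * (1 - x) ^ Suc j + x ^ Suc i * (real (Suc j) * (1 - x) ^ j * (- 1)))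
        (at x within {0..1})"
      by (auto intro!: derivative_eq_intros simp del: power_Suc)
    then show "((\<lambda>x. x ^ Suc i * (1 - x) ^ Suc j) has_vector_derivative
        real (Suc i) * (x ^ i * (1 - x) ^ Suc j) - real (Suc j) * (x ^ Suc i * (1 - x) ^ j))
        (at x within {0..1})"
      unfolding has_real_derivative_iff_has_vector_derivative[symmetric]
      by (rule DERIV_cong) (simp add: algebra_simps del: power_Suc)
  qed (auto intro!: continuous_intros)
  also have "(\<lambda>x. indicator {0..1} x *\<^sub>R
      (real (Suc i) * (x ^ i * (1 - x) ^ Suc j) - real (Suc j) * (x ^ Suc i * (1 - x) ^ j)))
    = (\<lambda>x. real (Suc i) * (indicator {0..1} x * (x ^ i * (1 - x) ^ Suc j))
        - real (Suc j) * (indicator {0..1} x * (x ^ Suc i * (1 - x :: real) ^ j)))"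
    by (auto simp: algebra_simps)
  also have "(\<integral>x. real (Suc i) * (indicator {0..1} x * (x ^ i * (1 - x) ^ Suc j))
        - real (Suc j) * (indicator {0..1} x * (x ^ Suc i * (1 - x :: real) ^ j)) \<partial>lborel)
      = real (Suc i) * ?I i (Suc j) - real (Suc j) * ?I (Suc i) j"
    by (subst Bochner_Integration.integral_diff) (auto intro: integrable_mult_right int simp del: power_Suc)
  finally have "real (Suc i) * ?I i (Suc j) = real (Suc j) * ?I (Suc i) j" by simp
  moreover have "a = b / c" if "c * a = b" "c \<noteq> 0" for a b c :: real
    using that by (simp add: eq_divide_eq mult.commute)
  ultimately have "?I i (Suc j) = real (Suc j) * ?I (Suc i) j / real (Suc i)"
    using of_nat_neq_0 by blast
  also have "\<dots> = real (Suc j) * (fact (Suc i) * fact j / fact (Suc i + j + 1)) / real (Suc i)"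
    by (simp only: Suc.IH)
  also have "Suc i + j + 1 = i + Suc j + 1" by simp
  also have "real (Suc j) * (fact (Suc i) * fact j / fact (i + Suc j + 1)) / real (Suc i)
      = fact i * fact (Suc j) / fact (i + Suc j + 1)"
    unfolding fact_Suc[of i] fact_Suc[of j] by (simp del: of_nat_Suc fact_Suc)
  finally show ?case .
qed

lemma alternating_choose_step:
  fixes g :: "nat \<Rightarrow> real"
  shows "(\<Sum>r\<le>Suc n. (-1) ^ r * real (Suc n choose r) * g r)
       = (\<Sum>r\<le>n. (-1) ^ r * real (n choose r) * (g r - g (Suc r)))"
proof -
  have "(\<Sum>r\<le>Suc n. (-1) ^ r * real (Suc n choose r) * g r)
      = g 0 + (\<Sum>r\<le>n. (-1) ^ Suc r * real (Suc n choose Suc r) * g (Suc r))"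
    by (simp add: sum.atMost_Suc_shift del: sum.atMost_Suc binomial_Suc_Suc)
  also have "\<dots> = (g 0 + (\<Sum>r\<le>n. (-1) ^ Suc r * real (n choose Suc r) * g (Suc r)))
      - (\<Sum>r\<le>n. (-1) ^ r * real (n choose r) * g (Suc r))"
    by (simp add: sum.distrib[symmetric] sum_subtractf[symmetric] sum_negf[symmetric] algebra_simps)
  also have "g 0 + (\<Sum>r\<le>n. (-1) ^ Suc r * real (n choose Suc r) * g (Suc r))
      = (\<Sum>r\<le>Suc n. (-1) ^ r * real (n choose r) * g r)"
    by (simp add: sum.atMost_Suc_shift del: sum.atMost_Suc)
  also have "\<dots> = (\<Sum>r\<le>n. (-1) ^ r * real (n choose r) * g r)" by simp
  finally show ?thesis by (simp add: sum_subtractf[symmetric] algebra_simps)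
qed

lemma alternating_choose_sum:
  "m \<le> n \<Longrightarrow> (\<Sum>r\<le>n. (-1) ^ r * real (n choose r) * real ((r + c) choose m))
    = (if m = n then (-1) ^ n else 0)"
proof (induction n arbitrary: m c)
  case (Suc n)
  show ?case
  proof (cases m)
    case 0
    then show ?thesis unfolding alternating_choose_step by simp
  next
    case (Suc k)
    have "(\<Sum>r\<le>Suc n. (-1) ^ r * real (Suc n choose r) * real ((r + c) choose m))
        = (\<Sum>r\<le>n. (-1) ^ r * real (n choose r) * (- real ((r + c) choose k)))"
      unfolding alternating_choose_step by (intro sum.cong) (simp_all add: Suc)
    also have "\<dots> = - (\<Sum>r\<le>n. (-1) ^ r * real (n choose r) * real ((r + c) choose k))"
      by (simp add: sum_negf)
    also have "\<dots> = - (if k = n then (-1) ^ n else 0)" using Suc.IH[of k c] Suc.prems Suc by simp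
    finally show ?thesis using Suc by simp
  qed
qed simp

definition jacobi_poly :: "nat \<Rightarrow> nat \<Rightarrow> real poly" where
  "jacobi_poly a n = (\<Sum>s\<le>n. smult (real ((n + a) choose (n - s)) * real (n choose s))
      ([:-1, 1:] ^ s * [:0, 1:] ^ (n - s)))"

lemma poly_jacobi_poly_sum:
  "poly (jacobi_poly a n) x
    = (\<Sum>s\<le>n. real ((n + a) choose (n - s)) * real (n choose s) * (x - 1) ^ s * x ^ (n - s))"
  by (simp add: jacobi_poly_def poly_sum mult.assoc)

lemma jacobi01_eq_poly: "jacobi01 (real a) 0 n x = poly (jacobi_poly a n) x"
proof -
  have "real n + real a = real (n + a)" by simp
  then show ?thesis
    unfolding poly_jacobi_poly_sum jacobi01_def jacobi_def
    by (simp only: binomial_gbinomial[symmetric] add_0_right) (simp add: diff_divide_distrib)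
qed

lemma degree_jacobi_summand: "s \<le> n \<Longrightarrow> degree ([:-1, 1 :: real:] ^ s * [:0, 1:] ^ (n - s)) = n"
  by (subst degree_mult_eq) (auto simp: degree_power_eq)

lemma degree_jacobi_poly_le: "degree (jacobi_poly a n) \<le> n"
  unfolding jacobi_poly_def
  by (intro degree_sum_le order_trans[OF degree_smult_le]) (auto simp: degree_jacobi_summand)

lemma coeff_jacobi_poly: "poly.coeff (jacobi_poly a n) n = real ((2 * n + a) choose n)"
proof -
  have "poly.coeff ([:-1, 1 :: real:] ^ s * [:0, 1:] ^ (n - s)) n = 1" if "s \<le> n" for s
  proof -
    have "lead_coeff ([:-1, 1 :: real:] ^ s * [:0, 1:] ^ (n - s)) = 1"
      by (simp add: lead_coeff_mult lead_coeff_power)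
    then show ?thesis using degree_jacobi_summand[OF that] by simp
  qed
  then have "poly.coeff (jacobi_poly a n) n = (\<Sum>s\<le>n. real ((n choose s) * ((n + a) choose (n - s))))"
    unfolding jacobi_poly_def by (simp add: coeff_sum mult.commute)
  also have "\<dots> = real ((n + (n + a)) choose n)"
    unfolding of_nat_sum[symmetric] vandermonde ..
  finally show ?thesis by (simp add: mult_2 add.assoc)
qed

lemma coeff_jacobi_poly_pos: "0 < poly.coeff (jacobi_poly a n) n"
  by (simp add: coeff_jacobi_poly)

lemma degree_jacobi_poly [simp]: "degree (jacobi_poly a n) = n"
  using degree_jacobi_poly_le[of a n] coeff_jacobi_poly_pos[of a n] by (intro antisym le_degree) auto

lemma minus_one_power_mult_self: "(-1 :: real) ^ n * (-1) ^ n = 1"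
  by (simp add: power_add[symmetric])

lemma jacobi_poly_moment:
  assumes "m \<le> n"
  shows "L2_inner (jac_weight a) (poly (jacobi_poly a n)) (\<lambda>x. x ^ m)
    = (if m = n then fact (n + a) * fact n / fact (2 * n + a + 1) else 0)"
proof -
  have int: "integrable lborel (\<lambda>x. c * (indicator {0..1} x * (x ^ i * (1 - x :: real) ^ j)))" for i j c
    by (intro integrable_mult_right integrable_continuous_Icc continuous_intros)
  have "L2_inner (jac_weight a) (poly (jacobi_poly a n)) (\<lambda>x. x ^ m)
      = (\<integral>x. indicator {0..1} x * (1 - x) ^ a * (poly (jacobi_poly a n) x * x ^ m) \<partial>lborel)"
    unfolding L2_inner_def by (intro integral_jac_weight) measurable
  also have "(\<lambda>x. indicator {0..1} x * (1 - x) ^ a * (poly (jacobi_poly a n) x * x ^ m))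
      = (\<lambda>x. \<Sum>s\<le>n. ((-1) ^ s * real ((n + a) choose (n - s)) * real (n choose s)) *
          (indicator {0..1} x * (x ^ (n - s + m) * (1 - x) ^ (a + s))))"
  proof
    fix x :: real
    have "(x - 1) ^ s = (-1) ^ s * (1 - x) ^ s" for s
      by (simp add: power_mult_distrib[symmetric])
    note neg = this
    show "indicator {0..1} x * (1 - x) ^ a * (poly (jacobi_poly a n) x * x ^ m)
      = (\<Sum>s\<le>n. ((-1) ^ s * real ((n + a) choose (n - s)) * real (n choose s)) *
          (indicator {0..1} x * (x ^ (n - s + m) * (1 - x) ^ (a + s))))"
      unfolding poly_jacobi_poly_sum sum_distrib_left sum_distrib_right
      by (intro sum.cong refl) (simp only: power_add neg mult_ac)
  qed
  also have "(\<integral>x. (\<Sum>s\<le>n. ((-1) ^ s * real ((n + a) choose (n - s)) * real (n choose s)) *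
          (indicator {0..1} x * (x ^ (n - s + m) * (1 - x) ^ (a + s)))) \<partial>lborel)
      = (\<Sum>s\<le>n. ((-1) ^ s * real ((n + a) choose (n - s)) * real (n choose s)) *
          (fact (n - s + m) * fact (a + s) / fact (n - s + m + (a + s) + 1)))"
    by (subst Bochner_Integration.integral_sum, rule int)
      (simp only: integral_mult_right_zero beta_integral_nat)
  also have "\<dots> = (\<Sum>s\<le>n. fact (n + a) * fact m / fact (n + a + m + 1) *
          ((-1) ^ s * real (n choose s) * real ((n - s + m) choose m)))"
  proof (rule sum.cong[OF refl])
    fix s assume "s \<in> {..n}"
    then have s: "s \<le> n" by simp
    have b1: "real ((n + a) choose (n - s)) = fact (n + a) / (fact (n - s) * fact (a + s))"
    proof -
      have "n + a - (n - s) = a + s" using s by simp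
      then show ?thesis using binomial_fact[of "n - s" "n + a", where 'a = real] by simp
    qed
    have b2: "real ((n - s + m) choose m) = fact (n - s + m) / (fact m * fact (n - s))"
      using binomial_fact[of m "n - s + m", where 'a = real] by (simp only: diff_add_inverse2 le_add2)
    have e: "n - s + m + (a + s) + 1 = n + a + m + 1" using s by simp
    show "((-1) ^ s * real ((n + a) choose (n - s)) * real (n choose s)) *
          (fact (n - s + m) * fact (a + s) / fact (n - s + m + (a + s) + 1))
        = fact (n + a) * fact m / fact (n + a + m + 1) *
          ((-1) ^ s * real (n choose s) * real ((n - s + m) choose m))"
      unfolding b1 b2 e by (simp add: field_simps)
  qed
  also have "\<dots> = fact (n + a) * fact m / fact (n + a + m + 1) *
      (\<Sum>s\<le>n. (-1) ^ s * real (n choose s) * real ((n - s + m) choose m))"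
    by (simp only: sum_distrib_left)
  also have "(\<Sum>s\<le>n. (-1) ^ s * real (n choose s) * real ((n - s + m) choose m))
      = (\<Sum>r\<le>n. (-1) ^ n * ((-1) ^ r * real (n choose r) * real ((r + m) choose m)))"
  proof (rule sum.reindex_bij_witness[where i = "\<lambda>r. n - r" and j = "\<lambda>s. n - s"])
    fix s assume "s \<in> {..n}"
    then have s: "s \<le> n" by simp
    then have "n choose (n - s) = n choose s" by (rule binomial_symmetric[symmetric])
    moreover have "(-1 :: real) ^ n = (-1) ^ s * (-1) ^ (n - s)" using s by (simp add: power_add[symmetric])
    moreover have "(-1 :: real) ^ (n - s) * (-1) ^ (n - s) = 1" by (rule minus_one_power_mult_self)
    ultimately show "(-1) ^ n * ((-1) ^ (n - s) * real (n choose (n - s)) * real ((n - s + m) choose m))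
        = (-1) ^ s * real (n choose s) * real ((n - s + m) choose m)"
      by (simp only: mult.assoc) (simp only: mult.assoc[symmetric] mult_1_right)
  qed auto
  also have "\<dots> = (-1) ^ n * (if m = n then (-1) ^ n else 0)"
    by (simp only: sum_distrib_left[symmetric] alternating_choose_sum[OF assms])
  also have "\<dots> = (if m = n then 1 else 0)" using minus_one_power_mult_self[of n] by simp
  finally have "L2_inner (jac_weight a) (poly (jacobi_poly a n)) (\<lambda>x. x ^ m)
      = fact (n + a) * fact m / fact (n + a + m + 1) * (if m = n then 1 else 0)" .
  moreover have "n + a + n + 1 = 2 * n + a + 1" by simp
  ultimately show ?thesis by (cases "m = n") (simp_all only: if_True if_False mult_1_right mult_zero_right refl)
qed

lemma L2_inner_poly_expand:
  "L2_inner (jac_weight a) (poly p) (poly q)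
    = (\<Sum>m\<le>degree q. poly.coeff q m * L2_inner (jac_weight a) (poly p) (\<lambda>x. x ^ m))"
proof -
  have "square_integrable (jac_weight a) (\<lambda>x. x ^ m)" for m
  proof -
    have "poly (monom 1 m) = (\<lambda>x :: real. x ^ m)" by (simp add: fun_eq_iff poly_monom)
    then show ?thesis using square_integrable_poly[of a "monom 1 m"] by simp
  qed
  then have "L2_inner (jac_weight a) (\<lambda>x. \<Sum>m\<le>degree q. poly.coeff q m * x ^ m) (poly p)
      = (\<Sum>m\<le>degree q. L2_inner (jac_weight a) (\<lambda>x. poly.coeff q m * x ^ m) (poly p))"
    by (intro L2_inner_sum_left square_integrable_cmult) auto
  moreover have "poly q = (\<lambda>x. \<Sum>m\<le>degree q. poly.coeff q m * x ^ m)"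
    by (simp add: poly_altdef fun_eq_iff)
  ultimately have "L2_inner (jac_weight a) (poly q) (poly p)
      = (\<Sum>m\<le>degree q. poly.coeff q m * L2_inner (jac_weight a) (\<lambda>x. x ^ m) (poly p))"
    by (simp only: L2_inner_cmult_left)
  then show ?thesis by (simp add: L2_inner_commute)
qed

lemma jacobi_poly_inner:
  assumes "degree q \<le> n"
  shows "L2_inner (jac_weight a) (poly (jacobi_poly a n)) (poly q)
    = poly.coeff q n * (fact (n + a) * fact n / fact (2 * n + a + 1))"
proof -
  have "L2_inner (jac_weight a) (poly (jacobi_poly a n)) (poly q)
      = (\<Sum>m\<le>degree q. if m = n then poly.coeff q n * (fact (n + a) * fact n / fact (2 * n + a + 1)) else 0)"
    unfolding L2_inner_poly_expand using assms by (intro sum.cong) (auto simp: jacobi_poly_moment)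
  then show ?thesis using assms by (auto simp: coeff_eq_0)
qed

lemma jacobi_poly_inner_lower:
  "degree q < n \<Longrightarrow> L2_inner (jac_weight a) (poly (jacobi_poly a n)) (poly q) = 0"
  by (simp add: jacobi_poly_inner coeff_eq_0)

interpretation jacobi: orthogonal_family "jac_weight a" "\<lambda>n. poly (jacobi_poly a n)" UNIV for a
proof
  fix i j :: nat assume "i \<noteq> j"
  then consider "i < j" | "j < i" by linarith
  then show "L2_inner (jac_weight a) (poly (jacobi_poly a i)) (poly (jacobi_poly a j)) = 0"
  proof cases
    case 1
    then show ?thesis by (subst L2_inner_commute) (simp add: jacobi_poly_inner_lower)
  qed (simp add: jacobi_poly_inner_lower)
next
  fix i
  show "0 < L2_inner (jac_weight a) (poly (jacobi_poly a i)) (poly (jacobi_poly a i))"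
    using coeff_jacobi_poly_pos[of a i] by (simp add: jacobi_poly_inner)
qed simp

lemma poly_in_jacobi_span:
  assumes "degree q \<le> m"
  shows "\<exists>c. q = (\<Sum>l\<le>m. smult (c l) (jacobi_poly a l))"
  using assms
proof (induction m arbitrary: q)
  case 0
  have "jacobi_poly a 0 = 1" by (simp add: jacobi_poly_def)
  moreover obtain b where "q = [:b:]" using 0 degree_0_id[of q] by (metis le_zero_eq)
  ultimately show ?case by (intro exI[of _ "\<lambda>_. b"]) simp
next
  case (Suc m)
  define b where "b = poly.coeff q (Suc m) / poly.coeff (jacobi_poly a (Suc m)) (Suc m)"
  define r where "r = q - smult b (jacobi_poly a (Suc m))"
  have "poly.coeff r (Suc m) = 0"
    using coeff_jacobi_poly_pos[of a "Suc m"] by (simp add: r_def b_def)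
  moreover have "degree r \<le> Suc m"
    unfolding r_def using Suc.prems by (intro degree_diff_le order_trans[OF degree_smult_le]) auto
  ultimately have "degree r \<le> m"
    by (metis degree_0 le_SucE le_zero_eq leading_coeff_0_iff zero_le)
  then obtain c where c: "r = (\<Sum>l\<le>m. smult (c l) (jacobi_poly a l))" using Suc.IH by blast
  have "(\<Sum>l\<le>m. smult ((c(Suc m := b)) l) (jacobi_poly a l)) = r" unfolding c by (intro sum.cong) auto
  then have "q = (\<Sum>l\<le>Suc m. smult ((c(Suc m := b)) l) (jacobi_poly a l))" by (simp add: r_def)
  then show ?case by blast
qed

lemma poly_eq_jacobi_expansion:
  assumes "degree q \<le> m"
  shows "poly q x = (\<Sum>l\<le>m. coeff (jac_weight a) (\<lambda>n. poly (jacobi_poly a n)) (poly q) l * poly (jacobi_poly a l) x)"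
proof -
  obtain c where c: "q = (\<Sum>l\<le>m. smult (c l) (jacobi_poly a l))"
    using poly_in_jacobi_span[OF assms] by blast
  then have q: "poly q = (\<lambda>x. \<Sum>l\<le>m. c l * poly (jacobi_poly a l) x)"
    by (simp add: poly_sum fun_eq_iff)
  have "coeff (jac_weight a) (\<lambda>n. poly (jacobi_poly a n)) (poly q) l = c l" if "l \<le> m" for l
    unfolding q using that by (subst jacobi.coeff_comb) auto
  then show ?thesis using q by (auto intro!: sum.cong)
qed

lemma jacobi_poly_reflect: "poly (jacobi_poly 0 n) (1 - x) = (-1) ^ n * poly (jacobi_poly 0 n) x"
proof -
  have "poly (jacobi_poly 0 n) (1 - x)
      = (\<Sum>s\<le>n. real (n choose (n - s)) * real (n choose s) * (- x) ^ s * (1 - x) ^ (n - s))"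
    by (simp add: poly_jacobi_poly_sum)
  also have "\<dots> = (\<Sum>s\<le>n. (-1) ^ n * (real (n choose (n - s)) * real (n choose s) * (x - 1) ^ s * x ^ (n - s)))"
  proof (rule sum.reindex_bij_witness[where i = "\<lambda>r. n - r" and j = "\<lambda>s. n - s"])
    fix s assume "s \<in> {..n}"
    then have s: "s \<le> n" by simp
    have "(-1 :: real) ^ n = (-1) ^ s * (-1) ^ (n - s)" using s by (simp add: power_add[symmetric])
    moreover have "(x - 1) ^ (n - s) = (-1) ^ (n - s) * (1 - x) ^ (n - s)" "(- x) ^ s = (-1) ^ s * x ^ s"
      by (simp_all add: power_mult_distrib[symmetric])
    moreover have "(-1 :: real) ^ (n - s) * (-1) ^ (n - s) = 1" by (rule minus_one_power_mult_self)
    ultimately show "(-1) ^ n * (real (n choose (n - (n - s))) * real (n choose (n - s)) * (x - 1) ^ (n - s) * x ^ (n - (n - s)))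
        = real (n choose (n - s)) * real (n choose s) * (- x) ^ s * (1 - x) ^ (n - s)"
      using s by (simp add: mult_ac) 
  qed auto
  finally show ?thesis by (simp add: poly_jacobi_poly_sum sum_distrib_left)
qed

lemma jacobi_poly_1_at_0: "poly (jacobi_poly (Suc 0) n) 0 = (-1) ^ n"
proof -
  have "poly (jacobi_poly (Suc 0) n) 0 = (\<Sum>s\<le>n. if s = n then (-1) ^ n else 0)"
    unfolding poly_jacobi_poly_sum by (intro sum.cong) auto
  then show ?thesis by simp
qed

lemma jacobi_poly_1_norm:
  "L2_inner (jac_weight (Suc 0)) (poly (jacobi_poly (Suc 0) n)) (poly (jacobi_poly (Suc 0) n)) = 1 / (2 * real n + 2)"
proof -
  have "real ((2 * n + 1) choose n) = fact (2 * n + 1) / (fact n * fact (n + 1))"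
    using binomial_fact[of n "2 * n + 1", where 'a = real] by simp
  moreover have "fact (2 * n + 1 + 1) = (2 * real n + 2) * fact (2 * n + 1)"
    unfolding Suc_eq_plus1[symmetric] fact_Suc by simp
  moreover have "f / (g * h) * (h * g / (b * f)) = 1 / b" if "f \<noteq> 0" "g \<noteq> 0" "h \<noteq> 0" for f g h b :: real
    using that by (simp add: field_simps)
  ultimately have "real ((2 * n + 1) choose n) * (fact (n + 1) * fact n / fact (2 * n + 1 + 1)) = 1 / (2 * real n + 2)"
    by (simp only: fact_nonzero not_False_eq_True)
  then show ?thesis by (simp add: jacobi_poly_inner coeff_jacobi_poly)
qed

section \<open>Localisation of the orthogonal projections\<close>

abbreviation weight10 :: "real measure" where "weight10 \<equiv> jac_weight (Suc 0)"
abbreviation inner10 :: "(real \<Rightarrow> real) \<Rightarrow> (real \<Rightarrow> real) \<Rightarrow> real" where "inner10 \<equiv> L2_inner weight10"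
abbreviation norm10 :: "(real \<Rightarrow> real) \<Rightarrow> real" where "norm10 \<equiv> L2_norm_on weight10"
abbreviation jac10 :: "nat \<Rightarrow> real \<Rightarrow> real" where "jac10 n \<equiv> poly (jacobi_poly (Suc 0) n)"

definition rec_up :: "nat \<Rightarrow> real" where "rec_up n = (real n + 2) / (2 * (2 * real n + 3))"
definition rec_down :: "nat \<Rightarrow> real" where "rec_down n = real n / (2 * (2 * real n + 1))"

lemma rec_up_eq: "rec_up n = poly.coeff (jacobi_poly (Suc 0) n) n / poly.coeff (jacobi_poly (Suc 0) (Suc n)) (Suc n)"
proof -
  have 1: "real ((2 * n + 1) choose n) = fact (2 * n + 1) / (fact n * fact (n + 1))"
    using binomial_fact[of n "2 * n + 1", where 'a = real] by simp
  have "2 * Suc n + 1 - Suc n = Suc (n + 1)" by simp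
  then have 2: "real ((2 * Suc n + 1) choose Suc n) = fact (2 * Suc n + 1) / (fact (Suc n) * fact (Suc (n + 1)))"
    using binomial_fact[of "Suc n" "2 * Suc n + 1", where 'a = real] by simp
  have 3: "fact (2 * Suc n + 1) = (2 * real n + 3) * ((2 * real n + 2) * fact (2 * n + 1))"
  proof -
    have "2 * Suc n + 1 = Suc (Suc (2 * n + 1))" by simp
    then show ?thesis by (simp only: fact_Suc) (simp add: algebra_simps)
  qed
  have 4: "fact (Suc n) = (real n + 1) * fact n" "fact (Suc (n + 1)) = (real n + 2) * fact (n + 1)"
    unfolding fact_Suc by simp_all
  have "(f / (g * h)) / (p * (q * f) / (r * g * (s * h))) = r * s / (p * q)"
    if "f \<noteq> 0" "g \<noteq> 0" "h \<noteq> 0" for f g h p q r s :: real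
    using that by (simp add: field_simps)
  then have "real ((2 * n + 1) choose n) / real ((2 * Suc n + 1) choose Suc n)
      = (real n + 1) * (real n + 2) / ((2 * real n + 3) * (2 * real n + 2))"
    unfolding 1 2 3 4 by (simp only: fact_nonzero not_False_eq_True)
  also have "\<dots> = rec_up n"
    unfolding rec_up_def by (simp add: divide_simps) (simp add: algebra_simps)
  finally show ?thesis by (simp only: coeff_jacobi_poly One_nat_def)
qed

lemma jac10_recurrence:
  "x * jac10 n x = rec_up n * jac10 (Suc n) x + (rec_up n + rec_down n) * jac10 n x + rec_down n * jac10 (n - 1) x"
proof -
  let ?J = "jacobi_poly (Suc 0)" and ?N = "\<lambda>n. inner10 (jac10 n) (jac10 n)"
  let ?\<kappa> = "\<lambda>n. poly.coeff (?J n) n"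
  define q where "q = [:0, 1:] * ?J n"
  define c where "c l = coeff weight10 jac10 (poly q) l" for l
  have dq: "degree q \<le> Suc n" unfolding q_def by (intro order_trans[OF degree_mult_le]) simp
  have ex: "poly q x = (\<Sum>l\<le>Suc n. c l * jac10 l x)" for x
    unfolding c_def by (rule poly_eq_jacobi_expansion[OF dq])
  have N: "?N m = ?\<kappa> m * (fact (m + 1) * fact m / fact (2 * m + 1 + 1))" for m
    by (simp add: jacobi_poly_inner)
  have F: "inner10 (jac10 m) (poly p) = poly.coeff p m * ?N m / ?\<kappa> m" if "degree p \<le> m" for m p
    using coeff_jacobi_poly_pos[of "Suc 0" m] that by (simp add: N jacobi_poly_inner)
  have Npos: "0 < ?N m" for m by (rule jacobi.inner_pos) simp
  have top: "c (Suc n) = rec_up n"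
  proof -
    have "inner10 (poly q) (jac10 (Suc n)) = poly.coeff q (Suc n) * ?N (Suc n) / ?\<kappa> (Suc n)"
      using F[OF dq] by (simp add: L2_inner_commute)
    moreover have "poly.coeff q (Suc n) = ?\<kappa> n" by (simp add: q_def)
    ultimately show ?thesis
      unfolding c_def coeff_eq_inner rec_up_eq using Npos[of "Suc n"] by simp
  qed
  have low: "c l = (if Suc l = n then rec_down n else 0)" if "l < n" for l
  proof -
    define p where "p = [:0, 1:] * ?J l"
    have dp: "degree p \<le> n" unfolding p_def using that by (intro order_trans[OF degree_mult_le]) simp
    have "inner10 (poly q) (jac10 l) = inner10 (jac10 n) (poly p)"
      by (simp add: L2_inner_def q_def p_def mult_ac)
    also have "\<dots> = poly.coeff p n * ?N n / ?\<kappa> n" by (rule F[OF dp])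
    finally have c: "c l = poly.coeff p n * ?N n / ?\<kappa> n / ?N l" unfolding c_def coeff_eq_inner by simp
    show ?thesis
    proof (cases "Suc l = n")
      case True
      then have "poly.coeff p n = ?\<kappa> l" by (auto simp: p_def)
      then have "c l = rec_up l * (?N n / ?N l)" using c True rec_up_eq[of l] by simp
      also have "\<dots> = rec_down n"
        unfolding True[symmetric] jacobi_poly_1_norm rec_up_def rec_down_def
        by (simp add: divide_simps) (simp add: algebra_simps)
      finally show ?thesis using True by simp
    next
      case False
      then have "degree p < n" unfolding p_def using that
        by (intro le_less_trans[OF degree_mult_le]) simp
      then show ?thesis using c False by (simp add: coeff_eq_0)
    qed
  qed
  have "(\<Sum>l\<le>Suc n. c l * jac10 l x) = c (Suc n) * jac10 (Suc n) x + c n * jac10 n x + (\<Sum>l<n. c l * jac10 l x)" for x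
    by (simp add: lessThan_Suc_atMost[symmetric])
  moreover have "(\<Sum>l<n. c l * jac10 l x) = rec_down n * jac10 (n - 1) x" for x
  proof (cases n)
    case (Suc m)
    have "(\<Sum>l<n. c l * jac10 l x) = (\<Sum>l<n. if l = m then rec_down n * jac10 m x else 0)"
      using Suc by (intro sum.cong) (auto simp: low)
    then show ?thesis using Suc by simp
  qed (simp add: rec_down_def)
  ultimately have eq: "x * jac10 n x = rec_up n * jac10 (Suc n) x + c n * jac10 n x + rec_down n * jac10 (n - 1) x" for x
    using ex[of x] by (simp add: q_def top)
  have "c n = rec_up n + rec_down n"
  proof -
    have "rec_down n * (-1) ^ (n - 1) = - (rec_down n * (-1) ^ n)"
      by (cases n) (simp_all add: rec_down_def)
    then have "(-1 :: real) ^ n * (c n - rec_up n - rec_down n) = 0"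
      using eq[of 0] unfolding jacobi_poly_1_at_0 by (simp add: algebra_simps)
    then show ?thesis by simp
  qed
  then show ?thesis using eq by simp
qed

definition power_coeff :: "nat \<Rightarrow> nat \<Rightarrow> nat \<Rightarrow> real" where
  "power_coeff k n l = inner10 (\<lambda>x. x ^ k * jac10 n x) (jac10 l) * (2 * real l + 2)"

lemma square_integrable_monom_poly [simp]: "square_integrable (jac_weight a) (\<lambda>x. x ^ k * poly p x)"
proof -
  have "(\<lambda>x. x ^ k * poly p x) = poly (monom 1 k * p)" by (auto simp: poly_monom)
  then show ?thesis by simp
qed

lemma power_coeff_Suc:
  "power_coeff (Suc k) n l =
     rec_up l * ((real l + 1) / (real l + 2)) * power_coeff k n (Suc l) + (rec_up l + rec_down l) * power_coeff k n l
     + rec_down l * ((real l + 1) / real l) * power_coeff k n (l - 1)"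
proof -
  let ?f = "\<lambda>x. x ^ k * jac10 n x"
  have sq: "square_integrable weight10 (\<lambda>x. a * jac10 i x)" for a i
    by (intro square_integrable_cmult square_integrable_poly)
  have "(\<lambda>x. x * jac10 l x) = (\<lambda>x. (rec_up l * jac10 (Suc l) x + (rec_up l + rec_down l) * jac10 l x) + rec_down l * jac10 (l - 1) x)"
    by (rule ext) (rule jac10_recurrence)
  then have "inner10 (\<lambda>x. x * jac10 l x) ?f
      = inner10 (\<lambda>x. (rec_up l * jac10 (Suc l) x + (rec_up l + rec_down l) * jac10 l x) + rec_down l * jac10 (l - 1) x) ?f"
    by (rule arg_cong)
  then have "inner10 (\<lambda>x. x * jac10 l x) ?f = rec_up l * inner10 (jac10 (Suc l)) ?f
      + (rec_up l + rec_down l) * inner10 (jac10 l) ?f + rec_down l * inner10 (jac10 (l - 1)) ?f"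
    by (simp only: L2_inner_add_left[OF square_integrable_add[OF sq sq] sq square_integrable_monom_poly]
        L2_inner_add_left[OF sq sq square_integrable_monom_poly] L2_inner_cmult_left)
  moreover have "inner10 (\<lambda>x. x ^ Suc k * jac10 n x) (jac10 l) = inner10 (\<lambda>x. x * jac10 l x) ?f"
    by (simp add: L2_inner_def mult_ac)
  ultimately have eq: "inner10 (\<lambda>x. x ^ Suc k * jac10 n x) (jac10 l) = rec_up l * inner10 ?f (jac10 (Suc l))
      + (rec_up l + rec_down l) * inner10 ?f (jac10 l) + rec_down l * inner10 ?f (jac10 (l - 1))"
    by (simp only: L2_inner_commute[of weight10 "jac10 _" ?f])
  have s1: "(2 * real l + 2) = ((real l + 1) / (real l + 2)) * (2 * real (Suc l) + 2)"
    by (simp add: field_simps)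
  have s2: "rec_down l * (2 * real l + 2) = rec_down l * ((real l + 1) / real l) * (2 * real (l - 1) + 2)"
  proof (cases l)
    case (Suc m)
    then have "(real l + 1) / real l * (2 * real (l - 1) + 2) = 2 * real l + 2"
      by (simp add: divide_simps) (simp add: algebra_simps)
    then show ?thesis by (simp only: mult.assoc)
  qed (simp add: rec_down_def)
  have dist: "(u * x + v * y + w * z) * t = u * x * t + v * (y * t) + z * (w * t)" for u v w x y z t :: real
    by (simp add: algebra_simps)
  have "power_coeff (Suc k) n l = rec_up l * inner10 ?f (jac10 (Suc l)) * (2 * real l + 2)
      + (rec_up l + rec_down l) * (inner10 ?f (jac10 l) * (2 * real l + 2))
      + inner10 ?f (jac10 (l - 1)) * (rec_down l * (2 * real l + 2))"
    unfolding power_coeff_def eq by (simp only: dist)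
  also have "rec_up l * inner10 ?f (jac10 (Suc l)) * (2 * real l + 2)
      = rec_up l * ((real l + 1) / (real l + 2)) * power_coeff k n (Suc l)"
    unfolding power_coeff_def by (subst s1) (simp only: mult_ac)
  finally show ?thesis unfolding s2 power_coeff_def by (simp only: mult_ac)
qed

text \<open>
  The limits of \<open>power_coeff\<close> along diagonals: coefficients of the powers of the free Jacobi
  matrix on the integers, whose rows have the entries \<open>1/4, 1/2, 1/4\<close>.
\<close>

definition walk :: "nat \<Rightarrow> int \<Rightarrow> real" where
  "walk k j = (if 0 \<le> int k + j then real ((2 * k) choose nat (int k + j)) / 4 ^ k else 0)"

lemma walk_Suc: "walk (Suc k) j = 1 / 4 * walk k (j + 1) + 1 / 2 * walk k j + 1 / 4 * walk k (j - 1)"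
proof -
  consider "int k + j < -1" | "int k + j = -1" | "int k + j = 0" | "0 < int k + j" by linarith
  then show ?thesis
  proof cases
    case 4
    define i where "i = nat (int k + j - 1)"
    have 4: "int k + j = int (Suc i)" using 4 by (simp add: i_def)
    have n: "nat (int (Suc k) + j) = Suc (Suc i)" "nat (int k + (j + 1)) = Suc (Suc i)"
      "nat (int k + j) = Suc i" "nat (int k + (j - 1)) = i"
      using 4 by auto
    have p: "0 \<le> int (Suc k) + j" "0 \<le> int k + (j + 1)" "0 \<le> int k + j" "0 \<le> int k + (j - 1)"
      using 4 by auto
    show ?thesis unfolding walk_def n using p by (simp add: field_simps)
  next
    case 1
    then show ?thesis by (simp add: walk_def)
  next
    case 2
    then have "nat (int (Suc k) + j) = 0" "nat (int k + (j + 1)) = 0"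
      "\<not> 0 \<le> int k + j" "\<not> 0 \<le> int k + (j - 1)" "0 \<le> int (Suc k) + j" "0 \<le> int k + (j + 1)"
      by auto
    then show ?thesis unfolding walk_def by (simp only: if_True if_False) simp
  next
    case 3
    then have "nat (int (Suc k) + j) = Suc 0" "nat (int k + (j + 1)) = Suc 0" "nat (int k + j) = 0"
      "\<not> 0 \<le> int k + (j - 1)" "0 \<le> int (Suc k) + j" "0 \<le> int k + (j + 1)" "0 \<le> int k + j"
      by auto
    then show ?thesis unfolding walk_def by (simp only: if_True if_False) (simp add: field_simps)
  qed
qed

lemma power_coeff_limit: "(\<lambda>n. power_coeff k n (nat (int n + j))) \<longlonglongrightarrow> walk k j"
proof (induction k arbitrary: j)
  case 0
  have "\<forall>\<^sub>F n in sequentially. power_coeff 0 n (nat (int n + j)) = walk 0 j"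
    using eventually_ge_at_top[of "nat \<bar>j\<bar>"]
  proof eventually_elim
    case (elim n)
    then have "n = nat (int n + j) \<longleftrightarrow> j = 0" by auto
    then show ?case
      using jacobi.orthogonal[of n "nat (int n + j)" "Suc 0"] jacobi_poly_1_norm[of n]
      by (auto simp: power_coeff_def walk_def)
  qed
  then show ?case by (rule tendsto_eventually)
next
  case (Suc k)
  let ?l = "\<lambda>n. nat (int n + j)"
  have l: "filterlim ?l at_top sequentially"
    unfolding filterlim_at_top
  proof
    fix Z
    show "\<forall>\<^sub>F n in sequentially. Z \<le> ?l n" using eventually_ge_at_top[of "Z + nat \<bar>j\<bar>"]
      by eventually_elim linarith
  qed
  have lim: "(\<lambda>n. rec_up n * ((real n + 1) / (real n + 2))) \<longlonglongrightarrow> 1 / 4"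
    "(\<lambda>n. rec_up n + rec_down n) \<longlonglongrightarrow> 1 / 2"
    "(\<lambda>n. rec_down n * ((real n + 1) / real n)) \<longlonglongrightarrow> 1 / 4"
    unfolding rec_up_def rec_down_def by real_asymp+
  note lim' = lim[THEN filterlim_compose[OF _ l]]
  have ev: "\<forall>\<^sub>F n in sequentially. 
     rec_up (?l n) * ((real (?l n) + 1) / (real (?l n) + 2)) * power_coeff k n (nat (int n + (j + 1)))
     + (rec_up (?l n) + rec_down (?l n)) * power_coeff k n (nat (int n + j))
     + rec_down (?l n) * ((real (?l n) + 1) / real (?l n)) * power_coeff k n (nat (int n + (j - 1)))
     = power_coeff (Suc k) n (?l n)"
    using eventually_ge_at_top[of "Suc (nat \<bar>j\<bar>)"]
  proof eventually_elim
    case (elim n)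
    then have "nat (int n + (j + 1)) = Suc (?l n)" "nat (int n + (j - 1)) = ?l n - 1" by auto
    then show ?case by (simp only: power_coeff_Suc)
  qed
  show ?case unfolding walk_Suc
    by (rule Lim_transform_eventually[OF _ ev]) (intro tendsto_add tendsto_mult lim' Suc)
qed

lemma central_walk_bound: "(walk k 0)\<^sup>2 * (2 * real k + 1) \<le> 1"
proof (induction k)
  case (Suc k)
  have "Suc k * ((2 * Suc k) choose Suc k) = 2 * Suc (2 * k) * ((2 * k) choose k)"
    using Suc_times_binomial_eq[of "2 * k + 1" k] Suc_times_binomial_eq[of "2 * k" k]
      binomial_symmetric[of k "Suc (2 * k)"] by (simp add: algebra_simps)
  then have "real (Suc k * ((2 * Suc k) choose Suc k)) = real (2 * Suc (2 * k) * ((2 * k) choose k))"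
    by (rule arg_cong)
  then have "real ((2 * Suc k) choose Suc k) = 2 * (2 * real k + 1) / (real k + 1) * real ((2 * k) choose k)"
    by (simp add: field_simps del: binomial_Suc_Suc)
  then have w: "walk (Suc k) 0 = (2 * real k + 1) / (2 * real k + 2) * walk k 0"
  proof -
    have w0: "walk k 0 = real ((2 * k) choose k) / 4 ^ k" for k by (simp add: walk_def)
    have "2 * a / b * C / (4 * F) = a / (2 * b) * (C / F)" for a b C F :: real by (simp add: mult_ac)
    moreover have "2 * real k + 2 = 2 * (real k + 1)" by simp
    ultimately show ?thesis
      unfolding w0 \<open>real ((2 * Suc k) choose Suc k) = _\<close> power_Suc by (simp only:)
  qed
  have "((2 * real k + 1) / (2 * real k + 2))\<^sup>2 * (2 * real (Suc k) + 1) \<le> 2 * real k + 1"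
    by (simp add: divide_simps power2_eq_square) (simp add: algebra_simps)
  then have "(walk k 0)\<^sup>2 * (((2 * real k + 1) / (2 * real k + 2))\<^sup>2 * (2 * real (Suc k) + 1))
      \<le> (walk k 0)\<^sup>2 * (2 * real k + 1)"
    by (intro mult_left_mono) auto
  with Suc show ?case unfolding w power_mult_distrib by (simp add: mult_ac)
qed (simp add: walk_def)

lemma central_walk_small:
  assumes "0 < e"
  shows "\<exists>k. walk k 0 < e"
proof -
  obtain k where k: "1 / e\<^sup>2 < real k" using reals_Archimedean2 by blast
  have "(walk k 0)\<^sup>2 < e\<^sup>2"
  proof (rule ccontr)
    assume "\<not> (walk k 0)\<^sup>2 < e\<^sup>2"
    then have "e\<^sup>2 * (2 * real k + 1) \<le> (walk k 0)\<^sup>2 * (2 * real k + 1)" by (intro mult_right_mono) auto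
    then have "e\<^sup>2 * (2 * real k + 1) \<le> 1" using central_walk_bound[of k] by linarith
    moreover have "0 < e\<^sup>2" using assms by simp
    moreover from this k have "1 < real k * e\<^sup>2" by (simp only: pos_divide_less_eq)
    moreover have "e\<^sup>2 * (2 * real k + 1) = 2 * (real k * e\<^sup>2) + e\<^sup>2" by (simp add: algebra_simps)
    ultimately show False by linarith
  qed
  then have "walk k 0 < e" using assms by (intro power2_less_imp_less[of "walk k 0" e]) simp_all
  then show ?thesis ..
qed

text \<open>
  The measures \<open>(jac10 n)\<^sup>2 weight10\<close>, normalised, converge to the arcsine law, which has no atom
  at 1. It suffices that the limits of their moments tend to 0.
\<close>

lemma jac10_not_concentrated:
  assumes e: "0 < e"
  shows "\<exists>d\<in>{0<..<1}. \<forall>\<^sub>F n in sequentially.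
      norm10 (\<lambda>x. indicator {1 - d..} x * jac10 n x) \<le> e * norm10 (jac10 n)"
proof -
  obtain k where k: "walk k 0 < e\<^sup>2 / 2" using central_walk_small[of "e\<^sup>2 / 2"] e by auto
  define d where "d = 1 / (2 * real k + 2)"
  have d: "0 < d" "d < 1" by (simp_all add: d_def)
  have "1 - real k * d \<le> (1 - d) ^ k" using Bernoulli_inequality[of "- d" k] d by simp
  moreover have "1 / 2 \<le> 1 - real k * d" by (simp add: d_def field_simps)
  ultimately have half: "1 / 2 \<le> (1 - d) ^ k" by linarith
  have "\<forall>\<^sub>F n in sequentially. power_coeff k n (nat (int n + 0)) < e\<^sup>2 / 2"
    using power_coeff_limit k by (rule order_tendstoD(2))
  then have "\<forall>\<^sub>F n in sequentially.
      norm10 (\<lambda>x. indicator {1 - d..} x * jac10 n x) \<le> e * norm10 (jac10 n)"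
  proof eventually_elim
    case (elim n)
    let ?I = "inner10 (\<lambda>x. x ^ k * jac10 n x) (jac10 n)"
    have 1: "inner10 (\<lambda>x. indicator {1 - d..} x * jac10 n x) (\<lambda>x. indicator {1 - d..} x * jac10 n x)
        \<le> inner10 (\<lambda>x. 2 * (x ^ k * jac10 n x)) (jac10 n)"
      unfolding L2_inner_def
    proof (rule integral_mono_AE')
      show "integrable weight10 (\<lambda>x. 2 * (x ^ k * jac10 n x) * jac10 n x)"
        by (intro square_integrable_mult square_integrable_cmult) simp_all
      show "AE x in weight10. indicator {1 - d..} x * jac10 n x * (indicator {1 - d..} x * jac10 n x)
          \<le> 2 * (x ^ k * jac10 n x) * jac10 n x"
        using AE_jac_weight
      proof eventually_elim
        case (elim x)
        have "indicator {1 - d..} x \<le> 2 * x ^ k"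
        proof (cases "1 - d \<le> x")
          case True
          then have "(1 - d) ^ k \<le> x ^ k" using d by (intro power_mono) auto
          then show ?thesis using half by (auto simp: indicator_def)
        qed (use elim in auto)
        then have "indicator {1 - d..} x * (jac10 n x)\<^sup>2 \<le> 2 * x ^ k * (jac10 n x)\<^sup>2"
          by (intro mult_right_mono) auto
        then show ?case by (auto simp: indicator_def power2_eq_square split: if_splits)
      qed
      show "AE x in weight10. 0 \<le> 2 * (x ^ k * jac10 n x) * jac10 n x"
        using AE_jac_weight
      proof eventually_elim
        case (elim x)
        then have "0 \<le> 2 * x ^ k * (jac10 n x)\<^sup>2" by simp
        then show ?case by (simp only: power2_eq_square mult_ac)
      qed
    qed
    have 2: "inner10 (\<lambda>x. 2 * (x ^ k * jac10 n x)) (jac10 n) = 2 * ?I" by (rule L2_inner_cmult_left)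
    have "2 * ?I \<le> e\<^sup>2 * inner10 (jac10 n) (jac10 n)"
      using elim unfolding power_coeff_def jacobi_poly_1_norm by (simp add: field_simps)
    with 1 2 have "(norm10 (\<lambda>x. indicator {1 - d..} x * jac10 n x))\<^sup>2 \<le> (e * norm10 (jac10 n))\<^sup>2"
      by (simp add: L2_norm_on_power2 power_mult_distrib)
    then show ?case by (rule power2_le_imp_le) (use e in simp)
  qed
  then show ?thesis using d by auto
qed

lemma poly_in_span_proj:
  assumes "degree q < n"
  shows "jacobi.proj a {..<n} (poly q) x = poly q x"
proof -
  obtain m where m: "n = Suc m" "degree q \<le> m" using assms by (cases n) auto
  show ?thesis
    unfolding jacobi.proj_def m lessThan_Suc_atMost using poly_eq_jacobi_expansion[OF m(2)] by simp
qed

lemma proj_eq_poly: "\<exists>q. jacobi.proj a {..<n} f = poly q \<and> degree q \<le> n - 1"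
proof (intro exI conjI)
  show "jacobi.proj a {..<n} f = poly (\<Sum>i<n. smult (coeff (jac_weight a) (\<lambda>n. poly (jacobi_poly a n)) f i) (jacobi_poly a i))"
    by (simp add: fun_eq_iff jacobi.proj_def poly_sum)
  show "degree (\<Sum>i<n. smult (coeff (jac_weight a) (\<lambda>n. poly (jacobi_poly a n)) f i) (jacobi_poly a i)) \<le> n - 1"
    by (intro degree_sum_le order_trans[OF degree_smult_le]) auto
qed

lemma AE_power_le_1: "AE x in jac_weight a. \<bar>x ^ k\<bar> \<le> 1"
  using AE_jac_weight by eventually_elim (simp add: power_le_one)

text \<open>
  Multiplication by \<open>x ^ k\<close> makes functions supported in \<open>[0, 1/2]\<close> small without changing the
  neighbourhood of 1 much, and its commutator with the projection onto polynomials of degree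
  less than \<open>n\<close> has rank at most \<open>2 k\<close> with range spanned by \<open>jac10 i\<close>, \<open>n - k \<le> i < n + k\<close>. These do not
  concentrate at 1.
\<close>

lemma proj_localised:
  assumes e: "0 < e"
  shows "\<exists>d\<in>{0<..<1}. \<forall>\<^sub>F n in sequentially. \<forall>f. square_integrable weight10 f \<longrightarrow> (\<forall>x>1/2. f x = 0) \<longrightarrow>
    norm10 (\<lambda>x. indicator {1 - d..} x * (f x - jacobi.proj (Suc 0) {..<n} f x)) \<le> e * norm10 f"
proof -
  obtain k0 where k0: "(1 / 2 :: real) ^ k0 < e / 4"
    using real_arch_pow_inv[of "e / 4" "1 / 2"] e by auto
  define k where "k = Suc k0"
  have k: "(1 / 2 :: real) ^ k \<le> e / 4" "0 < k"
    using k0 power_decreasing[of k0 "Suc k0" "1 / 2 :: real"] unfolding k_def by linarith simp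
  define e' where "e' = e / (16 * real k)"
  have e': "0 < e'" using e k by (simp add: e'_def)
  obtain d0 where d0: "0 < d0" "d0 < 1" and tight: "\<forall>\<^sub>F n in sequentially.
      norm10 (\<lambda>x. indicator {1 - d0..} x * jac10 n x) \<le> e' * norm10 (jac10 n)"
    using jac10_not_concentrated[OF e'] by auto
  obtain N where N: "norm10 (\<lambda>x. indicator {1 - d0..} x * jac10 n x) \<le> e' * norm10 (jac10 n)"
    if "N \<le> n" for n
    using tight by (auto simp: eventually_sequentially)
  define d where "d = min d0 (1 / (2 * real k))"
  have d: "0 < d" "d < 1" "d \<le> d0" "real k * d \<le> 1 / 2"
    using d0 k by (auto simp: d_def min_def field_simps)
  have "1 - real k * d \<le> (1 - d) ^ k" using Bernoulli_inequality[of "- d" k] d by simp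
  then have half: "1 / 2 \<le> (1 - d) ^ k" using d(4) by linarith
  define cut :: "real \<Rightarrow> real" where "cut = indicator {1 - d..}"
  have cut_meas [measurable]: "cut \<in> borel_measurable borel" by (simp add: cut_def)
  have cut_le: "AE x in weight10. \<bar>cut x\<bar> \<le> 1" by (simp add: cut_def indicator_def)
  have tight': "norm10 (\<lambda>x. cut x * jac10 n x) \<le> e' * norm10 (jac10 n)" if "N \<le> n" for n
  proof -
    have "norm10 (\<lambda>x. cut x * jac10 n x) \<le> norm10 (\<lambda>x. indicator {1 - d0..} x * jac10 n x)"
    proof (rule L2_norm_on_mono)
      show "square_integrable weight10 (\<lambda>x. indicator {1 - d0..} x * jac10 n x)"
        by (rule square_integrable_bounded_mult[where B = 1]) (auto simp: indicator_def)
    qed (use d in \<open>auto simp: cut_def indicator_def\<close>)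
    with N[OF that] show ?thesis by simp
  qed
  have "\<forall>\<^sub>F n in sequentially. \<forall>f. square_integrable weight10 f \<longrightarrow> (\<forall>x>1/2. f x = 0) \<longrightarrow>
    norm10 (\<lambda>x. cut x * (f x - jacobi.proj (Suc 0) {..<n} f x)) \<le> e * norm10 f"
    using eventually_ge_at_top[of "N + k + 1"]
  proof eventually_elim
    case (elim n)
    show ?case
    proof (intro allI impI)
      fix f assume f: "square_integrable weight10 f" and supp: "\<forall>x>1/2. f x = 0"
      let ?P = "jacobi.proj (Suc 0) {..<n}" and ?g = "\<lambda>x. x ^ k * f x"
      let ?F = "norm10 f"
      have [measurable]: "f \<in> borel_measurable borel" using square_integrable_measurable[OF f] by simp
      have sP: "square_integrable weight10 (?P u)" for u by (rule jacobi.square_integrable_proj) simp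
      have g: "square_integrable weight10 ?g"
        by (rule square_integrable_bounded_mult[where B = 1]) (auto simp: f AE_power_le_1)
      have sxP: "square_integrable weight10 (\<lambda>x. x ^ k * ?P f x)"
        by (rule square_integrable_bounded_mult[where B = 1]) (auto simp: sP AE_power_le_1)
      define r where "r = (\<lambda>x. ?P ?g x - x ^ k * ?P f x)"
      have r: "square_integrable weight10 r" unfolding r_def by (intro square_integrable_diff sP sxP)
      have g_small: "norm10 ?g \<le> (1 / 2) ^ k * ?F"
      proof -
        have "norm10 ?g \<le> norm10 (\<lambda>x. (1 / 2) ^ k * f x)"
        proof (rule L2_norm_on_mono)
          show "AE x in weight10. \<bar>x ^ k * f x\<bar> \<le> \<bar>(1 / 2) ^ k * f x\<bar>"
            using AE_jac_weight
          proof eventually_elim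
            case (elim x)
            then show ?case
            proof (cases "x \<le> 1 / 2")
              case True
              then have "x ^ k \<le> (1 / 2) ^ k" using elim by (intro power_mono) auto
              then show ?thesis using elim by (simp add: abs_mult mult_right_mono del: power_divide)
            qed (use supp in auto)
          qed
        qed (auto intro: square_integrable_cmult f)
        then show ?thesis by (simp only: L2_norm_on_cmult) simp
      qed
      have r_norm: "norm10 r \<le> 2 * ?F"
      proof -
        have "norm10 r \<le> norm10 (?P ?g) + norm10 (\<lambda>x. x ^ k * ?P f x)"
          unfolding r_def by (intro L2_norm_on_triangle_diff sP sxP)
        also have "norm10 (?P ?g) \<le> norm10 ?g"
          by (intro jacobi.norm_proj_le g) auto
        also have "norm10 ?g \<le> 1 * ?F"
          by (rule L2_norm_on_bounded_mult) (auto simp: f AE_power_le_1)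
        also have "norm10 (\<lambda>x. x ^ k * ?P f x) \<le> 1 * norm10 (?P f)"
          by (rule L2_norm_on_bounded_mult) (auto simp: sP AE_power_le_1)
        also have "norm10 (?P f) \<le> ?F"
          by (intro jacobi.norm_proj_le f) auto
        finally show ?thesis by simp
      qed
      have r_coeff: "coeff weight10 jac10 r i = 0" if "i + k < n" for i
      proof -
        define q where "q = monom 1 k * jacobi_poly (Suc 0) i"
        have q: "poly q = (\<lambda>x. x ^ k * jac10 i x)" by (simp add: q_def poly_monom fun_eq_iff)
        have dq: "degree q < n"
          unfolding q_def using that by (intro le_less_trans[OF degree_mult_le]) (simp add: degree_monom_eq)
        have "inner10 r (jac10 i) = inner10 (?P ?g) (jac10 i) - inner10 (\<lambda>x. x ^ k * ?P f x) (jac10 i)"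
          unfolding r_def by (intro L2_inner_diff_left sP sxP square_integrable_poly)
        also have "inner10 (?P ?g) (jac10 i) = inner10 ?g (jac10 i)"
        proof -
          have "coeff weight10 jac10 (?P ?g) i = coeff weight10 jac10 ?g i"
            using that by (subst jacobi.coeff_proj) auto
          then show ?thesis using jacobi.inner_pos[of i "Suc 0"] by (simp add: coeff_eq_inner)
        qed
        also have "\<dots> = inner10 f (poly q)" unfolding q by (simp add: L2_inner_def mult_ac)
        also have "inner10 (\<lambda>x. x ^ k * ?P f x) (jac10 i) = inner10 (?P f) (poly q)"
          unfolding q by (simp add: L2_inner_def mult_ac)
        also have "inner10 f (poly q) - inner10 (?P f) (poly q)
            = inner10 (\<lambda>x. f x - ?P f x) (poly q)"
          by (intro L2_inner_diff_left[symmetric] f sP square_integrable_poly)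
        also have "poly q = (\<lambda>x. \<Sum>l<n. coeff weight10 jac10 (poly q) l * jac10 l x)"
          using poly_in_span_proj[OF dq, of "Suc 0"] unfolding jacobi.proj_def by (simp add: fun_eq_iff)
        also have "inner10 (\<lambda>x. f x - ?P f x) \<dots> = 0"
          by (intro jacobi.inner_residual_comb f) auto
        finally show ?thesis by (simp add: coeff_eq_inner)
      qed
      obtain q1 where q1: "?P ?g = poly q1" "degree q1 \<le> n - 1" using proj_eq_poly by blast
      obtain q2 where q2: "?P f = poly q2" "degree q2 \<le> n - 1" using proj_eq_poly by blast
      have rp: "r = poly (q1 - monom 1 k * q2)"
        unfolding r_def q1 q2 by (simp add: poly_monom fun_eq_iff)
      have "degree (q1 - monom 1 k * q2) < n + k"
      proof -
        have "degree (monom 1 k * q2) \<le> k + (n - 1)"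
          using degree_mult_le[of "monom 1 k" q2] q2(2) by (simp add: degree_monom_eq)
        then have "degree (q1 - monom 1 k * q2) \<le> k + (n - 1)"
          using q1(2) by (intro degree_diff_le) auto
        then show ?thesis using elim by simp
      qed
      then have r_sum: "r x = (\<Sum>i<n + k. coeff weight10 jac10 r i * jac10 i x)" for x
        using poly_in_span_proj[of "q1 - monom 1 k * q2" "n + k" "Suc 0" x]
        unfolding rp jacobi.proj_def by simp
      have r_sum': "r x = (\<Sum>i\<in>{n - k..<n + k}. coeff weight10 jac10 r i * jac10 i x)" for x
        unfolding r_sum[of x] using r_coeff by (intro sum.mono_neutral_right) auto
      have cut_r: "norm10 (\<lambda>x. cut x * r x) \<le> 2 * real k * (e' * (2 * ?F))"
      proof -
        have "(\<lambda>x. cut x * r x) = (\<lambda>x. \<Sum>i\<in>{n - k..<n + k}. coeff weight10 jac10 r i * (cut x * jac10 i x))"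
          by (subst r_sum') (simp add: sum_distrib_left mult_ac)
        then have "norm10 (\<lambda>x. cut x * r x)
            \<le> (\<Sum>i\<in>{n - k..<n + k}. norm10 (\<lambda>x. coeff weight10 jac10 r i * (cut x * jac10 i x)))"
          using L2_norm_on_triangle_sum[of "{n - k..<n + k}" weight10 "\<lambda>i x. coeff weight10 jac10 r i * (cut x * jac10 i x)"]
            square_integrable_cmult[OF square_integrable_bounded_mult[OF square_integrable_poly _ cut_le]] by simp
        also have "\<dots> \<le> (\<Sum>i\<in>{n - k..<n + k}. e' * (2 * ?F))"
        proof (rule sum_mono)
          fix i assume "i \<in> {n - k..<n + k}"
          then have i: "N \<le> i" using elim unfolding atLeastLessThan_iff by linarith
          have "norm10 (\<lambda>x. coeff weight10 jac10 r i * (cut x * jac10 i x))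
              = \<bar>coeff weight10 jac10 r i\<bar> * norm10 (\<lambda>x. cut x * jac10 i x)"
            by (rule L2_norm_on_cmult)
          also have "\<dots> \<le> \<bar>coeff weight10 jac10 r i\<bar> * (e' * norm10 (jac10 i))"
            by (intro mult_left_mono tight' i) simp
          also have "\<dots> = e' * (\<bar>coeff weight10 jac10 r i\<bar> * norm10 (jac10 i))" by (simp only: mult_ac)
          also have "\<dots> \<le> e' * norm10 r"
            using e' r by (intro mult_left_mono jacobi.coeff_norm_le) auto
          also have "\<dots> \<le> e' * (2 * ?F)" using e' r_norm by (intro mult_left_mono) auto
          finally show "norm10 (\<lambda>x. coeff weight10 jac10 r i * (cut x * jac10 i x)) \<le> e' * (2 * ?F)" .
        qed
        also have "\<dots> = 2 * real k * (e' * (2 * ?F))" using elim by simp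
        finally show ?thesis .
      qed
      have sR: "square_integrable weight10 (\<lambda>x. ?g x - ?P ?g x)" by (intro square_integrable_diff g sP)
      have "norm10 (\<lambda>x. cut x * (f x - ?P f x)) \<le> norm10 (\<lambda>x. 2 * (cut x * (?g x - ?P ?g x) + cut x * r x))"
      proof (rule L2_norm_on_mono)
        show "square_integrable weight10 (\<lambda>x. 2 * (cut x * (?g x - ?P ?g x) + cut x * r x))"
          using sR r by (intro square_integrable_cmult square_integrable_add square_integrable_bounded_mult[OF _ _ cut_le]) auto
        show "(\<lambda>x. cut x * (f x - ?P f x)) \<in> borel_measurable weight10"
          using square_integrable_measurable[OF sP[of f]] by measurable
        show "AE x in weight10. \<bar>cut x * (f x - ?P f x)\<bar> \<le> \<bar>2 * (cut x * (?g x - ?P ?g x) + cut x * r x)\<bar>"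
          using AE_jac_weight
        proof eventually_elim
          case (elim x)
          show ?case
          proof (cases "1 - d \<le> x")
            case True
            then have "(1 - d) ^ k \<le> x ^ k" using d by (intro power_mono) auto
            then have "1 * \<bar>f x - ?P f x\<bar> \<le> (2 * x ^ k) * \<bar>f x - ?P f x\<bar>"
              using half by (intro mult_right_mono) auto
            also have "\<dots> = \<bar>2 * (x ^ k * (f x - ?P f x))\<bar>" using elim by (simp add: abs_mult)
            also have "x ^ k * (f x - ?P f x) = (?g x - ?P ?g x) + r x"
              by (simp add: r_def right_diff_distrib)
            finally show ?thesis using True by (simp add: cut_def)
          qed (simp add: cut_def)
        qed
      qed
      also have "\<dots> = 2 * norm10 (\<lambda>x. cut x * (?g x - ?P ?g x) + cut x * r x)"
        by (simp only: L2_norm_on_cmult abs_numeral)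
      also have "\<dots> \<le> 2 * (norm10 (\<lambda>x. cut x * (?g x - ?P ?g x)) + norm10 (\<lambda>x. cut x * r x))"
        using sR r by (intro mult_left_mono L2_norm_on_triangle square_integrable_bounded_mult[OF _ _ cut_le]) auto
      also have "\<dots> \<le> 2 * (e / 4 * ?F + 2 * real k * (e' * (2 * ?F)))"
      proof (intro mult_left_mono add_mono cut_r)
        have "norm10 (\<lambda>x. cut x * (?g x - ?P ?g x)) \<le> 1 * norm10 (\<lambda>x. ?g x - ?P ?g x)"
          using sR cut_le by (intro L2_norm_on_bounded_mult) auto
        also have "norm10 (\<lambda>x. ?g x - ?P ?g x) \<le> norm10 ?g"
          by (intro jacobi.norm_residual_le g) auto
        also have "\<dots> \<le> (1 / 2) ^ k * ?F" by (rule g_small)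
        also have "\<dots> \<le> e / 4 * ?F" using k by (intro mult_right_mono) auto
        finally show "norm10 (\<lambda>x. cut x * (?g x - ?P ?g x)) \<le> e / 4 * ?F" by simp
      qed simp
      also have "\<dots> = e * ?F"
        using k by (simp add: e'_def field_simps)
      finally show "norm10 (\<lambda>x. cut x * (f x - ?P f x)) \<le> e * ?F" .
    qed
  qed
  then show ?thesis using d unfolding cut_def by auto
qed

section \<open>Integral operators in coefficient space\<close>

lemma borel_measurable_fst_real [measurable]: "fst \<in> borel_measurable (borel :: (real \<times> real) measure)"
  by (intro borel_measurable_continuous_onI continuous_intros)

lemma borel_measurable_snd_real [measurable]: "snd \<in> borel_measurable (borel :: (real \<times> real) measure)"
  by (intro borel_measurable_continuous_onI continuous_intros)

locale jacobi_frame =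
  fixes p :: "nat \<Rightarrow> real \<Rightarrow> real" and c :: "nat \<Rightarrow> real" and B1 B2 :: real
  assumes p_def: "p n = (\<lambda>x. c n * jac10 n x)" and c_nonzero: "c n \<noteq> 0"
    and B1: "0 < B1" and B2: "0 < B2"
    and ell2_coeff: "square_integrable weight10 f \<Longrightarrow> coeff weight10 p f \<in> ell2"
    and norm_coeff_le: "square_integrable weight10 f \<Longrightarrow> ell2_norm (coeff weight10 p f) \<le> B1 * norm10 f"
    and synthesis: "v \<in> ell2 \<Longrightarrow> \<exists>f. square_integrable weight10 f \<and> coeff weight10 p f = v"
    and norm_le_coeff: "square_integrable weight10 f \<Longrightarrow> norm10 f \<le> B2 * ell2_norm (coeff weight10 p f)"
begin

abbreviation an :: "(real \<Rightarrow> real) \<Rightarrow> nat \<Rightarrow> real" where "an \<equiv> coeff weight10 p"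

sublocale orthogonal_family weight10 p UNIV
proof
  show "square_integrable weight10 (p i)" for i
    unfolding p_def by (intro square_integrable_cmult square_integrable_poly)
  have in_p: "inner10 (p i) (p j) = c i * (c j * inner10 (jac10 i) (jac10 j))" for i j
    unfolding p_def by (simp only: L2_inner_cmult_left L2_inner_commute[of _ "jac10 i"])
  show "inner10 (p i) (p j) = 0" if "i \<noteq> j" for i j
    using jacobi.orthogonal[of i j "Suc 0"] that by (simp only: in_p) simp
  show "0 < inner10 (p i) (p i)" for i
  proof -
    have "0 < (c i)\<^sup>2" using c_nonzero[of i] by simp
    then show ?thesis
      using jacobi.inner_pos[of i "Suc 0"]
      unfolding in_p mult.assoc[symmetric] power2_eq_square
      by (rule mult_pos_pos) simp
  qed
qed

lemma proj_eq_jacobi: "proj F f = jacobi.proj (Suc 0) F f"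
proof
  fix x
  have "coeff weight10 p f i * p i x = coeff weight10 jac10 f i * jac10 i x" for i
    unfolding coeff_eq_inner p_def using c_nonzero[of i]
    by (simp only: L2_inner_cmult_left L2_inner_commute[of _ f] L2_inner_commute[of _ "jac10 i" "\<lambda>x. c i * jac10 i x"])
      (simp add: field_simps)
  then show "proj F f x = jacobi.proj (Suc 0) F f x"
    unfolding proj_def jacobi.proj_def by simp
qed

lemma an_p: "an (p i) = (\<lambda>j. if j = i then 1 else 0)"
  using coeff_comb[of "{i}" _ "\<lambda>_. 1"] by auto

lemma norm_p_le: "norm10 (p i) \<le> B2"
proof -
  have "(\<Sum>j. (if j = i then 1 else 0 :: real)\<^sup>2) = (\<Sum>j\<in>{i}. (if j = i then 1 else 0 :: real)\<^sup>2)"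
    by (rule suminf_finite) auto
  then have "ell2_norm (an (p i)) = 1" unfolding an_p ell2_norm_def by simp
  then show ?thesis using norm_le_coeff[OF square_integrable_p[of i]] by simp
qed

lemma an_diff: "square_integrable weight10 f \<Longrightarrow> square_integrable weight10 g \<Longrightarrow> an (\<lambda>x. f x - g x) = (\<lambda>i. an f i - an g i)"
  by (simp add: coeff_diff fun_eq_iff)

lemma an_add: "square_integrable weight10 f \<Longrightarrow> square_integrable weight10 g \<Longrightarrow> an (\<lambda>x. f x + g x) = (\<lambda>i. an f i + an g i)"
  by (simp add: coeff_add fun_eq_iff)

lemma an_cmult: "an (\<lambda>x. a * f x) = (\<lambda>i. a * an f i)"
  by (simp add: coeff_cmult fun_eq_iff)

lemma an_residual:
  assumes "square_integrable weight10 f"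
  shows "an (\<lambda>x. f x - proj {..<n} f x) = tail n (an f)"
  using assms by (auto simp: an_diff square_integrable_proj coeff_proj tail_def)

lemma residual_tendsto_0:
  assumes "square_integrable weight10 f"
  shows "(\<lambda>n. norm10 (\<lambda>x. f x - proj {..<n} f x)) \<longlonglongrightarrow> 0"
proof (rule tendsto_sandwich[where f = "\<lambda>_. 0"])
  have "norm10 (\<lambda>x. f x - proj {..<n} f x) \<le> B2 * ell2_norm (tail n (an f))" for n
    using norm_le_coeff[of "\<lambda>x. f x - proj {..<n} f x"] assms
    by (simp add: an_residual square_integrable_diff square_integrable_proj)
  then show "\<forall>\<^sub>F n in sequentially. norm10 (\<lambda>x. f x - proj {..<n} f x) \<le> B2 * ell2_norm (tail n (an f))"
    by simp
  show "(\<lambda>n. B2 * ell2_norm (tail n (an f))) \<longlonglongrightarrow> 0"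
    by (intro tendsto_mult_right_zero ell2_norm_tail_tendsto_0 ell2_coeff assms)
qed auto

end

lemma square_integrable_indicator_mult:
  assumes "square_integrable M f" "S \<in> sets M"
  shows "square_integrable M (\<lambda>x. indicator S x * f x)"
  using assms by (intro square_integrable_bounded_mult[where B = 1]) (auto simp: indicator_def)

lemma L2_norm_indicator_mult_le:
  assumes "square_integrable M f" "S \<in> sets M"
  shows "L2_norm_on M (\<lambda>x. indicator S x * f x) \<le> L2_norm_on M f"
  using L2_norm_on_bounded_mult[OF assms(1), of "indicator S" 1] assms by (auto simp: indicator_def)

lemma truncation_near_1_tendsto_0:
  assumes f: "square_integrable weight10 f"
  shows "(\<lambda>m. norm10 (\<lambda>x. indicator {1 - 1 / real (Suc m)<..} x * f x)) \<longlonglongrightarrow> 0"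
proof -
  have [measurable]: "f \<in> borel_measurable borel" using square_integrable_measurable[OF f] by simp
  have "(\<lambda>m. \<integral>x. (indicator {1 - 1 / real (Suc m)<..} x * f x)\<^sup>2 \<partial>weight10) \<longlonglongrightarrow> (\<integral>x. 0 \<partial>weight10)"
  proof (rule integral_dominated_convergence)
    show "integrable weight10 (\<lambda>x. (f x)\<^sup>2)" using f by (simp add: square_integrable_def)
    have "AE x in lborel. x \<noteq> (1 :: real)" by (rule AE_lborel_singleton)
    then have "AE x in weight10. x \<noteq> 1"
      unfolding jac_weight_def by (subst AE_density) auto
    with AE_jac_weight show "AE x in weight10. (\<lambda>m. (indicator {1 - 1 / real (Suc m)<..} x * f x)\<^sup>2) \<longlonglongrightarrow> 0"
    proof eventually_elim
      case (elim x)
      then have "x < 1" by auto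
      then obtain M where M: "1 / real (Suc M) < 1 - x" using nat_approx_posE[of "1 - x"] by auto
      have "(indicator {1 - 1 / real (Suc m)<..} x * f x)\<^sup>2 = 0" if "M \<le> m" for m
      proof -
        have "1 / real (Suc m) \<le> 1 / real (Suc M)" using that by (intro divide_left_mono) auto
        then have "x \<notin> {1 - 1 / real (Suc m)<..}" using M by simp
        then show ?thesis by simp
      qed
      then have "\<forall>\<^sub>F m in sequentially. (indicator {1 - 1 / real (Suc m)<..} x * f x)\<^sup>2 = 0"
        unfolding eventually_sequentially by blast
      then show ?case by (rule tendsto_eventually)
    qed
    show "AE x in weight10. norm ((indicator {1 - 1 / real (Suc m)<..} x * f x)\<^sup>2) \<le> (f x)\<^sup>2" for m
      by (auto simp: indicator_def)
  qed auto
  then have "(\<lambda>m. sqrt (\<integral>x. (indicator {1 - 1 / real (Suc m)<..} x * f x)\<^sup>2 \<partial>weight10)) \<longlonglongrightarrow> sqrt 0"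
    by (intro tendsto_real_sqrt) simp
  then show ?thesis by (simp add: L2_norm_on_def)
qed

locale volterra_kernel = jacobi_frame +
  fixes D :: "(real \<times> real) set" and k :: "real \<times> real \<Rightarrow> real" and A :: "(nat \<Rightarrow> real) \<Rightarrow> nat \<Rightarrow> real"
  assumes D_borel [measurable]: "D \<in> sets borel" and D_unit: "D \<subseteq> {0..1} \<times> {0..1}"
    and marginal: "(g :: real \<Rightarrow> real) \<in> borel_measurable borel \<Longrightarrow> integrable weight10 g \<Longrightarrow>
      integrable lborel (\<lambda>z. indicator D z * g (snd z)) \<and>
      (\<integral>z. indicator D z * g (snd z) \<partial>lborel) = (\<integral>x. g x \<partial>weight10)"
    and k_square_integrable: "square_integrable lborel k" and k_outside: "z \<notin> D \<Longrightarrow> k z = 0"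
    and A_repr: "square_integrable weight10 f \<Longrightarrow> A (coeff weight10 p f) j =
      (\<integral>z. k z * f (snd z) * (p j (fst z) * (1 - fst z)) \<partial>lborel) / inner10 (p j) (p j)"
    and A_ell2: "u \<in> ell2 \<Longrightarrow> A u \<in> ell2"
begin

lemma k_measurable [measurable]: "k \<in> borel_measurable borel"
  using square_integrable_measurable[OF k_square_integrable] by simp

lemma square_integrable_snd:
  assumes f: "square_integrable weight10 f"
  shows "square_integrable lborel (\<lambda>z. indicator D z * f (snd z))"
    and "L2_norm_on lborel (\<lambda>z. indicator D z * f (snd z)) = norm10 f"
proof -
  have [measurable]: "f \<in> borel_measurable borel" using square_integrable_measurable[OF f] by simp
  have *: "(\<lambda>z. (indicator D z * f (snd z))\<^sup>2) = (\<lambda>z. indicator D z * (f (snd z))\<^sup>2)"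
    by (auto simp: indicator_def)
  have "integrable weight10 (\<lambda>x. (f x)\<^sup>2)" using f by (simp add: square_integrable_def)
  then have "integrable lborel (\<lambda>z. indicator D z * (f (snd z))\<^sup>2)"
    "(\<integral>z. indicator D z * (f (snd z))\<^sup>2 \<partial>lborel) = (\<integral>x. (f x)\<^sup>2 \<partial>weight10)"
    using marginal[of "\<lambda>x. (f x)\<^sup>2"] by auto
  then show "square_integrable lborel (\<lambda>z. indicator D z * f (snd z))"
    "L2_norm_on lborel (\<lambda>z. indicator D z * f (snd z)) = norm10 f"
    unfolding square_integrable_def L2_norm_on_def * by auto
qed

definition test :: "nat \<Rightarrow> real \<times> real \<Rightarrow> real" where
  "test j z = indicator ({0..1} \<times> {0..1}) z * (p j (fst z) * (1 - fst z))"

lemma p_measurable [measurable]: "p j \<in> borel_measurable borel"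
  using square_integrable_measurable[OF square_integrable_p[of j]] by simp

lemma test_measurable [measurable]: "test j \<in> borel_measurable borel"
proof -
  have [measurable]: "{0..1} \<times> {0..1 :: real} \<in> sets (borel :: (real \<times> real) measure)"
    by (intro borel_closed closed_Times closed_atLeastAtMost)
  show ?thesis unfolding test_def[abs_def] by measurable
qed

lemma test_bounded: "\<exists>C\<ge>0. \<forall>z. \<bar>test j z\<bar> \<le> C"
proof -
  have "compact ((\<lambda>x. p j x * (1 - x)) ` {0..1})"
    unfolding p_def by (intro compact_continuous_image continuous_intros) simp
  then obtain C where "\<forall>y\<in>(\<lambda>x. p j x * (1 - x)) ` {0..1}. norm y \<le> C"
    using compact_imp_bounded bounded_iff by blast
  then have "\<bar>test j z\<bar> \<le> max C 0" for z
    by (cases z) (auto simp: test_def indicator_def le_max_iff_disj)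
  then show ?thesis by (intro exI[of _ "max C 0"]) auto
qed

definition test_bound :: "nat \<Rightarrow> real" where
  "test_bound j = (SOME C. C \<ge> 0 \<and> (\<forall>z. \<bar>test j z\<bar> \<le> C))"

lemma test_bound: "0 \<le> test_bound j" "\<bar>test j z\<bar> \<le> test_bound j"
  using someI_ex[OF test_bounded[of j]] unfolding test_bound_def by blast+

lemma square_integrable_test:
  assumes "square_integrable weight10 f"
  shows "square_integrable lborel (\<lambda>z. test j z * (indicator D z * f (snd z)))"
  by (rule square_integrable_bounded_mult[where B = "test_bound j"])
    (auto intro: square_integrable_snd(1) assms test_bound(2))

lemma integrand_eq: "k z * f (snd z) * (p j (fst z) * (1 - fst z)) = k z * (test j z * (indicator D z * f (snd z)))"
proof (cases "z \<in> D")
  case True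
  then have "z \<in> {0..1} \<times> {0..1}" using D_unit by blast
  then show ?thesis using True by (simp add: test_def)
qed (simp add: k_outside)

lemma A_repr_inner:
  assumes "square_integrable weight10 f"
  shows "A (an f) j = L2_inner lborel (\<lambda>z. test j z * (indicator D z * f (snd z))) k / inner10 (p j) (p j)"
  unfolding A_repr[OF assms] integrand_eq by (simp only: L2_inner_def mult.commute[of "k _"])

lemma A_row_bounded:
  assumes f: "square_integrable weight10 f"
  shows "\<bar>A (an f) j\<bar> \<le> test_bound j * L2_norm_on lborel k / inner10 (p j) (p j) * norm10 f"
proof -
  have "\<bar>L2_inner lborel (\<lambda>z. test j z * (indicator D z * f (snd z))) k\<bar>
      \<le> L2_norm_on lborel (\<lambda>z. test j z * (indicator D z * f (snd z))) * L2_norm_on lborel k"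
    by (intro L2_inner_Cauchy_Schwarz square_integrable_test f k_square_integrable)
  also have "\<dots> \<le> (test_bound j * L2_norm_on lborel (\<lambda>z. indicator D z * f (snd z))) * L2_norm_on lborel k"
    by (intro mult_right_mono L2_norm_on_bounded_mult)
      (auto intro: square_integrable_snd(1) f test_bound)
  also have "\<dots> = test_bound j * L2_norm_on lborel k * norm10 f"
    by (simp add: square_integrable_snd(2)[OF f])
  finally show ?thesis
    unfolding A_repr_inner[OF f] using inner_pos[of j] by (simp add: divide_right_mono abs_divide)
qed

sublocale ell2_operator A
proof
  show "A u \<in> ell2" if "u \<in> ell2" for u using that by (rule A_ell2)
  show "A (\<lambda>i. u i + v i) = (\<lambda>i. A u i + A v i)" if uv: "u \<in> ell2" "v \<in> ell2" for u v
  proof -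
    obtain f where f: "square_integrable weight10 f" "an f = u" using synthesis[OF uv(1)] by blast
    obtain g where g: "square_integrable weight10 g" "an g = v" using synthesis[OF uv(2)] by blast
    have "A (an (\<lambda>x. f x + g x)) j = A (an f) j + A (an g) j" for j
    proof -
      have "(\<lambda>z. test j z * (indicator D z * (f (snd z) + g (snd z))))
          = (\<lambda>z. test j z * (indicator D z * f (snd z)) + test j z * (indicator D z * g (snd z)))"
        by (simp add: algebra_simps)
      then show ?thesis
        unfolding A_repr_inner[OF f(1)] A_repr_inner[OF g(1)] A_repr_inner[OF square_integrable_add[OF f(1) g(1)]]
        using square_integrable_test[OF f(1)] square_integrable_test[OF g(1)] k_square_integrable
        by (simp only: L2_inner_add_left add_divide_distrib)
    qed
    then show ?thesis unfolding an_add[OF f(1) g(1)] f(2) g(2) by blast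
  qed
  show "A (\<lambda>i. a * u i) = (\<lambda>i. a * A u i)" if u: "u \<in> ell2" for u a
  proof -
    obtain f where f: "square_integrable weight10 f" "an f = u" using synthesis[OF u] by blast
    have "A (an (\<lambda>x. a * f x)) j = a * A (an f) j" for j
    proof -
      have "(\<lambda>z. test j z * (indicator D z * (a * f (snd z)))) = (\<lambda>z. a * (test j z * (indicator D z * f (snd z))))"
        by (simp add: algebra_simps)
      then show ?thesis
        unfolding A_repr_inner[OF f(1)] A_repr_inner[OF square_integrable_cmult[OF f(1)]]
        by (simp only: L2_inner_cmult_left times_divide_eq_right)
    qed
    then show ?thesis unfolding an_cmult f(2) by blast
  qed
qed

lemma A_bounded: "\<exists>B\<ge>0. \<forall>u\<in>ell2. ell2_norm (A u) \<le> B * ell2_norm u"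
proof (rule bounded_of_bounded_rows)
  fix j
  let ?C = "test_bound j * L2_norm_on lborel k / inner10 (p j) (p j)"
  have C: "0 \<le> ?C" using test_bound(1)[of j] inner_pos[of j] by simp
  have "\<bar>A u j\<bar> \<le> (?C * B2) * ell2_norm u" if u: "u \<in> ell2" for u
  proof -
    obtain f where f: "square_integrable weight10 f" "an f = u" using synthesis[OF u] by blast
    have "\<bar>A u j\<bar> \<le> ?C * norm10 f" using A_row_bounded[OF f(1), of j] f(2) by simp
    also have "\<dots> \<le> ?C * (B2 * ell2_norm u)" using C norm_le_coeff[OF f(1)] f(2) by (intro mult_left_mono) auto
    finally show ?thesis by (simp only: mult.assoc)
  qed
  then show "\<exists>C. \<forall>u\<in>ell2. \<bar>A u j\<bar> \<le> C * ell2_norm u" by blast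
qed

lemma k_pair_measurable [measurable]: "k \<in> borel_measurable (lborel \<Otimes>\<^sub>M lborel)"
  using k_measurable by (simp add: lborel_prod)

definition section_fun :: "real set \<Rightarrow> real \<Rightarrow> real \<Rightarrow> real" where
  "section_fun S x y = k (x, y) * indicator S y / (1 - y)"

definition apply_kernel :: "real set \<Rightarrow> (real \<Rightarrow> real) \<Rightarrow> real \<Rightarrow> real" where
  "apply_kernel S f x = (\<integral>y. k (x, y) * (indicator S y * f y) \<partial>lborel)"

definition finite_on :: "real set \<Rightarrow> bool" where
  "finite_on S \<longleftrightarrow> S \<in> sets borel \<and>
     integrable lborel (\<lambda>z. (k z)\<^sup>2 * (1 - fst z) / (1 - snd z) * indicator S (snd z))"

definition mass_on :: "real set \<Rightarrow> real" where
  "mass_on S = (\<integral>z. (k z)\<^sup>2 * (1 - fst z) / (1 - snd z) * indicator S (snd z) \<partial>lborel)"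

lemma k_row_measurable [measurable]: "(\<lambda>y. k (x, y)) \<in> borel_measurable borel"
  using measurable_compose[OF measurable_Pair1' k_pair_measurable, of x] by simp

lemma section_fun_measurable [measurable]:
  assumes [measurable]: "S \<in> sets borel"
  shows "section_fun S x \<in> borel_measurable borel"
  unfolding section_fun_def[abs_def] by measurable

lemma k_eq_0: "x \<notin> {0..1} \<or> y \<notin> {0..1} \<Longrightarrow> k (x, y) = 0"
  using D_unit by (intro k_outside) auto

lemma apply_kernel_eq_inner:
  assumes S: "S \<in> sets borel" and f: "f \<in> borel_measurable borel"
  shows "apply_kernel S f x = inner10 (section_fun S x) f"
proof -
  have [measurable]: "S \<in> sets borel" "f \<in> borel_measurable borel" by fact+
  have "inner10 (section_fun S x) f
      = (\<integral>y. indicator {0..1} y * (1 - y) ^ Suc 0 * (section_fun S x y * f y) \<partial>lborel)"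
    unfolding L2_inner_def by (rule integral_jac_weight) measurable
  also have "\<dots> = apply_kernel S f x"
    unfolding apply_kernel_def
  proof (rule integral_cong_AE)
    have "AE y in lborel. y \<noteq> (1 :: real)" by (rule AE_lborel_singleton)
    then show "AE y in lborel. indicator {0..1} y * (1 - y) ^ Suc 0 * (section_fun S x y * f y) = k (x, y) * (indicator S y * f y)"
    proof eventually_elim
      case (elim y)
      then show ?case by (cases "y \<in> {0..1}") (simp_all add: section_fun_def k_eq_0)
    qed
  qed measurable
  finally show ?thesis by simp
qed

lemma apply_kernel_outside: "x \<notin> {0..1} \<Longrightarrow> apply_kernel S f x = 0"
  by (simp add: apply_kernel_def k_eq_0)

lemma apply_kernel_measurable:
  assumes [measurable]: "S \<in> sets borel" "f \<in> borel_measurable borel"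
  shows "apply_kernel S f \<in> borel_measurable borel"
proof -
  have "(\<lambda>x. \<integral>y. (\<lambda>(x, y). k (x, y) * (indicator S y * f y)) (x, y) \<partial>lborel) \<in> borel_measurable lborel"
    by (intro lborel.borel_measurable_lebesgue_integral) measurable
  then show ?thesis by (simp add: apply_kernel_def[abs_def])
qed

lemma section_fun_square:
  assumes "x < 1"
  shows "(k (x, y))\<^sup>2 * (1 - x) / (1 - y) * indicator S y
    = (1 - x) * (indicator {0..1} y * (1 - y) ^ Suc 0 * (section_fun S x y)\<^sup>2)"
  using k_eq_0[of x y] by (auto simp: section_fun_def indicator_def power_divide power2_eq_square)

lemma sections_square_integrable:
  assumes S: "finite_on S"
  shows "AE x in lborel. x < 1 \<longrightarrow> square_integrable weight10 (section_fun S x) \<and>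
      (1 - x) * inner10 (section_fun S x) (section_fun S x)
      = (\<integral>y. (k (x, y))\<^sup>2 * (1 - x) / (1 - y) * indicator S y \<partial>lborel)"
    and "integrable lborel (\<lambda>x. \<integral>y. (k (x, y))\<^sup>2 * (1 - x) / (1 - y) * indicator S y \<partial>lborel)"
    and "(\<integral>x. (\<integral>y. (k (x, y))\<^sup>2 * (1 - x) / (1 - y) * indicator S y \<partial>lborel) \<partial>lborel) = mass_on S"
proof -
  have Sb [measurable]: "S \<in> sets borel" using S by (simp add: finite_on_def)
  let ?h = "\<lambda>z. (k z)\<^sup>2 * (1 - fst z) / (1 - snd z) * indicator S (snd z)"
  have int: "integrable (lborel \<Otimes>\<^sub>M lborel) ?h" using S by (simp add: finite_on_def lborel_prod)
  from lborel_pair.AE_integrable_fst'[OF int]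
  show "AE x in lborel. x < 1 \<longrightarrow> square_integrable weight10 (section_fun S x) \<and>
      (1 - x) * inner10 (section_fun S x) (section_fun S x)
      = (\<integral>y. (k (x, y))\<^sup>2 * (1 - x) / (1 - y) * indicator S y \<partial>lborel)"
  proof eventually_elim
    case (elim x)
    show ?case
    proof
      assume x: "x < 1"
      have *: "integrable lborel (\<lambda>y. (1 - x) * (indicator {0..1} y * (1 - y) ^ Suc 0 * (section_fun S x y)\<^sup>2))"
        using elim unfolding fst_conv snd_conv section_fun_square[OF x] .
      then have "integrable lborel (\<lambda>y. indicator {0..1} y * (1 - y) ^ Suc 0 * (section_fun S x y)\<^sup>2)"
        using x unfolding integrable_mult_left_iff by simp
      then have "integrable weight10 (\<lambda>y. (section_fun S x y)\<^sup>2)"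
        by (subst integrable_jac_weight) auto
      moreover have "inner10 (section_fun S x) (section_fun S x)
          = (\<integral>y. indicator {0..1} y * (1 - y) ^ Suc 0 * (section_fun S x y)\<^sup>2 \<partial>lborel)"
        unfolding L2_inner_def power2_eq_square[symmetric] by (rule integral_jac_weight) measurable
      ultimately show "square_integrable weight10 (section_fun S x) \<and>
        (1 - x) * inner10 (section_fun S x) (section_fun S x)
        = (\<integral>y. (k (x, y))\<^sup>2 * (1 - x) / (1 - y) * indicator S y \<partial>lborel)"
        unfolding section_fun_square[OF x] by (simp add: square_integrable_def)
    qed
  qed
  show "integrable lborel (\<lambda>x. \<integral>y. (k (x, y))\<^sup>2 * (1 - x) / (1 - y) * indicator S y \<partial>lborel)"
    using lborel_pair.integrable_fst'[OF int] by simp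
  show "(\<integral>x. (\<integral>y. (k (x, y))\<^sup>2 * (1 - x) / (1 - y) * indicator S y \<partial>lborel) \<partial>lborel) = mass_on S"
    using lborel_pair.integral_fst'[OF int] by (simp add: mass_on_def lborel_prod)
qed

lemma weight10_integral_bound:
  fixes q :: "real \<Rightarrow> real"
  assumes S: "finite_on S" and q [measurable]: "q \<in> borel_measurable borel" and C: "0 \<le> C" and q0: "\<And>x. 0 \<le> q x"
    and le: "\<And>x. square_integrable weight10 (section_fun S x) \<Longrightarrow>
      q x \<le> C * inner10 (section_fun S x) (section_fun S x)"
  shows "integrable weight10 q" "(\<integral>x. q x \<partial>weight10) \<le> C * mass_on S"
proof -
  let ?m = "\<lambda>x. \<integral>y. (k (x, y))\<^sup>2 * (1 - x) / (1 - y) * indicator S y \<partial>lborel"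
  have m: "integrable lborel (\<lambda>x. C * ?m x)"
    using sections_square_integrable(2)[OF S] by simp
  have "AE x in lborel. x \<noteq> (1 :: real)" by (rule AE_lborel_singleton)
  with sections_square_integrable(1)[OF S]
  have ae: "AE x in lborel. indicator {0..1} x * (1 - x) ^ Suc 0 * q x \<le> C * ?m x"
  proof eventually_elim
    case (elim x)
    show ?case
    proof (cases "x \<in> {0..1}")
      case True
      then have x: "x < 1" using elim by auto
      with elim have s: "square_integrable weight10 (section_fun S x)"
        and eq: "(1 - x) * inner10 (section_fun S x) (section_fun S x) = ?m x" by auto
      have "(1 - x) * q x \<le> (1 - x) * (C * inner10 (section_fun S x) (section_fun S x))"
        using le[OF s] x by (intro mult_left_mono) auto
      also have "\<dots> = C * ((1 - x) * inner10 (section_fun S x) (section_fun S x))" by simp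
      finally show ?thesis using True unfolding eq by simp
    next
      case False
      then have "?m x = 0" using k_eq_0 by simp
      then show ?thesis using False by simp
    qed
  qed
  have "integrable lborel (\<lambda>x. indicator {0..1} x * (1 - x) ^ Suc 0 * q x)"
  proof (rule Bochner_Integration.integrable_bound[OF m])
    show "AE x in lborel. norm (indicator {0..1} x * (1 - x) ^ Suc 0 * q x) \<le> norm (C * ?m x)"
      using ae
    proof eventually_elim
      case (elim x)
      have "0 \<le> indicator {0..1} x * (1 - x) ^ Suc 0 * q x" using q0 by (intro mult_nonneg_nonneg jac_weight_nonneg)
      with elim show ?case by (simp only: real_norm_def abs_of_nonneg order_trans[OF _ elim])
    qed
  qed measurable
  then show int: "integrable weight10 q" by (simp add: integrable_jac_weight)
  have "(\<integral>x. q x \<partial>weight10) = (\<integral>x. indicator {0..1} x * (1 - x) ^ Suc 0 * q x \<partial>lborel)"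
    by (rule integral_jac_weight) measurable
  also have "\<dots> \<le> (\<integral>x. C * ?m x \<partial>lborel)"
    using \<open>integrable lborel (\<lambda>x. indicator {0..1} x * (1 - x) ^ Suc 0 * q x)\<close> m ae by (rule integral_mono_AE)
  also have "\<dots> = C * mass_on S" using sections_square_integrable(3)[OF S] by simp
  finally show "(\<integral>x. q x \<partial>weight10) \<le> C * mass_on S" .
qed

lemma apply_kernel_an:
  assumes S: "finite_on S" and f: "square_integrable weight10 f"
  shows "square_integrable weight10 (apply_kernel S f)"
    and "A (an (\<lambda>x. indicator S x * f x)) = an (apply_kernel S f)"
proof -
  have Sb [measurable]: "S \<in> sets borel" using S by (simp add: finite_on_def)
  have fb [measurable]: "f \<in> borel_measurable borel" using square_integrable_measurable[OF f] by simp
  have [measurable]: "apply_kernel S f \<in> borel_measurable borel" by (intro apply_kernel_measurable) measurable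
  have "integrable weight10 (\<lambda>x. (apply_kernel S f x)\<^sup>2)"
  proof (rule weight10_integral_bound[OF S])
    fix x assume "square_integrable weight10 (section_fun S x)"
    from L2_inner_Cauchy_Schwarz_square[OF this f]
    show "(apply_kernel S f x)\<^sup>2 \<le> inner10 f f * inner10 (section_fun S x) (section_fun S x)"
      by (simp add: apply_kernel_eq_inner[OF Sb fb] mult.commute)
  qed auto
  then show sq: "square_integrable weight10 (apply_kernel S f)" by (simp add: square_integrable_def)
  have Sf: "square_integrable weight10 (\<lambda>x. indicator S x * f x)"
    using f by (rule square_integrable_indicator_mult) simp
  show "A (an (\<lambda>x. indicator S x * f x)) = an (apply_kernel S f)"
  proof
    fix j
    let ?g = "\<lambda>z. k z * (indicator S (snd z) * f (snd z)) * (p j (fst z) * (1 - fst z))"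
    have "integrable lborel (\<lambda>z. k z * (test j z * (indicator D z * (indicator S (snd z) * f (snd z)))))"
      using square_integrable_mult[OF k_square_integrable square_integrable_test[OF Sf]] .
    then have int: "integrable (lborel \<Otimes>\<^sub>M lborel) ?g"
      unfolding lborel_prod integrand_eq[of _ "\<lambda>y. indicator S y * f y"] .
    have "(\<integral>z. ?g z \<partial>lborel) = (\<integral>x. (\<integral>y. ?g (x, y) \<partial>lborel) \<partial>lborel)"
      using lborel_pair.integral_fst'[OF int] by (simp add: lborel_prod)
    also have "(\<lambda>x. \<integral>y. ?g (x, y) \<partial>lborel) = (\<lambda>x. indicator {0..1} x * (1 - x) ^ Suc 0 * (apply_kernel S f x * p j x))"
    proof
      fix x
      have "(\<integral>y. ?g (x, y) \<partial>lborel) = apply_kernel S f x * (p j x * (1 - x))"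
        unfolding apply_kernel_def by simp
      then show "(\<integral>y. ?g (x, y) \<partial>lborel) = indicator {0..1} x * (1 - x) ^ Suc 0 * (apply_kernel S f x * p j x)"
        using apply_kernel_outside[of x S f] by (auto simp: indicator_def)
    qed
    also have "(\<integral>x. indicator {0..1} x * (1 - x) ^ Suc 0 * (apply_kernel S f x * p j x) \<partial>lborel)
        = inner10 (apply_kernel S f) (p j)"
      unfolding L2_inner_def by (rule integral_jac_weight[symmetric]) measurable
    finally show "A (an (\<lambda>x. indicator S x * f x)) j = an (apply_kernel S f) j"
      unfolding A_repr[OF Sf] coeff_eq_inner by simp
  qed
qed

lemma Hilbert_Schmidt_matrix:
  assumes S: "finite_on S"
  shows "(\<Sum>j<J. \<Sum>i<m. (A (an (\<lambda>x. indicator S x * p i x)) j)\<^sup>2) \<le> B1\<^sup>2 * (B2\<^sup>2 * mass_on S)"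
proof -
  have Sb [measurable]: "S \<in> sets borel" using S by (simp add: finite_on_def)
  let ?G = "\<lambda>i. apply_kernel S (p i)"
  have G: "square_integrable weight10 (?G i)" and AG: "A (an (\<lambda>x. indicator S x * p i x)) = an (?G i)" for i
    using apply_kernel_an[OF S square_integrable_p[of i]] by auto
  have [measurable]: "?G i \<in> borel_measurable borel" for i by (intro apply_kernel_measurable) measurable
  have "(\<Sum>j<J. \<Sum>i<m. (A (an (\<lambda>x. indicator S x * p i x)) j)\<^sup>2) = (\<Sum>i<m. \<Sum>j<J. (an (?G i) j)\<^sup>2)"
    unfolding AG by (rule sum.swap)
  also have "\<dots> \<le> (\<Sum>i<m. B1\<^sup>2 * inner10 (?G i) (?G i))"
  proof (rule sum_mono)
    fix i
    have "(\<Sum>j<J. (an (?G i) j)\<^sup>2) \<le> (ell2_norm (an (?G i)))\<^sup>2"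
      using ell2_coeff[OF G] by (intro sum_power2_le_ell2_norm) auto
    also have "\<dots> \<le> (B1 * norm10 (?G i))\<^sup>2"
      using norm_coeff_le[OF G] ell2_norm_nonneg[OF ell2_coeff[OF G]] by (intro power_mono)
    finally show "(\<Sum>j<J. (an (?G i) j)\<^sup>2) \<le> B1\<^sup>2 * inner10 (?G i) (?G i)"
      by (simp add: power_mult_distrib L2_norm_on_power2)
  qed
  also have "\<dots> = B1\<^sup>2 * (\<integral>x. (\<Sum>i<m. (?G i x)\<^sup>2) \<partial>weight10)"
  proof -
    have "(\<integral>x. (\<Sum>i<m. (?G i x)\<^sup>2) \<partial>weight10) = (\<Sum>i<m. inner10 (?G i) (?G i))"
      unfolding L2_inner_def power2_eq_square
      by (intro Bochner_Integration.integral_sum square_integrable_mult G)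
    then show ?thesis by (simp add: sum_distrib_left)
  qed
  also have "\<dots> \<le> B1\<^sup>2 * (B2\<^sup>2 * mass_on S)"
  proof (rule mult_left_mono)
    show "(\<integral>x. (\<Sum>i<m. (?G i x)\<^sup>2) \<partial>weight10) \<le> B2\<^sup>2 * mass_on S"
    proof (rule weight10_integral_bound(2)[OF S])
      fix x assume s: "square_integrable weight10 (section_fun S x)"
      have "(\<Sum>i<m. (?G i x)\<^sup>2) \<le> (\<Sum>i<m. B2\<^sup>2 * ((an (section_fun S x) i)\<^sup>2 * inner10 (p i) (p i)))"
      proof (rule sum_mono)
        fix i
        let ?N = "inner10 (p i) (p i)"
        have N: "0 < ?N" by (simp add: inner_pos)
        have "?N \<le> B2\<^sup>2" using norm_p_le[of i] B2 unfolding L2_norm_on_power2[symmetric] by (intro power_mono) auto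
        then have "(an (section_fun S x) i)\<^sup>2 * ?N * ?N \<le> (an (section_fun S x) i)\<^sup>2 * ?N * B2\<^sup>2"
          using N by (intro mult_left_mono) auto
        moreover have "?G i x = an (section_fun S x) i * ?N"
          unfolding coeff_eq_inner using N by (simp add: apply_kernel_eq_inner)
        ultimately show "(?G i x)\<^sup>2 \<le> B2\<^sup>2 * ((an (section_fun S x) i)\<^sup>2 * ?N)"
          by (simp add: power2_eq_square mult_ac)
      qed
      also have "\<dots> = B2\<^sup>2 * (\<Sum>i<m. (an (section_fun S x) i)\<^sup>2 * inner10 (p i) (p i))"
        by (simp only: sum_distrib_left)
      also have "\<dots> \<le> B2\<^sup>2 * inner10 (section_fun S x) (section_fun S x)"
        using s by (intro mult_left_mono Bessel) auto
      finally show "(\<Sum>i<m. (?G i x)\<^sup>2) \<le> B2\<^sup>2 * inner10 (section_fun S x) (section_fun S x)" .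
    qed (auto intro: sum_nonneg)
  qed simp
  finally show ?thesis .
qed

lemma row_sums:
  assumes S: "S \<in> sets borel" and f: "square_integrable weight10 f"
  shows "(\<lambda>i. A (an (\<lambda>x. indicator S x * p i x)) j * an f i) sums A (an (\<lambda>x. indicator S x * f x)) j"
proof -
  let ?C = "test_bound j * L2_norm_on lborel k / inner10 (p j) (p j)"
  have C: "0 \<le> ?C" using test_bound(1)[of j] inner_pos[of j] by simp
  let ?S = "\<lambda>f x. indicator S x * f x"
  have sS: "square_integrable weight10 (?S g)" if "square_integrable weight10 g" for g
    using that S by (intro square_integrable_indicator_mult) auto
  have part: "A (an (?S (proj {..<n} f))) j = (\<Sum>i<n. A (an (?S (p i))) j * an f i)" for n
  proof (induction n)
    case 0
    have "?S (proj {..<0} f) = (\<lambda>x. 0)" by (simp add: proj_def)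
    then have "an (?S (proj {..<0} f)) = (\<lambda>i. 0)"
      by (intro ext) (simp add: coeff_eq_inner L2_inner_def)
    then show ?case by (simp add: op_zero)
  next
    case (Suc n)
    have s1: "square_integrable weight10 (?S (proj {..<n} f))" by (intro sS square_integrable_proj) simp
    have s2: "square_integrable weight10 (?S (p n))" by (intro sS square_integrable_p) simp
    have "?S (proj {..<Suc n} f) = (\<lambda>x. ?S (proj {..<n} f) x + an f n * ?S (p n) x)"
      unfolding proj_def by (rule ext) (simp add: distrib_left mult.left_commute)
    then have "an (?S (proj {..<Suc n} f)) = (\<lambda>i. an (?S (proj {..<n} f)) i + an f n * an (?S (p n)) i)"
      using an_add[OF s1 square_integrable_cmult[OF s2]] by (simp only: an_cmult)
    then have "A (an (?S (proj {..<Suc n} f))) = (\<lambda>i. A (an (?S (proj {..<n} f))) i + an f n * A (an (?S (p n))) i)"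
      using op_add[OF ell2_coeff[OF s1] ell2_cmult[OF ell2_coeff[OF s2]]] by (simp only: op_cmult[OF ell2_coeff[OF s2]])
    then show ?case by (simp only: Suc sum.lessThan_Suc mult.commute)
  qed
  have "(\<lambda>n. A (an (?S f)) j - (\<Sum>i<n. A (an (?S (p i))) j * an f i)) \<longlonglongrightarrow> 0"
  proof (rule tendsto_rabs_zero_cancel, rule tendsto_sandwich[where f = "\<lambda>_. 0"])
    have "\<bar>A (an (?S f)) j - (\<Sum>i<n. A (an (?S (p i))) j * an f i)\<bar> \<le> ?C * norm10 (\<lambda>x. f x - proj {..<n} f x)" for n
    proof -
      have r: "square_integrable weight10 (\<lambda>x. f x - proj {..<n} f x)"
        using f by (simp add: square_integrable_diff square_integrable_proj)
      have s1: "square_integrable weight10 (?S (proj {..<n} f))" by (intro sS square_integrable_proj) simp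
      have "?S (\<lambda>x. f x - proj {..<n} f x) = (\<lambda>x. ?S f x - ?S (proj {..<n} f) x)"
        by (rule ext) (rule right_diff_distrib)
      then have "an (?S (\<lambda>x. f x - proj {..<n} f x)) = (\<lambda>i. an (?S f) i - an (?S (proj {..<n} f)) i)"
        using an_diff[OF sS[OF f] s1] by (simp only:)
      then have "A (an (?S (\<lambda>x. f x - proj {..<n} f x))) = (\<lambda>i. A (an (?S f)) i - A (an (?S (proj {..<n} f))) i)"
        using op_diff[OF ell2_coeff[OF sS[OF f]] ell2_coeff[OF s1]] by (simp only:)
      then have "A (an (?S f)) j - (\<Sum>i<n. A (an (?S (p i))) j * an f i) = A (an (?S (\<lambda>x. f x - proj {..<n} f x))) j"
        by (simp only: part)
      then have "\<bar>A (an (?S f)) j - (\<Sum>i<n. A (an (?S (p i))) j * an f i)\<bar>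
          \<le> ?C * norm10 (?S (\<lambda>x. f x - proj {..<n} f x))"
        using A_row_bounded[OF sS[OF r], of j] by (simp only:)
      also have "\<dots> \<le> ?C * norm10 (\<lambda>x. f x - proj {..<n} f x)"
        using C r S by (intro mult_left_mono L2_norm_indicator_mult_le) auto
      finally show ?thesis .
    qed
    then show "\<forall>\<^sub>F n in sequentially. \<bar>A (an (?S f)) j - (\<Sum>i<n. A (an (?S (p i))) j * an f i)\<bar>
        \<le> ?C * norm10 (\<lambda>x. f x - proj {..<n} f x)" by simp
    show "(\<lambda>n. ?C * norm10 (\<lambda>x. f x - proj {..<n} f x)) \<longlonglongrightarrow> 0"
      by (intro tendsto_mult_right_zero residual_tendsto_0 f)
  qed auto
  from tendsto_diff[OF tendsto_const[of "A (an (?S f)) j"] this]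
  have "(\<lambda>n. A (an (?S f)) j - (A (an (?S f)) j - (\<Sum>i<n. A (an (?S (p i))) j * an f i))) \<longlonglongrightarrow> A (an (?S f)) j - 0" .
  then show ?thesis by (simp add: sums_def)
qed

lemma cut_tails:
  assumes S: "finite_on S" and e: "0 < e"
  shows "\<forall>\<^sub>F n in sequentially. \<forall>f. square_integrable weight10 f \<longrightarrow>
      ell2_norm (tail n (A (an (\<lambda>x. indicator S x * f x)))) \<le> e * ell2_norm (an f)"
    and "\<forall>\<^sub>F n in sequentially. \<forall>f. square_integrable weight10 f \<longrightarrow> tail n (an f) = an f \<longrightarrow>
      ell2_norm (A (an (\<lambda>x. indicator S x * f x))) \<le> e * ell2_norm (an f)"
proof -
  have Sb: "S \<in> sets borel" using S by (simp add: finite_on_def)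
  define a where "a j i = A (an (\<lambda>x. indicator S x * p i x)) j" for j i
  define T where "T u = (\<lambda>j. \<Sum>i. a j i * u i)" for u
  have T: "T (an f) = A (an (\<lambda>x. indicator S x * f x))" if "square_integrable weight10 f" for f
    using row_sums[OF Sb that] by (auto simp: T_def a_def sums_iff)
  have sums: "(\<lambda>i. a j i * u i) sums T u j" if u: "u \<in> ell2" for u j
  proof -
    obtain f where f: "square_integrable weight10 f" "an f = u" using synthesis[OF u] by blast
    then show ?thesis using row_sums[OF Sb f(1), of j] T[OF f(1)] by (simp add: a_def)
  qed
  have C: "(\<Sum>j<J. \<Sum>i<m. (a j i)\<^sup>2) \<le> B1\<^sup>2 * (B2\<^sup>2 * mass_on S)" for J m
    unfolding a_def by (rule Hilbert_Schmidt_matrix[OF S])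
  show "\<forall>\<^sub>F n in sequentially. \<forall>f. square_integrable weight10 f \<longrightarrow>
      ell2_norm (tail n (A (an (\<lambda>x. indicator S x * f x)))) \<le> e * ell2_norm (an f)"
  proof (rule eventually_mono)
    show "\<forall>\<^sub>F n in sequentially. \<forall>u\<in>ell2. ell2_norm (tail n (T u)) \<le> e * ell2_norm u"
      by (rule Hilbert_Schmidt_tail(1)[where a = a, OF C _ e]) (rule sums)
    fix n assume n: "\<forall>u\<in>ell2. ell2_norm (tail n (T u)) \<le> e * ell2_norm u"
    show "\<forall>f. square_integrable weight10 f \<longrightarrow>
        ell2_norm (tail n (A (an (\<lambda>x. indicator S x * f x)))) \<le> e * ell2_norm (an f)"
    proof (intro allI impI)
      fix f assume f: "square_integrable weight10 f"
      show "ell2_norm (tail n (A (an (\<lambda>x. indicator S x * f x)))) \<le> e * ell2_norm (an f)"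
        using bspec[OF n ell2_coeff[OF f]] unfolding T[OF f] .
    qed
  qed
  show "\<forall>\<^sub>F n in sequentially. \<forall>f. square_integrable weight10 f \<longrightarrow> tail n (an f) = an f \<longrightarrow>
      ell2_norm (A (an (\<lambda>x. indicator S x * f x))) \<le> e * ell2_norm (an f)"
  proof (rule eventually_mono)
    show "\<forall>\<^sub>F n in sequentially. \<forall>u\<in>ell2. ell2_norm (T (tail n u)) \<le> e * ell2_norm u"
      by (rule Hilbert_Schmidt_tail(2)[where a = a, OF C _ e]) (rule sums)
    fix n assume n: "\<forall>u\<in>ell2. ell2_norm (T (tail n u)) \<le> e * ell2_norm u"
    show "\<forall>f. square_integrable weight10 f \<longrightarrow> tail n (an f) = an f \<longrightarrow>
        ell2_norm (A (an (\<lambda>x. indicator S x * f x))) \<le> e * ell2_norm (an f)"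
    proof (intro allI impI)
      fix f assume f: "square_integrable weight10 f" and t: "tail n (an f) = an f"
      show "ell2_norm (A (an (\<lambda>x. indicator S x * f x))) \<le> e * ell2_norm (an f)"
        using bspec[OF n ell2_coeff[OF f]] unfolding t T[OF f] .
    qed
  qed
qed

end

context volterra_kernel
begin

lemma tail_iterate_small_of_finite:
  assumes S: "finite_on UNIV" and e: "0 < e"
  shows "\<forall>\<^sub>F n in sequentially. \<forall>u\<in>ell2. ell2_norm (A (tail n (A u))) \<le> e * ell2_norm u"
proof -
  obtain B where B: "0 \<le> B" "\<And>u. u \<in> ell2 \<Longrightarrow> ell2_norm (A u) \<le> B * ell2_norm u"
    using A_bounded by blast
  have "0 < e / (B + 1)" using e B by simp
  from cut_tails(1)[OF S this] show ?thesis
  proof eventually_elim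
    case (elim n)
    show ?case
    proof
      fix u :: "nat \<Rightarrow> real" assume u: "u \<in> ell2"
      obtain f where f: "square_integrable weight10 f" "an f = u" using synthesis[OF u] by blast
      have t: "tail n (A u) \<in> ell2" using u by (intro ell2_tail ell2_op)
      have "ell2_norm (A (tail n (A u))) \<le> B * ell2_norm (tail n (A u))" using t by (rule B)
      also have "\<dots> \<le> B * (e / (B + 1) * ell2_norm u)"
        using elim[rule_format, OF f(1)] f(2) B(1) by (intro mult_left_mono) simp_all
      also have "\<dots> = B / (B + 1) * (e * ell2_norm u)" by simp
      also have "\<dots> \<le> 1 * (e * ell2_norm u)"
        using B(1) e ell2_norm_nonneg[OF u] by (intro mult_right_mono) auto
      finally show "ell2_norm (A (tail n (A u))) \<le> e * ell2_norm u" by simp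
    qed
  qed
qed

text \<open>
  When \<open>x + y \<le> 1\<close> on the support, the part of the kernel that may fail to be compact maps functions
  supported near 1 to functions supported near 0. Its square would vanish, were it not for the
  projection in between, and that projection hardly moves mass from \<open>[0, 1/2]\<close> towards 1.
\<close>

lemma corner_part_small:
  assumes S: "\<And>d. 0 < d \<Longrightarrow> d < 1 \<Longrightarrow> finite_on {..1 - d}"
    and D: "\<And>x y. (x, y) \<in> D \<Longrightarrow> x + y \<le> 1" and e: "0 < e"
  shows "\<forall>\<^sub>F n in sequentially. \<forall>f. square_integrable weight10 f \<longrightarrow>
    ell2_norm (A (tail n (A (an (\<lambda>x. indicator {1/2<..} x * f x))))) \<le> e * norm10 f"
proof -
  obtain B where B: "0 \<le> B" "\<And>u. u \<in> ell2 \<Longrightarrow> ell2_norm (A u) \<le> B * ell2_norm u"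
    using A_bounded by blast
  define m1 where "m1 = 2 * B * B1 * (B * B1 * B2)"
  define e1 where "e1 = e / (m1 + 1)"
  have m1: "0 \<le> m1" unfolding m1_def using B B1 B2 by (intro mult_nonneg_nonneg) auto
  then have e1: "0 < e1" using e by (simp add: e1_def)
  define m2 where "m2 = 2 * B * B1"
  define e2 where "e2 = e / (m2 + 1)"
  have m2: "0 \<le> m2" unfolding m2_def using B B1 by (intro mult_nonneg_nonneg) auto
  then have e2: "0 < e2" using e by (simp add: e2_def)
  have quot: "e / (m + 1) * (m / 2 * t) \<le> e / 2 * t" if "0 \<le> m" "0 \<le> t" for m t
  proof -
    have "e / (m + 1) * (m / 2 * t) = m / (m + 1) * (e / 2 * t)" by simp
    also have "\<dots> \<le> 1 * (e / 2 * t)" using that e by (intro mult_right_mono) auto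
    finally show ?thesis by simp
  qed
  obtain d where d: "0 < d" "d < 1" and loc: "\<forall>\<^sub>F n in sequentially. \<forall>f. square_integrable weight10 f \<longrightarrow> (\<forall>x>1/2. f x = 0) \<longrightarrow>
    norm10 (\<lambda>x. indicator {1 - d..} x * (f x - jacobi.proj (Suc 0) {..<n} f x)) \<le> e1 * norm10 f"
    using proj_localised[OF e1] by auto
  let ?H = "\<lambda>f x. indicator {1/2<..} x * f x"
  have sH: "square_integrable weight10 (?H f)" and nH: "norm10 (?H f) \<le> norm10 f"
    if "square_integrable weight10 f" for f
    using that by (auto intro: square_integrable_indicator_mult L2_norm_indicator_mult_le)
  have "\<forall>\<^sub>F n in sequentially. \<forall>f. square_integrable weight10 f \<longrightarrow> tail n (an f) = an f \<longrightarrow>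
      ell2_norm (A (an (\<lambda>x. indicator {..1 - d} x * f x))) \<le> e2 * ell2_norm (an f)"
    using cut_tails(2)[OF S[OF d] e2] .
  with loc show ?thesis
  proof eventually_elim
    case (elim n)
    have away: "ell2_norm (A (tail n (A (an (?H (\<lambda>x. indicator {..1 - h} x * f x)))))) \<le> e * norm10 f"
      if f: "square_integrable weight10 f" and h: "0 < h" "h < 1" for f h
    proof -
      let ?g = "?H (\<lambda>x. indicator {..1 - h} x * f x)"
      let ?F = "apply_kernel {..1 - h} ?g"
      have fh: "square_integrable weight10 (\<lambda>x. indicator {..1 - h} x * f x)"
        using f by (rule square_integrable_indicator_mult) simp
      then have g: "square_integrable weight10 ?g" by (rule sH)
      have gf: "norm10 ?g \<le> norm10 f"
        using nH[OF fh] L2_norm_indicator_mult_le[OF f, of "{..1 - h}"] by simp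
      have "(\<lambda>x. indicator {..1 - h} x * ?g x) = ?g" by (auto simp: indicator_def)
      then have F: "square_integrable weight10 ?F" and AF: "A (an ?g) = an ?F"
        using apply_kernel_an[OF S[OF h] g] by simp_all
      have "?F x = 0" if "1 / 2 < x" for x
      proof -
        have "k (x, y) * (indicator {..1 - h} y * ?g y) = 0" for y
        proof (cases "1 / 2 < y")
          case True
          then have "(x, y) \<notin> D" using D[of x y] that by auto
          then show ?thesis by (simp add: k_outside)
        qed simp
        then have "(\<lambda>y. k (x, y) * (indicator {..1 - h} y * ?g y)) = (\<lambda>y. 0)" by (rule ext)
        then show ?thesis unfolding apply_kernel_def by (simp only: integral_zero)
      qed
      then have loc': "norm10 (\<lambda>x. indicator {1 - d..} x * (?F x - proj {..<n} ?F x)) \<le> e1 * norm10 ?F"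
        using elim(1) F by (simp add: proj_eq_jacobi)
      define q where "q = (\<lambda>x. ?F x - proj {..<n} ?F x)"
      have q: "square_integrable weight10 q"
        unfolding q_def using F by (intro square_integrable_diff square_integrable_proj) simp_all
      have anq: "an q = tail n (A (an ?g))" unfolding q_def AF by (rule an_residual[OF F])
      have q1: "square_integrable weight10 (\<lambda>x. indicator {..1 - d} x * q x)"
        and q2: "square_integrable weight10 (\<lambda>x. indicator {1 - d<..} x * q x)"
        using q by (auto intro: square_integrable_indicator_mult)
      have "q = (\<lambda>x. indicator {..1 - d} x * q x + indicator {1 - d<..} x * q x)"
        by (auto simp: indicator_def)
      then have "an q = (\<lambda>i. an (\<lambda>x. indicator {..1 - d} x * q x) i + an (\<lambda>x. indicator {1 - d<..} x * q x) i)"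
        using an_add[OF q1 q2] by simp
      then have "A (an q) = (\<lambda>i. A (an (\<lambda>x. indicator {..1 - d} x * q x)) i + A (an (\<lambda>x. indicator {1 - d<..} x * q x)) i)"
        using op_add[OF ell2_coeff[OF q1] ell2_coeff[OF q2]] by simp
      then have "ell2_norm (A (an q)) \<le> ell2_norm (A (an (\<lambda>x. indicator {..1 - d} x * q x)))
          + ell2_norm (A (an (\<lambda>x. indicator {1 - d<..} x * q x)))"
        using ell2_norm_triangle[OF ell2_op[OF ell2_coeff[OF q1]] ell2_op[OF ell2_coeff[OF q2]]] by simp
      moreover have "ell2_norm (A (an (\<lambda>x. indicator {..1 - d} x * q x))) \<le> e / 2 * norm10 f"
      proof -
        have "tail n (an q) = an q" unfolding anq by (auto simp: tail_def)
        then have "ell2_norm (A (an (\<lambda>x. indicator {..1 - d} x * q x))) \<le> e2 * ell2_norm (an q)"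
          using elim(2) q by blast
        also have "\<dots> \<le> e2 * (B * (B1 * norm10 f))"
        proof (rule mult_left_mono)
          have "ell2_norm (an q) \<le> ell2_norm (A (an ?g))"
            unfolding anq using g by (intro ell2_norm_tail_le ell2_op ell2_coeff)
          also have "\<dots> \<le> B * ell2_norm (an ?g)" using g by (intro B(2) ell2_coeff)
          also have "\<dots> \<le> B * (B1 * norm10 f)"
            using norm_coeff_le[OF g] gf B1 B(1) by (intro mult_left_mono order_trans[OF norm_coeff_le[OF g]]) auto
          finally show "ell2_norm (an q) \<le> B * (B1 * norm10 f)" .
        qed (use e2 in simp)
        also have "B * (B1 * norm10 f) = m2 / 2 * norm10 f" by (simp add: m2_def)
        also have "e2 * \<dots> \<le> e / 2 * norm10 f" unfolding e2_def by (intro quot m2) simp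
        finally show ?thesis .
      qed
      moreover have "ell2_norm (A (an (\<lambda>x. indicator {1 - d<..} x * q x))) \<le> e / 2 * norm10 f"
      proof -
        have "ell2_norm (A (an (\<lambda>x. indicator {1 - d<..} x * q x))) \<le> B * ell2_norm (an (\<lambda>x. indicator {1 - d<..} x * q x))"
          using q2 by (intro B(2) ell2_coeff)
        also have "\<dots> \<le> B * (B1 * norm10 (\<lambda>x. indicator {1 - d<..} x * q x))"
          using B(1) norm_coeff_le[OF q2] by (rule mult_left_mono[rotated])
        also have "\<dots> \<le> B * (B1 * (e1 * (B2 * (B * (B1 * norm10 f)))))"
        proof (intro mult_left_mono)
          have "norm10 (\<lambda>x. indicator {1 - d<..} x * q x) \<le> norm10 (\<lambda>x. indicator {1 - d..} x * q x)"
          proof (rule L2_norm_on_mono)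
            show "square_integrable weight10 (\<lambda>x. indicator {1 - d..} x * q x)"
              using q by (rule square_integrable_indicator_mult) simp
            show "(\<lambda>x. indicator {1 - d<..} x * q x) \<in> borel_measurable weight10"
              using q2 by (rule square_integrable_measurable)
          qed (auto simp: indicator_def)
          also have "\<dots> \<le> e1 * norm10 ?F" using loc' by (simp add: q_def)
          also have "\<dots> \<le> e1 * (B2 * (B * (B1 * norm10 f)))"
          proof (intro mult_left_mono order_trans[OF norm_le_coeff[OF F]])
            have "ell2_norm (an ?F) \<le> B * ell2_norm (an ?g)" unfolding AF[symmetric] using g by (intro B(2) ell2_coeff)
            also have "\<dots> \<le> B * (B1 * norm10 f)"
              using gf B1 B(1) by (intro mult_left_mono order_trans[OF norm_coeff_le[OF g]]) auto
            finally show "ell2_norm (an ?F) \<le> B * (B1 * norm10 f)" .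
          qed (use e1 B2 in auto)
          finally show "norm10 (\<lambda>x. indicator {1 - d<..} x * q x) \<le> e1 * (B2 * (B * (B1 * norm10 f)))" .
        qed (use B B1 in auto)
        also have "\<dots> = e1 * (m1 / 2 * norm10 f)" by (simp add: m1_def mult_ac)
        also have "\<dots> \<le> e / 2 * norm10 f" unfolding e1_def by (intro quot m1) simp
        finally show ?thesis .
      qed
      ultimately show ?thesis unfolding anq by simp
    qed
    show ?case
    proof (intro allI impI)
      fix f assume f: "square_integrable weight10 f"
      let ?L = "\<lambda>f. A (tail n (A (an (?H f))))"
      let ?r = "\<lambda>m x. indicator {1 - 1 / real (Suc m)<..} x * f x"
      have bound: "ell2_norm (?L f) \<le> e * norm10 f + B * (B * (B1 * norm10 (?r m)))"
        if m: "1 \<le> m" for m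
      proof -
        let ?c = "\<lambda>x. indicator {..1 - 1 / real (Suc m)} x * f x"
        have c: "square_integrable weight10 ?c" and r: "square_integrable weight10 (?r m)"
          using f by (auto intro: square_integrable_indicator_mult)
        have "?H f = (\<lambda>x. ?H ?c x + ?H (?r m) x)" by (auto simp: indicator_def)
        then have "an (?H f) = (\<lambda>i. an (?H ?c) i + an (?H (?r m)) i)"
          using an_add[OF sH[OF c] sH[OF r]] by simp
        then have "A (an (?H f)) = (\<lambda>i. A (an (?H ?c)) i + A (an (?H (?r m))) i)"
          using op_add[OF ell2_coeff[OF sH[OF c]] ell2_coeff[OF sH[OF r]]] by simp
        then have "tail n (A (an (?H f))) = (\<lambda>i. tail n (A (an (?H ?c))) i + tail n (A (an (?H (?r m)))) i)"
          by (auto simp: tail_def)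
        then have "?L f = (\<lambda>i. ?L ?c i + ?L (?r m) i)"
          using op_add[OF ell2_tail[OF ell2_op[OF ell2_coeff[OF sH[OF c]]]] ell2_tail[OF ell2_op[OF ell2_coeff[OF sH[OF r]]]]]
          by simp
        then have "ell2_norm (?L f) \<le> ell2_norm (?L ?c) + ell2_norm (?L (?r m))"
          using ell2_norm_triangle[OF ell2_op[OF ell2_tail[OF ell2_op[OF ell2_coeff[OF sH[OF c]]]]]
              ell2_op[OF ell2_tail[OF ell2_op[OF ell2_coeff[OF sH[OF r]]]]]] by simp
        moreover have "ell2_norm (?L ?c) \<le> e * norm10 f"
          using away[OF f, of "1 / real (Suc m)"] m by simp
        moreover have "ell2_norm (?L (?r m)) \<le> B * (B * (B1 * norm10 (?r m)))"
        proof -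
          have "ell2_norm (?L (?r m)) \<le> B * ell2_norm (tail n (A (an (?H (?r m)))))"
            by (intro B(2) ell2_tail ell2_op ell2_coeff sH r)
          also have "\<dots> \<le> B * ell2_norm (A (an (?H (?r m))))"
            using B(1) by (intro mult_left_mono ell2_norm_tail_le ell2_op ell2_coeff sH r)
          also have "\<dots> \<le> B * (B * ell2_norm (an (?H (?r m))))"
            using B(1) by (intro mult_left_mono B(2) ell2_coeff sH r)
          also have "\<dots> \<le> B * (B * (B1 * norm10 (?H (?r m))))"
            using B(1) by (intro mult_left_mono norm_coeff_le sH r)
          also have "\<dots> \<le> B * (B * (B1 * norm10 (?r m)))"
            using B(1) B1 by (intro mult_left_mono nH r) auto
          finally show ?thesis .
        qed
        ultimately show ?thesis by linarith
      qed
      have "(\<lambda>m. e * norm10 f + B * (B * (B1 * norm10 (?r m))))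
          \<longlonglongrightarrow> e * norm10 f + B * (B * (B1 * 0))"
        by (intro tendsto_add tendsto_const tendsto_mult truncation_near_1_tendsto_0 f)
      then have "ell2_norm (?L f) \<le> e * norm10 f + B * (B * (B1 * 0))"
        by (rule LIMSEQ_le_const) (use bound in blast)
      then show "ell2_norm (?L f) \<le> e * norm10 f" by simp
    qed
  qed
qed

lemma tail_iterate_small_of_corner:
  assumes S: "\<And>d. 0 < d \<Longrightarrow> d < 1 \<Longrightarrow> finite_on {..1 - d}"
    and D: "\<And>x y. (x, y) \<in> D \<Longrightarrow> x + y \<le> 1" and e: "0 < e"
  shows "\<forall>\<^sub>F n in sequentially. \<forall>u\<in>ell2. ell2_norm (A (tail n (A u))) \<le> e * ell2_norm u"
proof -
  obtain B where B: "0 \<le> B" "\<And>u. u \<in> ell2 \<Longrightarrow> ell2_norm (A u) \<le> B * ell2_norm u"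
    using A_bounded by blast
  have e1: "0 < e / (2 * B2)" using e B2 by simp
  have e2: "0 < e / (2 * (B + 1))" using e B by simp
  have "finite_on {..1 - 1 / 2}" by (rule S) simp_all
  then have fin: "finite_on {..1 / 2}" by simp
  have "\<forall>\<^sub>F n in sequentially. \<forall>f. square_integrable weight10 f \<longrightarrow>
    ell2_norm (A (tail n (A (an (\<lambda>x. indicator {1/2<..} x * f x))))) \<le> e / (2 * B2) * norm10 f"
    using S D e1 by (rule corner_part_small)
  from this cut_tails(1)[OF fin e2] show ?thesis
  proof eventually_elim
    case (elim n)
    show ?case
    proof
      fix u :: "nat \<Rightarrow> real" assume u: "u \<in> ell2"
      obtain f where f: "square_integrable weight10 f" "an f = u" using synthesis[OF u] by blast
      let ?f1 = "\<lambda>x. indicator {..1 / 2} x * f x" and ?f2 = "\<lambda>x. indicator {1 / 2<..} x * f x"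
      have s1: "square_integrable weight10 ?f1" and s2: "square_integrable weight10 ?f2"
        using f(1) by (auto intro: square_integrable_indicator_mult)
      have "f = (\<lambda>x. ?f1 x + ?f2 x)" by (auto simp: indicator_def)
      then have "u = (\<lambda>i. an ?f1 i + an ?f2 i)" using an_add[OF s1 s2] f(2) by simp
      then have "A u = (\<lambda>i. A (an ?f1) i + A (an ?f2) i)"
        using op_add[OF ell2_coeff[OF s1] ell2_coeff[OF s2]] by simp
      then have "tail n (A u) = (\<lambda>i. tail n (A (an ?f1)) i + tail n (A (an ?f2)) i)"
        by (auto simp: tail_def)
      then have "A (tail n (A u)) = (\<lambda>i. A (tail n (A (an ?f1))) i + A (tail n (A (an ?f2))) i)"
        using op_add[OF ell2_tail[OF ell2_op[OF ell2_coeff[OF s1]]] ell2_tail[OF ell2_op[OF ell2_coeff[OF s2]]]] by simp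
      then have "ell2_norm (A (tail n (A u))) \<le> ell2_norm (A (tail n (A (an ?f1)))) + ell2_norm (A (tail n (A (an ?f2))))"
        using ell2_norm_triangle[OF ell2_op[OF ell2_tail[OF ell2_op[OF ell2_coeff[OF s1]]]]
            ell2_op[OF ell2_tail[OF ell2_op[OF ell2_coeff[OF s2]]]]] by simp
      moreover have "ell2_norm (A (tail n (A (an ?f1)))) \<le> e / 2 * ell2_norm u"
      proof -
        have "ell2_norm (A (tail n (A (an ?f1)))) \<le> B * ell2_norm (tail n (A (an ?f1)))"
          by (intro B(2) ell2_tail ell2_op ell2_coeff s1)
        also have "\<dots> \<le> B * (e / (2 * (B + 1)) * ell2_norm u)"
          using elim(2)[rule_format, OF f(1)] f(2) B(1) by (intro mult_left_mono) simp_all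
        also have "\<dots> = B / (B + 1) * (e / 2 * ell2_norm u)" by simp
        also have "\<dots> \<le> 1 * (e / 2 * ell2_norm u)"
          using B(1) e ell2_norm_nonneg[OF u] by (intro mult_right_mono) auto
        finally show ?thesis by simp
      qed
      moreover have "ell2_norm (A (tail n (A (an ?f2)))) \<le> e / 2 * ell2_norm u"
      proof -
        have "ell2_norm (A (tail n (A (an ?f2)))) \<le> e / (2 * B2) * norm10 f"
          using elim(1) f(1) by blast
        also have "\<dots> \<le> e / (2 * B2) * (B2 * ell2_norm u)"
          using norm_le_coeff[OF f(1)] f(2) e1 by (intro mult_left_mono) simp_all
        also have "\<dots> = e / 2 * ell2_norm u" using B2 by simp
        finally show ?thesis .
      qed
      ultimately show "ell2_norm (A (tail n (A u))) \<le> e * ell2_norm u" by simp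
    qed
  qed
qed

end

section \<open>The triangle\<close>

lemma T2_borel [measurable]: "T2 \<in> sets borel"
proof -
  have "T2 = {z. 0 \<le> fst z} \<inter> {z. 0 \<le> snd z} \<inter> {z. snd z \<le> 1 - fst z}"
    by (auto simp: T2_def)
  moreover have "closed ({z. 0 \<le> fst z} \<inter> {z. 0 \<le> snd z} \<inter> {z :: real \<times> real. snd z \<le> 1 - fst z})"
    by (intro closed_Int closed_Collect_le continuous_intros)
  ultimately show ?thesis by (simp add: borel_closed)
qed

lemma T2_unit: "T2 \<subseteq> {0..1} \<times> {0..1}"
  by (auto simp: T2_def)

lemma integral_triangle: "(\<integral>z. f z \<partial>triangle_measure) = (\<integral>z. indicator T2 z * f z \<partial>lborel)"
  for f :: "real \<times> real \<Rightarrow> real"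
  by (subst integral_restrict_space) simp_all

lemma integrable_triangle: "integrable triangle_measure f \<longleftrightarrow> integrable lborel (\<lambda>z. indicator T2 z * f z)"
  for f :: "real \<times> real \<Rightarrow> real"
  by (subst integrable_restrict_space) simp_all

lemma nn_integral_triangle:
  "(\<integral>\<^sup>+z. f z \<partial>triangle_measure) = (\<integral>\<^sup>+z. f z * indicator T2 z \<partial>lborel)"
  by (subst nn_integral_restrict_space) simp_all

lemma space_triangle [simp]: "space triangle_measure = T2"
  by (simp add: space_restrict_space)

lemma borel_measurable_triangle:
  "f \<in> borel_measurable borel \<Longrightarrow> f \<in> borel_measurable triangle_measure"
  by (intro measurable_restrict_space1) simp

lemma L2_inner_triangle: "L2_inner triangle_measure f g = (\<integral>z. indicator T2 z * (f z * g z) \<partial>lborel)"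
  unfolding L2_inner_def by (rule integral_triangle)

lemma nn_integral_triangle_snd:
  assumes [measurable]: "h \<in> borel_measurable borel"
  shows "(\<integral>\<^sup>+z. h (snd z) \<partial>triangle_measure) = (\<integral>\<^sup>+y. h y \<partial>weight10)"
proof -
  have [measurable]: "T2 \<in> sets (lborel \<Otimes>\<^sub>M lborel)"
    unfolding lborel_prod sets_lborel by (rule T2_borel)
  have "(\<integral>\<^sup>+z. h (snd z) \<partial>triangle_measure) = (\<integral>\<^sup>+z. h (snd z) * indicator T2 z \<partial>(lborel \<Otimes>\<^sub>M lborel))"
    unfolding nn_integral_triangle by (simp add: lborel_prod)
  also have "\<dots> = (\<integral>\<^sup>+y. (\<integral>\<^sup>+x. h y * indicator T2 (x, y) \<partial>lborel) \<partial>lborel)"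
    by (subst lborel_pair.nn_integral_snd[symmetric]) auto
  also have "\<dots> = (\<integral>\<^sup>+y. ennreal (indicator {0..1} y * (1 - y) ^ Suc 0) * h y \<partial>lborel)"
  proof (intro nn_integral_cong)
    fix y :: real
    have "(\<integral>\<^sup>+x. h y * indicator T2 (x, y) \<partial>lborel) = (\<integral>\<^sup>+x. (if 0 \<le> y then h y else 0) * indicator {0..1 - y} x \<partial>lborel)"
      by (intro nn_integral_cong) (auto simp: indicator_def T2_def)
    also have "\<dots> = (if 0 \<le> y then h y else 0) * emeasure lborel {0..1 - y}"
      by (subst nn_integral_cmult_indicator) auto
    also have "\<dots> = ennreal (indicator {0..1} y * (1 - y) ^ Suc 0) * h y"
      by (auto simp: indicator_def mult.commute)
    finally show "(\<integral>\<^sup>+x. h y * indicator T2 (x, y) \<partial>lborel) = ennreal (indicator {0..1} y * (1 - y) ^ Suc 0) * h y" .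
  qed
  also have "\<dots> = (\<integral>\<^sup>+y. h y \<partial>weight10)" by (subst nn_integral_jac_weight) auto
  finally show ?thesis .
qed

lemma nn_integral_triangle_fst:
  assumes [measurable]: "h \<in> borel_measurable borel"
  shows "(\<integral>\<^sup>+z. h (fst z) \<partial>triangle_measure) = (\<integral>\<^sup>+x. h x \<partial>weight10)"
proof -
  have [measurable]: "T2 \<in> sets (lborel \<Otimes>\<^sub>M lborel)"
    unfolding lborel_prod sets_lborel by (rule T2_borel)
  have "(\<integral>\<^sup>+z. h (fst z) \<partial>triangle_measure) = (\<integral>\<^sup>+z. h (fst z) * indicator T2 z \<partial>(lborel \<Otimes>\<^sub>M lborel))"
    unfolding nn_integral_triangle by (simp add: lborel_prod)
  also have "\<dots> = (\<integral>\<^sup>+x. (\<integral>\<^sup>+y. h x * indicator T2 (x, y) \<partial>lborel) \<partial>lborel)"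
    by (subst lborel.nn_integral_fst[symmetric]) auto
  also have "\<dots> = (\<integral>\<^sup>+x. ennreal (indicator {0..1} x * (1 - x) ^ Suc 0) * h x \<partial>lborel)"
  proof (intro nn_integral_cong)
    fix x :: real
    have "(\<integral>\<^sup>+y. h x * indicator T2 (x, y) \<partial>lborel) = (\<integral>\<^sup>+y. (if 0 \<le> x then h x else 0) * indicator {0..1 - x} y \<partial>lborel)"
      by (intro nn_integral_cong) (auto simp: indicator_def T2_def)
    also have "\<dots> = (if 0 \<le> x then h x else 0) * emeasure lborel {0..1 - x}"
      by (subst nn_integral_cmult_indicator) auto
    also have "\<dots> = ennreal (indicator {0..1} x * (1 - x) ^ Suc 0) * h x"
      by (auto simp: indicator_def mult.commute)
    finally show "(\<integral>\<^sup>+y. h x * indicator T2 (x, y) \<partial>lborel) = ennreal (indicator {0..1} x * (1 - x) ^ Suc 0) * h x" .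
  qed
  also have "\<dots> = (\<integral>\<^sup>+x. h x \<partial>weight10)" by (subst nn_integral_jac_weight) auto
  finally show ?thesis .
qed

lemma measure_eqI_nn_integral:
  assumes sets: "sets M = sets N"
    and eq: "\<And>A. A \<in> sets M \<Longrightarrow> (\<integral>\<^sup>+x. indicator A x \<partial>M) = (\<integral>\<^sup>+x. indicator A x \<partial>N)"
  shows "M = N"
proof (rule measure_eqI[OF sets])
  fix A assume "A \<in> sets M"
  with eq[OF this] sets show "emeasure M A = emeasure N A" by simp
qed

lemma distr_triangle_snd: "distr triangle_measure borel snd = weight10"
proof (rule measure_eqI_nn_integral)
  fix A assume "A \<in> sets (distr triangle_measure borel snd)"
  then have [measurable]: "A \<in> sets borel" by simp
  have "snd \<in> borel_measurable triangle_measure" by (intro borel_measurable_triangle) measurable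
  then have "(\<integral>\<^sup>+x. indicator A x \<partial>distr triangle_measure borel snd) = (\<integral>\<^sup>+z. indicator A (snd z) \<partial>triangle_measure)"
    by (rule nn_integral_distr) (auto intro!: borel_measurable_indicator)
  also have "\<dots> = (\<integral>\<^sup>+x. indicator A x \<partial>weight10)" by (rule nn_integral_triangle_snd) measurable
  finally show "(\<integral>\<^sup>+x. indicator A x \<partial>distr triangle_measure borel snd) = (\<integral>\<^sup>+x. indicator A x \<partial>weight10)" .
qed simp

lemma distr_triangle_fst: "distr triangle_measure borel fst = weight10"
proof (rule measure_eqI_nn_integral)
  fix A assume "A \<in> sets (distr triangle_measure borel fst)"
  then have [measurable]: "A \<in> sets borel" by simp
  have "fst \<in> borel_measurable triangle_measure" by (intro borel_measurable_triangle) measurable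
  then have "(\<integral>\<^sup>+x. indicator A x \<partial>distr triangle_measure borel fst) = (\<integral>\<^sup>+z. indicator A (fst z) \<partial>triangle_measure)"
    by (rule nn_integral_distr) (auto intro!: borel_measurable_indicator)
  also have "\<dots> = (\<integral>\<^sup>+x. indicator A x \<partial>weight10)" by (rule nn_integral_triangle_fst) measurable
  finally show "(\<integral>\<^sup>+x. indicator A x \<partial>distr triangle_measure borel fst) = (\<integral>\<^sup>+x. indicator A x \<partial>weight10)" .
qed simp

lemma integral_triangle_snd:
  fixes g :: "real \<Rightarrow> real"
  assumes [measurable]: "g \<in> borel_measurable borel"
  shows "(\<integral>z. g (snd z) \<partial>triangle_measure) = (\<integral>y. g y \<partial>weight10)"
    and "integrable triangle_measure (\<lambda>z. g (snd z)) \<longleftrightarrow> integrable weight10 g"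
proof -
  have m: "snd \<in> borel_measurable triangle_measure" by (intro borel_measurable_triangle) measurable
  show "(\<integral>z. g (snd z) \<partial>triangle_measure) = (\<integral>y. g y \<partial>weight10)"
    unfolding distr_triangle_snd[symmetric] using m by (subst integral_distr) auto
  show "integrable triangle_measure (\<lambda>z. g (snd z)) \<longleftrightarrow> integrable weight10 g"
    unfolding distr_triangle_snd[symmetric] using m by (subst integrable_distr_eq) auto
qed

lemma integral_triangle_fst:
  fixes g :: "real \<Rightarrow> real"
  assumes [measurable]: "g \<in> borel_measurable borel"
  shows "(\<integral>z. g (fst z) \<partial>triangle_measure) = (\<integral>y. g y \<partial>weight10)"
proof -
  have m: "fst \<in> borel_measurable triangle_measure" by (intro borel_measurable_triangle) measurable
  show "(\<integral>z. g (fst z) \<partial>triangle_measure) = (\<integral>y. g y \<partial>weight10)"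
    unfolding distr_triangle_fst[symmetric] using m by (subst integral_distr) auto
qed

lemma square_integrable_triangle_snd:
  assumes f: "square_integrable weight10 f"
  shows "square_integrable triangle_measure (\<lambda>z. f (snd z))"
proof -
  have [measurable]: "f \<in> borel_measurable borel" using square_integrable_measurable[OF f] by simp
  have "integrable triangle_measure (\<lambda>z. (f (snd z))\<^sup>2)"
    using f integral_triangle_snd(2)[of "\<lambda>x. (f x)\<^sup>2"] by (simp add: square_integrable_def)
  moreover have "(\<lambda>z. f (snd z)) \<in> borel_measurable triangle_measure"
    by (intro borel_measurable_triangle) measurable
  ultimately show ?thesis by (simp add: square_integrable_def)
qed

lemma L2_inner_triangle_snd:
  assumes "f \<in> borel_measurable borel" "g \<in> borel_measurable borel"
  shows "L2_inner triangle_measure (\<lambda>z. f (snd z)) (\<lambda>z. g (snd z)) = inner10 f g"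
  using integral_triangle_snd(1)[of "\<lambda>x. f x * g x"] assms by (simp add: L2_inner_def)

lemma nn_integral_reflect_fst:
  fixes h :: "real \<times> real \<Rightarrow> ennreal"
  assumes [measurable]: "h \<in> borel_measurable borel"
  shows "(\<integral>\<^sup>+z. h (1 - fst z, snd z) \<partial>lborel) = (\<integral>\<^sup>+z. h z \<partial>lborel)"
proof -
  have [measurable]: "h \<in> borel_measurable (lborel \<Otimes>\<^sub>M lborel)" using assms by (simp add: lborel_prod)
  have "(\<integral>\<^sup>+z. h (1 - fst z, snd z) \<partial>lborel) = (\<integral>\<^sup>+z. h (1 - fst z, snd z) \<partial>(lborel \<Otimes>\<^sub>M lborel))"
    by (simp add: lborel_prod)
  also have "\<dots> = (\<integral>\<^sup>+y. (\<integral>\<^sup>+x. h (1 - x, y) \<partial>lborel) \<partial>lborel)"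
    by (subst lborel_pair.nn_integral_snd[symmetric]) auto
  also have "\<dots> = (\<integral>\<^sup>+y. (\<integral>\<^sup>+x. h (x, y) \<partial>lborel) \<partial>lborel)"
  proof (rule nn_integral_cong)
    fix y :: real
    have "(\<integral>\<^sup>+x. h (x, y) \<partial>lborel) = ennreal \<bar>-1\<bar> * (\<integral>\<^sup>+x. h (1 + -1 * x, y) \<partial>lborel)"
      by (intro nn_integral_real_affine) simp_all
    then show "(\<integral>\<^sup>+x. h (1 - x, y) \<partial>lborel) = (\<integral>\<^sup>+x. h (x, y) \<partial>lborel)" by simp
  qed
  also have "\<dots> = (\<integral>\<^sup>+z. h z \<partial>(lborel \<Otimes>\<^sub>M lborel))"
    by (subst lborel_pair.nn_integral_snd[symmetric]) auto
  finally show ?thesis by (simp add: lborel_prod)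
qed

lemma reflect_measurable: "(\<lambda>z. (1 - fst z, snd z)) \<in> borel \<rightarrow>\<^sub>M (borel :: (real \<times> real) measure)"
  by (intro borel_measurable_continuous_onI continuous_intros)

lemma distr_reflect_fst: "distr lborel borel (\<lambda>z. (1 - fst z, snd z)) = (lborel :: (real \<times> real) measure)"
proof (rule measure_eqI_nn_integral)
  fix A assume "A \<in> sets (distr lborel borel (\<lambda>z. (1 - fst z, snd z)) :: (real \<times> real) measure)"
  then have [measurable]: "A \<in> sets (borel :: (real \<times> real) measure)" by simp
  show "(\<integral>\<^sup>+z. indicator A z \<partial>distr lborel borel (\<lambda>z. (1 - fst z, snd z))) = (\<integral>\<^sup>+z. indicator A z \<partial>lborel)"
  proof -
    have "(\<integral>\<^sup>+z. indicator A z \<partial>distr lborel borel (\<lambda>z. (1 - fst z, snd z))) = (\<integral>\<^sup>+z. indicator A (1 - fst z, snd z) \<partial>lborel)"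
      using reflect_measurable by (intro nn_integral_distr) auto
    also have "\<dots> = (\<integral>\<^sup>+z. indicator A z \<partial>lborel)" by (rule nn_integral_reflect_fst) measurable
    finally show ?thesis .
  qed
qed simp

lemma integral_reflect_fst:
  fixes g :: "real \<times> real \<Rightarrow> real"
  assumes "g \<in> borel_measurable borel"
  shows "(\<integral>z. g (1 - fst z, snd z) \<partial>lborel) = (\<integral>z. g z \<partial>lborel)"
    and "integrable lborel (\<lambda>z. g (1 - fst z, snd z)) \<longleftrightarrow> integrable lborel g"
proof -
  have m: "(\<lambda>z. (1 - fst z, snd z)) \<in> lborel \<rightarrow>\<^sub>M (borel :: (real \<times> real) measure)"
    using reflect_measurable by simp
  show "(\<integral>z. g (1 - fst z, snd z) \<partial>lborel) = (\<integral>z. g z \<partial>lborel)"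
    using integral_distr[OF m assms] unfolding distr_reflect_fst by simp
  show "integrable lborel (\<lambda>z. g (1 - fst z, snd z)) \<longleftrightarrow> integrable lborel g"
    using integrable_distr_eq[OF m assms] unfolding distr_reflect_fst by simp
qed

section \<open>Triangle Jacobi polynomials\<close>

lemma triangle_jacobi_eq:
  "triangle_jacobi (k, n) (x, y) = (1 - x) ^ k * poly (jacobi_poly (2 * k + 1) (n - k)) x * poly (jacobi_poly 0 k) (y / (1 - x))"
proof -
  have "2 * real k + 1 = real (2 * k + 1)" by simp
  then show ?thesis
    unfolding triangle_jacobi_def prod.case using jacobi01_eq_poly[of 0] by (simp only: jacobi01_eq_poly of_nat_0)
qed

lemma triangle_jacobi_measurable [measurable]: "triangle_jacobi i \<in> borel_measurable borel"
proof (cases i)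
  case (Pair k n)
  have "triangle_jacobi i = (\<lambda>z. (1 - fst z) ^ k * poly (jacobi_poly (2 * k + 1) (n - k)) (fst z) * poly (jacobi_poly 0 k) (snd z / (1 - fst z)))"
    unfolding Pair by (rule ext) (metis prod.collapse triangle_jacobi_eq)
  then show ?thesis by (simp only:) measurable
qed

lemma poly_bounded_unit: "\<exists>C. \<forall>x\<in>{0..1}. \<bar>poly p x\<bar> \<le> (C :: real)"
proof -
  have "compact (poly p ` {0..1})" by (intro compact_continuous_image continuous_intros) simp
  then obtain C where "\<forall>y\<in>poly p ` {0..1}. norm y \<le> C" using compact_imp_bounded bounded_iff by blast
  then show ?thesis by auto
qed

lemma triangle_jacobi_bounded: "\<exists>C. \<forall>z\<in>T2. \<bar>triangle_jacobi i z\<bar> \<le> C"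
proof (cases i)
  case (Pair k n)
  obtain C1 where C1: "\<And>x. x \<in> {0..1} \<Longrightarrow> \<bar>poly (jacobi_poly (2 * k + 1) (n - k)) x\<bar> \<le> C1"
    using poly_bounded_unit by blast
  obtain C2 where C2: "\<And>x. x \<in> {0..1} \<Longrightarrow> \<bar>poly (jacobi_poly 0 k) x\<bar> \<le> C2"
    using poly_bounded_unit by blast
  have "\<bar>triangle_jacobi i (x, y)\<bar> \<le> 1 * C1 * C2" if "(x, y) \<in> T2" for x y
  proof -
    have x: "x \<in> {0..1}" using that by (auto simp: T2_def)
    have t: "y / (1 - x) \<in> {0..1}"
      using that by (cases "x = 1") (auto simp: T2_def divide_simps)
    have "0 \<le> C1" using C1[OF x] by linarith
    then show ?thesis
      unfolding Pair triangle_jacobi_eq abs_mult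
      using C1[OF x] C2[OF t] x by (intro mult_mono) (auto simp: power_abs power_le_one)
  qed
  then show ?thesis by (intro exI[of _ "1 * C1 * C2"]) auto
qed

lemma square_integrable_triangle_bounded:
  assumes f: "square_integrable triangle_measure f" and h: "h \<in> borel_measurable borel"
    and C: "\<exists>C. \<forall>z\<in>T2. \<bar>h z\<bar> \<le> C"
  shows "square_integrable triangle_measure (\<lambda>z. h z * f z)"
proof -
  obtain C where "\<forall>z\<in>T2. \<bar>h z\<bar> \<le> C" using C ..
  then show ?thesis
    using f h by (intro square_integrable_bounded_mult[where B = C] borel_measurable_triangle AE_I2) auto
qed

lemma square_integrable_one_triangle: "square_integrable triangle_measure (\<lambda>_. 1)"
  using square_integrable_triangle_snd[OF square_integrable_poly[of "Suc 0" 1]] by simp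

lemma square_integrable_triangle_jacobi [simp]: "square_integrable triangle_measure (triangle_jacobi i)"
  using square_integrable_triangle_bounded[OF square_integrable_one_triangle triangle_jacobi_measurable triangle_jacobi_bounded]
  by simp

lemma integral_Icc_scale:
  fixes h :: "real \<Rightarrow> real"
  assumes "0 < s"
  shows "(\<integral>y. indicator {0..s} y * h (y / s) \<partial>lborel) = s * (\<integral>t. indicator {0..1} t * h t \<partial>lborel)"
proof -
  have "(\<integral>y. indicator {0..s} y * h (y / s) \<partial>lborel)
      = \<bar>s\<bar> *\<^sub>R (\<integral>t. indicator {0..s} (0 + s * t) * h ((0 + s * t) / s) \<partial>lborel)"
    using assms by (intro lborel_integral_real_affine) simp
  also have "(\<lambda>t. indicator {0..s} (0 + s * t) * h ((0 + s * t) / s)) = (\<lambda>t. indicator {0..1} t * h t)"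
    using assms by (auto simp: indicator_def zero_le_mult_iff fun_eq_iff)
  finally show ?thesis using assms by simp
qed

lemma L2_inner_triangle_jacobi:
  "L2_inner triangle_measure (triangle_jacobi (k, n)) (triangle_jacobi (l, m)) =
    (\<integral>x. indicator {0..1} x * ((1 - x) ^ (k + l + 1) * (poly (jacobi_poly (2 * k + 1) (n - k)) x * poly (jacobi_poly (2 * l + 1) (m - l)) x)) \<partial>lborel)
    * L2_inner (jac_weight 0) (poly (jacobi_poly 0 k)) (poly (jacobi_poly 0 l))"
proof -
  let ?P = "triangle_jacobi (k, n)" and ?Q = "triangle_jacobi (l, m)"
  let ?q = "\<lambda>x. poly (jacobi_poly (2 * k + 1) (n - k)) x * poly (jacobi_poly (2 * l + 1) (m - l)) x"
  let ?h = "\<lambda>t. poly (jacobi_poly 0 k) t * poly (jacobi_poly 0 l) t"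
  let ?c = "L2_inner (jac_weight 0) (poly (jacobi_poly 0 k)) (poly (jacobi_poly 0 l))"
  have c: "?c = (\<integral>t. indicator {0..1} t * ?h t \<partial>lborel)"
    unfolding L2_inner_def by (subst integral_jac_weight) auto
  have "integrable triangle_measure (\<lambda>z. ?P z * ?Q z)" by (intro square_integrable_mult) simp_all
  then have int: "integrable (lborel \<Otimes>\<^sub>M lborel) (\<lambda>z. indicator T2 z * (?P z * ?Q z))"
    by (simp add: integrable_triangle lborel_prod)
  have "L2_inner triangle_measure ?P ?Q = (\<integral>x. (\<integral>y. indicator T2 (x, y) * (?P (x, y) * ?Q (x, y)) \<partial>lborel) \<partial>lborel)"
    unfolding L2_inner_triangle using lborel_pair.integral_fst'[OF int] by (simp add: lborel_prod)
  also have "\<dots> = (\<integral>x. indicator {0..1} x * ((1 - x) ^ (k + l + 1) * ?q x) * ?c \<partial>lborel)"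
  proof (rule integral_cong_AE)
    show "(\<lambda>x. \<integral>y. indicator T2 (x, y) * (?P (x, y) * ?Q (x, y)) \<partial>lborel) \<in> borel_measurable lborel"
      using borel_measurable_integrable[OF lborel_pair.integrable_fst'[OF int]] by simp
    have "AE x in lborel. x \<noteq> (1 :: real)" by (rule AE_lborel_singleton)
    then show "AE x in lborel. (\<integral>y. indicator T2 (x, y) * (?P (x, y) * ?Q (x, y)) \<partial>lborel)
        = indicator {0..1} x * ((1 - x) ^ (k + l + 1) * ?q x) * ?c"
    proof eventually_elim
      case (elim x)
      show ?case
      proof (cases "0 \<le> x \<and> x < 1")
        case True
        have "(\<lambda>y. indicator T2 (x, y) * (?P (x, y) * ?Q (x, y)))
            = (\<lambda>y. ((1 - x) ^ (k + l) * ?q x) * (indicator {0..1 - x} y * ?h (y / (1 - x))))"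
          using True by (auto simp: triangle_jacobi_eq T2_def indicator_def power_add fun_eq_iff)
        then have "(\<integral>y. indicator T2 (x, y) * (?P (x, y) * ?Q (x, y)) \<partial>lborel)
            = ((1 - x) ^ (k + l) * ?q x) * (\<integral>y. indicator {0..1 - x} y * ?h (y / (1 - x)) \<partial>lborel)"
          by (simp only: integral_mult_right_zero)
        also have "(\<integral>y. indicator {0..1 - x} y * ?h (y / (1 - x)) \<partial>lborel) = (1 - x) * ?c"
          unfolding c using True by (intro integral_Icc_scale) simp
        finally show ?thesis using True by (simp add: mult_ac)
      next
        case False
        then have "x \<notin> {0..1}" using elim by auto
        moreover have "(\<lambda>y. indicator T2 (x, y) * (?P (x, y) * ?Q (x, y))) = (\<lambda>y. 0)"
          using \<open>x \<notin> {0..1}\<close> by (auto simp: T2_def indicator_def)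
        ultimately show ?thesis by simp
      qed
    qed
  qed measurable
  finally show ?thesis by (simp only: integral_mult_left_zero)
qed

interpretation triangle: orthogonal_family triangle_measure triangle_jacobi triangle_index
proof
  fix i j assume ij: "i \<in> triangle_index" "j \<in> triangle_index"
  obtain k n l m where eq: "i = (k, n)" "j = (l, m)" by (cases i, cases j)
  have le: "k \<le> n" "l \<le> m" using ij by (auto simp: eq triangle_index_def)
  assume "i \<noteq> j"
  show "L2_inner triangle_measure (triangle_jacobi i) (triangle_jacobi j) = 0"
  proof (cases "k = l")
    case True
    have "(\<integral>x. indicator {0..1} x * ((1 - x) ^ (k + k + 1) * (poly (jacobi_poly (2 * k + 1) (n - k)) x * poly (jacobi_poly (2 * k + 1) (m - k)) x)) \<partial>lborel)
        = L2_inner (jac_weight (2 * k + 1)) (poly (jacobi_poly (2 * k + 1) (n - k))) (poly (jacobi_poly (2 * k + 1) (m - k)))"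
      unfolding L2_inner_def by (subst integral_jac_weight) (auto simp: mult_2 mult.assoc)
    also have "\<dots> = 0" using \<open>i \<noteq> j\<close> le True by (intro jacobi.orthogonal) (auto simp: eq)
    finally show ?thesis unfolding eq L2_inner_triangle_jacobi True[symmetric] by (simp only: mult_zero_left)
  next
    case False
    then have "L2_inner (jac_weight 0) (poly (jacobi_poly 0 k)) (poly (jacobi_poly 0 l)) = 0"
      by (intro jacobi.orthogonal) auto
    then show ?thesis unfolding eq L2_inner_triangle_jacobi by (simp only: mult_zero_right)
  qed
next
  fix i assume "i \<in> triangle_index"
  obtain k n where eq: "i = (k, n)" by (cases i)
  have "(\<integral>x. indicator {0..1} x * ((1 - x) ^ (k + k + 1) * (poly (jacobi_poly (2 * k + 1) (n - k)) x * poly (jacobi_poly (2 * k + 1) (n - k)) x)) \<partial>lborel)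
      = L2_inner (jac_weight (2 * k + 1)) (poly (jacobi_poly (2 * k + 1) (n - k))) (poly (jacobi_poly (2 * k + 1) (n - k)))"
    unfolding L2_inner_def by (subst integral_jac_weight) (auto simp: mult_2 mult.assoc)
  then show "0 < L2_inner triangle_measure (triangle_jacobi i) (triangle_jacobi i)"
    unfolding eq L2_inner_triangle_jacobi using jacobi.inner_pos by (simp only:) (intro mult_pos_pos; simp)
qed simp

lemma triangle_jacobi_0: "triangle_jacobi (0, n) z = jac10 n (fst z)"
proof -
  have "jacobi_poly 0 0 = 1" by (simp add: jacobi_poly_def)
  then show ?thesis by (cases z) (simp add: triangle_jacobi_eq)
qed

lemma norm_triangle_jacobi_0:
  "L2_inner triangle_measure (triangle_jacobi (0, n)) (triangle_jacobi (0, n)) = inner10 (jac10 n) (jac10 n)"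
  unfolding L2_inner_def triangle_jacobi_0 by (rule integral_triangle_fst) measurable

lemma monomial_in_triangle_span:
  "\<exists>a. \<forall>x y. x \<noteq> 1 \<longrightarrow> y ^ m = (\<Sum>(k, n)\<in>(SIGMA k:{..m}. {k..m}). a (k, n) * triangle_jacobi (k, n) (x, y))"
proof -
  obtain s where s: "monom 1 m = (\<Sum>k\<le>m. smult (s k) (jacobi_poly 0 k))"
    using poly_in_jacobi_span[of "monom 1 m" m 0] by (auto simp: degree_monom_eq)
  have "\<forall>k. \<exists>t. [:1, -1:] ^ (m - k) = (\<Sum>l\<le>m - k. smult (t l) (jacobi_poly (2 * k + 1) l))"
  proof
    fix k
    have "degree ([:1, -1 :: real:] ^ (m - k)) \<le> m - k" by (rule order_trans[OF degree_power_le]) simp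
    then show "\<exists>t. [:1, -1:] ^ (m - k) = (\<Sum>l\<le>m - k. smult (t l) (jacobi_poly (2 * k + 1) l))"
      by (rule poly_in_jacobi_span)
  qed
  then obtain t where t: "[:1, -1:] ^ (m - k) = (\<Sum>l\<le>m - k. smult (t k l) (jacobi_poly (2 * k + 1) l))" for k
    by metis
  define a where "a = (\<lambda>(k, n). s k * t k (n - k))"
  have "y ^ m = (\<Sum>(k, n)\<in>(SIGMA k:{..m}. {k..m}). a (k, n) * triangle_jacobi (k, n) (x, y))" if x: "x \<noteq> 1" for x y :: real
  proof -
    let ?u = "y / (1 - x)"
    have su: "?u ^ m = (\<Sum>k\<le>m. s k * poly (jacobi_poly 0 k) ?u)"
      using arg_cong[OF s, of "\<lambda>q. poly q ?u"] by (simp add: poly_sum poly_monom)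
    have tx: "(1 - x) ^ (m - k) = (\<Sum>l\<le>m - k. t k l * poly (jacobi_poly (2 * k + 1) l) x)" for k
      using arg_cong[OF t[of k], of "\<lambda>q. poly q x"] by (simp add: poly_sum)
    have "y ^ m = (1 - x) ^ m * ?u ^ m" using x by (simp add: power_divide)
    also have "\<dots> = (\<Sum>k\<le>m. s k * ((1 - x) ^ m * poly (jacobi_poly 0 k) ?u))"
      unfolding su by (simp only: sum_distrib_left mult.left_commute)
    also have "\<dots> = (\<Sum>k\<le>m. \<Sum>n\<in>{k..m}. a (k, n) * triangle_jacobi (k, n) (x, y))"
    proof (rule sum.cong[OF refl])
      fix k assume "k \<in> {..m}"
      then have k: "k \<le> m" by simp
      have "(1 - x) ^ m = (1 - x) ^ k * (1 - x) ^ (m - k)" using k by (simp add: power_add[symmetric])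
      then have "s k * ((1 - x) ^ m * poly (jacobi_poly 0 k) ?u)
          = (\<Sum>l\<le>m - k. s k * ((1 - x) ^ k * (t k l * poly (jacobi_poly (2 * k + 1) l) x) * poly (jacobi_poly 0 k) ?u))"
        by (simp only: tx sum_distrib_left sum_distrib_right)
      also have "\<dots> = (\<Sum>l\<le>m - k. a (k, k + l) * triangle_jacobi (k, k + l) (x, y))"
        by (intro sum.cong) (simp_all add: a_def triangle_jacobi_eq)
      also have "\<dots> = (\<Sum>n\<in>{k..m}. a (k, n) * triangle_jacobi (k, n) (x, y))"
        using k by (intro sum.reindex_bij_witness[where i = "\<lambda>n. n - k" and j = "\<lambda>l. k + l"]) auto
      finally show "s k * ((1 - x) ^ m * poly (jacobi_poly 0 k) ?u) = (\<Sum>n\<in>{k..m}. a (k, n) * triangle_jacobi (k, n) (x, y))" .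
    qed
    also have "\<dots> = (\<Sum>(k, n)\<in>(SIGMA k:{..m}. {k..m}). a (k, n) * triangle_jacobi (k, n) (x, y))"
      by (subst sum.Sigma) auto
    finally show ?thesis .
  qed
  then show ?thesis by blast
qed

lemma poly_snd_approximable: "triangle.approximable (\<lambda>z. poly q (snd z))"
proof -
  have "\<forall>m. \<exists>a. \<forall>x y. x \<noteq> 1 \<longrightarrow> y ^ m = (\<Sum>(k, n)\<in>(SIGMA k:{..m}. {k..m}). a (k, n) * triangle_jacobi (k, n) (x, y))"
    by (rule allI) (rule monomial_in_triangle_span)
  from choice[OF this] obtain a where
    a: "\<forall>m x y. x \<noteq> 1 \<longrightarrow> y ^ m = (\<Sum>(k, n)\<in>(SIGMA k:{..m}. {k..m}). a m (k, n) * triangle_jacobi (k, n) (x, y))" ..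
  let ?d = "degree q"
  let ?F = "SIGMA k:{..?d}. {k..?d}"
  define b where "b i = (\<Sum>m\<le>?d. poly.coeff q m * (if i \<in> (SIGMA k:{..m}. {k..m}) then a m i else 0))" for i
  show ?thesis
  proof (rule triangle.approximable_comb[of ?F _ b])
    show "finite ?F" by simp
    show "?F \<subseteq> triangle_index" by (auto simp: triangle_index_def)
    show "(\<lambda>z. poly q (snd z)) \<in> borel_measurable triangle_measure"
      by (intro borel_measurable_triangle) measurable
    have eq: "poly q (snd z) = (\<Sum>i\<in>?F. b i * triangle_jacobi i z)" if "fst z \<noteq> 1" for z
    proof -
      have pw: "(snd z) ^ m = (\<Sum>i\<in>?F. (if i \<in> (SIGMA k:{..m}. {k..m}) then a m i else 0) * triangle_jacobi i z)" if "m \<le> ?d" for m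
      proof -
        have "(snd z) ^ m = (\<Sum>i\<in>(SIGMA k:{..m}. {k..m}). a m i * triangle_jacobi i z)"
          using a[rule_format, OF \<open>fst z \<noteq> 1\<close>, of "snd z" m] by (simp add: case_prod_beta')
        also have "\<dots> = (\<Sum>i\<in>?F. (if i \<in> (SIGMA k:{..m}. {k..m}) then a m i else 0) * triangle_jacobi i z)"
        proof (rule sum.mono_neutral_cong_left)
          show "(SIGMA k:{..m}. {k..m}) \<subseteq> ?F" using that by auto
          show "finite ?F" by simp
          show "\<forall>i\<in>?F - (SIGMA k:{..m}. {k..m}). (if i \<in> (SIGMA k:{..m}. {k..m}) then a m i else 0) * triangle_jacobi i z = 0"
            by (rule ballI, erule DiffE, simp only: if_False mult_zero_left)
          show "a m i * triangle_jacobi i z = (if i \<in> (SIGMA k:{..m}. {k..m}) then a m i else 0) * triangle_jacobi i z"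
            if "i \<in> (SIGMA k:{..m}. {k..m})" for i
            using that by (simp only: if_True)
        qed
        finally show ?thesis .
      qed
      have "poly q (snd z) = (\<Sum>m\<le>?d. poly.coeff q m * (\<Sum>i\<in>?F. (if i \<in> (SIGMA k:{..m}. {k..m}) then a m i else 0) * triangle_jacobi i z))"
        unfolding poly_altdef by (intro sum.cong refl) (simp only: pw atMost_iff)
      also have "\<dots> = (\<Sum>i\<in>?F. b i * triangle_jacobi i z)"
        unfolding sum_distrib_left by (subst sum.swap) (simp only: b_def sum_distrib_right mult.assoc)
      finally show ?thesis .
    qed
    have "AE z in triangle_measure. fst z \<noteq> 1"
    proof -
      have m: "fst \<in> borel_measurable triangle_measure" by (intro borel_measurable_triangle) measurable
      have "AE x in lborel. x \<noteq> (1 :: real)" by (rule AE_lborel_singleton)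
      then have "AE x in weight10. x \<noteq> 1" unfolding jac_weight_def by (subst AE_density) auto
      then show ?thesis
        unfolding distr_triangle_fst[symmetric] using m by (subst (asm) AE_distr_iff) auto
    qed
    then show "AE z in triangle_measure. poly q (snd z) = (\<Sum>i\<in>?F. b i * triangle_jacobi i z)"
      by (rule AE_mp) (intro AE_I2 impI eq)
  qed
qed

section \<open>The integral operator behind the coefficient operators\<close>

lemma integral_jacobi_measure:
  fixes f :: "real \<Rightarrow> real"
  assumes [measurable]: "f \<in> borel_measurable borel"
  shows "(\<integral>x. f x \<partial>jacobi_measure (real a) 0) = (\<integral>x. f x \<partial>jac_weight a)"
    and "integrable (jacobi_measure (real a) 0) f \<longleftrightarrow> integrable (jac_weight a) f"
proof -
  let ?w = "\<lambda>x. (1 - x) powr real a * x powr 0"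
  have m: "f \<in> borel_measurable (restrict_space lborel {0..1})" "?w \<in> borel_measurable (restrict_space lborel {0..1})"
    by (intro measurable_restrict_space1; measurable)+
  have ae: "AE x in lborel. indicator {0..1} x *\<^sub>R (?w x *\<^sub>R f x) = indicator {0..1} x * (1 - x) ^ a * f x"
  proof -
    have "AE x in lborel. x \<noteq> (0 :: real)" "AE x in lborel. x \<noteq> (1 :: real)" by (rule AE_lborel_singleton)+
    then show ?thesis by eventually_elim (auto simp: indicator_def powr_realpow)
  qed
  show "(\<integral>x. f x \<partial>jacobi_measure (real a) 0) = (\<integral>x. f x \<partial>jac_weight a)"
  proof -
    have "(\<integral>x. f x \<partial>jacobi_measure (real a) 0) = (\<integral>x. ?w x *\<^sub>R f x \<partial>restrict_space lborel {0..1})"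
      unfolding jacobi_measure_def using m by (intro integral_density) auto
    also have "\<dots> = (\<integral>x. indicator {0..1} x *\<^sub>R (?w x *\<^sub>R f x) \<partial>lborel)"
      by (rule integral_restrict_space) simp
    also have "\<dots> = (\<integral>x. indicator {0..1} x * (1 - x) ^ a * f x \<partial>lborel)"
      using ae by (intro integral_cong_AE) measurable
    finally show ?thesis by (simp add: integral_jac_weight)
  qed
  have "integrable (jacobi_measure (real a) 0) f \<longleftrightarrow> integrable (restrict_space lborel {0..1}) (\<lambda>x. ?w x *\<^sub>R f x)"
    unfolding jacobi_measure_def using m by (intro integrable_density) auto
  also have "\<dots> \<longleftrightarrow> integrable lborel (\<lambda>x. indicator {0..1} x *\<^sub>R (?w x *\<^sub>R f x))"
    by (rule integrable_restrict_space) simp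
  also have "\<dots> \<longleftrightarrow> integrable lborel (\<lambda>x. indicator {0..1} x * (1 - x) ^ a * f x)"
    using ae by (intro integrable_cong_AE) measurable
  finally show "integrable (jacobi_measure (real a) 0) f \<longleftrightarrow> integrable (jac_weight a) f"
    by (simp add: integrable_jac_weight)
qed

lemma coeff_jacobi_measure:
  assumes "f \<in> borel_measurable borel" "q j \<in> borel_measurable borel"
  shows "coeff (jacobi_measure (real a) 0) q f j = coeff (jac_weight a) q f j"
  unfolding coeff_eq_inner L2_inner_def using assms by (simp add: integral_jacobi_measure(1) borel_measurable_times)

lemma coeff_jacobi_measure_10:
  "f \<in> borel_measurable borel \<Longrightarrow> q j \<in> borel_measurable borel \<Longrightarrow>
    coeff (jacobi_measure 1 0) q f j = coeff weight10 q f j"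
  using coeff_jacobi_measure[of f q j "Suc 0"] by simp

lemma coeff_jacobi_measure_00:
  "f \<in> borel_measurable borel \<Longrightarrow> q j \<in> borel_measurable borel \<Longrightarrow>
    coeff (jacobi_measure 0 0) q f j = coeff (jac_weight 0) q f j"
  using coeff_jacobi_measure[of f q j 0] by simp

text \<open>Only finitely many terms are nonzero, so nothing is required of \<open>\<Phi>\<close> besides linearity.\<close>

lemma infsum_jacobi_expansion:
  fixes \<Phi> :: "real poly \<Rightarrow> real"
  assumes add: "\<And>r s. \<Phi> (r + s) = \<Phi> r + \<Phi> s" and smult: "\<And>b r. \<Phi> (smult b r) = b * \<Phi> r"
  shows "(\<Sum>\<^sub>\<infinity>i\<in>UNIV. coeff (jac_weight a) (\<lambda>n. poly (jacobi_poly a n)) (poly h) i * \<Phi> (jacobi_poly a i)) = \<Phi> h"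
proof -
  let ?c = "coeff (jac_weight a) (\<lambda>n. poly (jacobi_poly a n)) (poly h)"
  have "(\<Sum>\<^sub>\<infinity>i\<in>UNIV. ?c i * \<Phi> (jacobi_poly a i)) = (\<Sum>\<^sub>\<infinity>i\<in>{..degree h}. ?c i * \<Phi> (jacobi_poly a i))"
  proof (rule infsum_cong_neutral)
    fix i assume "i \<in> UNIV - {..degree h}"
    then have "?c i = 0"
      by (simp add: coeff_eq_inner L2_inner_commute[of _ "poly h"] jacobi_poly_inner_lower)
    then show "?c i * \<Phi> (jacobi_poly a i) = 0" by simp
  qed auto
  also have "\<dots> = (\<Sum>i\<le>degree h. ?c i * \<Phi> (jacobi_poly a i))" by (rule infsum_finite) simp
  also have "\<dots> = \<Phi> (\<Sum>i\<le>degree h. smult (?c i) (jacobi_poly a i))"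
  proof -
    have 0: "\<Phi> 0 = 0" using smult[of 0 0] by simp
    have "\<Phi> (\<Sum>i\<in>F. smult (?c i) (jacobi_poly a i)) = (\<Sum>i\<in>F. ?c i * \<Phi> (jacobi_poly a i))" if fin: "finite F" for F
      using fin by (induction F rule: finite_induct) (simp_all add: add smult 0)
    then show ?thesis by simp
  qed
  also have "(\<Sum>i\<le>degree h. smult (?c i) (jacobi_poly a i)) = h"
  proof -
    have "poly (\<Sum>i\<le>degree h. smult (?c i) (jacobi_poly a i)) = poly h"
      using poly_eq_jacobi_expansion[of h "degree h"] by (simp add: fun_eq_iff poly_sum)
    then show ?thesis by (simp add: poly_eq_poly_eq_iff)
  qed
  finally show ?thesis .
qed

lemma basis10_eq: "basis10 c n x = c n * jac10 n x"
  using jacobi01_eq_poly[of "Suc 0" n x] by (simp add: basis10_def)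

lemma jacobi01_0_eq: "jacobi01 0 0 n = poly (jacobi_poly 0 n)"
  using jacobi01_eq_poly[of 0 n] by (simp add: fun_eq_iff)

locale coefficient_operators = jacobi_frame +
  fixes K :: "real \<Rightarrow> real \<Rightarrow> real"
  assumes K: "square_integrable triangle_measure (\<lambda>(x, y). K x y)"
begin

lemma p_eq_basis10: "p = basis10 c"
  by (simp add: fun_eq_iff basis10_eq p_def)

lemma p_borel [measurable]: "p i \<in> borel_measurable borel"
  using square_integrable_measurable[OF square_integrable_p[of i]] by simp

sublocale snd_family: orthogonal_family triangle_measure "\<lambda>i z. p i (snd z)" UNIV
proof
  show "square_integrable triangle_measure (\<lambda>z. p i (snd z))" for i
    by (intro square_integrable_triangle_snd square_integrable_p) simp
  show "L2_inner triangle_measure (\<lambda>z. p i (snd z)) (\<lambda>z. p j (snd z)) = 0" if "i \<noteq> j" for i j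
    using that orthogonal[of i j] by (simp add: L2_inner_triangle_snd)
  show "0 < L2_inner triangle_measure (\<lambda>z. p i (snd z)) (\<lambda>z. p i (snd z))" for i
    using inner_pos[of i] by (simp add: L2_inner_triangle_snd)
qed

lemma residual_triangle_small:
  assumes f: "square_integrable weight10 f" and e: "0 < e"
  shows "\<exists>n. L2_norm_on triangle_measure (\<lambda>z. f (snd z) - proj {..<n} f (snd z)) < e"
proof -
  obtain n where n: "norm10 (\<lambda>x. f x - proj {..<n} f x) < e"
    using order_tendstoD(2)[OF residual_tendsto_0[OF f] e] by (auto simp: eventually_sequentially)
  have s: "square_integrable weight10 (\<lambda>x. f x - proj {..<n} f x)"
    using f by (simp add: square_integrable_diff square_integrable_proj)
  have "(\<lambda>x. f x - proj {..<n} f x) \<in> borel_measurable borel"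
    using square_integrable_measurable[OF s] by simp
  from L2_inner_triangle_snd[OF this this] n show ?thesis
    by (intro exI[of _ n]) (simp add: L2_norm_on_alt)
qed

lemma snd_family_approximable:
  assumes f: "square_integrable weight10 f"
  shows "snd_family.approximable (\<lambda>z. f (snd z))"
  unfolding snd_family.approximable_def
proof (intro allI impI)
  fix e :: real assume "0 < e"
  from residual_triangle_small[OF f this] obtain n where
    n: "L2_norm_on triangle_measure (\<lambda>z. f (snd z) - proj {..<n} f (snd z)) < e" ..
  then show "\<exists>F a. finite F \<and> F \<subseteq> UNIV \<and> L2_norm_on triangle_measure (\<lambda>z. f (snd z) - (\<Sum>i\<in>F. a i * p i (snd z))) < e"
    unfolding proj_def by (intro exI[of _ "{..<n}"] exI[of _ "coeff weight10 p f"]) simp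
qed

lemma triangle_approximable:
  assumes f: "square_integrable weight10 f"
  shows "triangle.approximable (\<lambda>z. f (snd z))"
proof (rule triangle.approximable_limit)
  show "square_integrable triangle_measure (\<lambda>z. f (snd z))" using f by (rule square_integrable_triangle_snd)
  fix e :: real assume "0 < e"
  from residual_triangle_small[OF f this] obtain n where
    n: "L2_norm_on triangle_measure (\<lambda>z. f (snd z) - proj {..<n} f (snd z)) < e" ..
  obtain q where "proj {..<n} f = poly q" using proj_eq_poly[of "Suc 0" n f] by (auto simp: proj_eq_jacobi)
  with n show "\<exists>g. square_integrable triangle_measure g \<and> triangle.approximable g \<and> L2_norm_on triangle_measure (\<lambda>z. f (snd z) - g z) < e"
    using poly_snd_approximable[of q] square_integrable_triangle_snd[OF square_integrable_poly[of _ q]]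
    by (intro exI[of _ "\<lambda>z. poly q (snd z)"]) simp
qed

lemma coeff_snd_family:
  assumes "square_integrable weight10 f"
  shows "coeff triangle_measure (\<lambda>i z. p i (snd z)) (\<lambda>z. f (snd z)) i = an f i"
  using square_integrable_measurable[OF assms] by (simp add: coeff_eq_inner L2_inner_triangle_snd)

lemma op_E_eq:
  assumes f: "square_integrable weight10 f"
  shows "op_E c (an f) i = coeff triangle_measure triangle_jacobi (\<lambda>z. f (snd z)) i"
proof -
  let ?P = "triangle_jacobi i"
  have "((\<lambda>j. L2_inner triangle_measure ?P (\<lambda>z. p j (snd z)) * coeff triangle_measure (\<lambda>i z. p i (snd z)) (\<lambda>z. f (snd z)) j)
      has_sum L2_inner triangle_measure ?P (\<lambda>z. f (snd z))) UNIV"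
    using f by (intro snd_family.Parseval snd_family_approximable square_integrable_triangle_snd) simp_all
  then have hs: "((\<lambda>j. L2_inner triangle_measure ?P (\<lambda>z. p j (snd z)) * an f j * (1 / L2_inner triangle_measure ?P ?P))
      has_sum L2_inner triangle_measure ?P (\<lambda>z. f (snd z)) * (1 / L2_inner triangle_measure ?P ?P)) UNIV"
    unfolding coeff_snd_family[OF f] by (rule has_sum_cmult_left)
  have "((\<lambda>j. coeff triangle_measure triangle_jacobi (\<lambda>z. p j (snd z)) i * an f j)
      has_sum coeff triangle_measure triangle_jacobi (\<lambda>z. f (snd z)) i) UNIV"
  proof -
    have e: "coeff triangle_measure triangle_jacobi h i = L2_inner triangle_measure ?P h * (1 / L2_inner triangle_measure ?P ?P)" for h
      unfolding coeff_eq_inner L2_inner_commute[of triangle_measure h ?P] by simp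
    show ?thesis using hs unfolding e by (simp only: mult_ac)
  qed
  then have "(\<Sum>\<^sub>\<infinity>j\<in>UNIV. coeff triangle_measure triangle_jacobi (\<lambda>z. p j (snd z)) i * an f j)
      = coeff triangle_measure triangle_jacobi (\<lambda>z. f (snd z)) i"
    by (rule infsumI)
  then show ?thesis
    by (simp add: op_E_def coeff_op_def p_eq_basis10 case_prod_beta')
qed

lemma square_integrable_K_mult:
  assumes "h \<in> borel_measurable borel" "\<exists>C. \<forall>z\<in>T2. \<bar>h z\<bar> \<le> C"
  shows "square_integrable triangle_measure (\<lambda>z. h z * K (fst z) (snd z))"
  using square_integrable_triangle_bounded[OF K assms] by (simp add: case_prod_beta')

lemma op_mult_eq:
  assumes f: "square_integrable weight10 f"
  shows "op_mult K (op_E c (an f)) i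
    = L2_inner triangle_measure (\<lambda>z. triangle_jacobi i z * K (fst z) (snd z)) (\<lambda>z. f (snd z))
      / L2_inner triangle_measure (triangle_jacobi i) (triangle_jacobi i)"
proof -
  let ?g = "\<lambda>z. triangle_jacobi i z * K (fst z) (snd z)"
  let ?N = "L2_inner triangle_measure (triangle_jacobi i) (triangle_jacobi i)"
  have "((\<lambda>j. L2_inner triangle_measure ?g (triangle_jacobi j) * coeff triangle_measure triangle_jacobi (\<lambda>z. f (snd z)) j)
      has_sum L2_inner triangle_measure ?g (\<lambda>z. f (snd z))) triangle_index"
    using f by (intro triangle.Parseval triangle_approximable square_integrable_triangle_snd
        square_integrable_K_mult triangle_jacobi_measurable triangle_jacobi_bounded)
  then have "((\<lambda>j. L2_inner triangle_measure ?g (triangle_jacobi j) * coeff triangle_measure triangle_jacobi (\<lambda>z. f (snd z)) j * (1 / ?N))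
      has_sum L2_inner triangle_measure ?g (\<lambda>z. f (snd z)) * (1 / ?N)) triangle_index"
    by (rule has_sum_cmult_left)
  moreover have "L2_inner triangle_measure ?g (triangle_jacobi j) * coeff triangle_measure triangle_jacobi (\<lambda>z. f (snd z)) j * (1 / ?N)
      = coeff triangle_measure triangle_jacobi (\<lambda>(x, y). K x y * triangle_jacobi j (x, y)) i * op_E c (an f) j" for j
    unfolding op_E_eq[OF f] coeff_eq_inner[of _ _ "\<lambda>(x, y). K x y * triangle_jacobi j (x, y)"]
    by (simp add: L2_inner_def case_prod_beta' mult_ac)
  ultimately have "((\<lambda>j. coeff triangle_measure triangle_jacobi (\<lambda>(x, y). K x y * triangle_jacobi j (x, y)) i * op_E c (an f) j)
      has_sum L2_inner triangle_measure ?g (\<lambda>z. f (snd z)) / ?N) triangle_index" by simp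
  then show ?thesis unfolding op_mult_def coeff_op_def by (rule infsumI)
qed

lemma inner_average_triangle_jacobi:
  assumes "x < 1"
  shows "1 / (1 - x) * (LBINT y:{0..1 - x}. triangle_jacobi (k, n) (x, y)) = (if k = 0 then jac10 n x else 0)"
proof -
  let ?q = "poly (jacobi_poly (2 * k + 1) (n - k)) x"
  have "(LBINT y:{0..1 - x}. triangle_jacobi (k, n) (x, y))
      = (\<integral>y. ((1 - x) ^ k * ?q) * (indicator {0..1 - x} y * poly (jacobi_poly 0 k) (y / (1 - x))) \<partial>lborel)"
    unfolding set_lebesgue_integral_def triangle_jacobi_eq by (simp add: mult_ac)
  also have "\<dots> = ((1 - x) ^ k * ?q) * ((1 - x) * (\<integral>t. indicator {0..1} t * poly (jacobi_poly 0 k) t \<partial>lborel))"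
    using assms by (simp only: integral_mult_right_zero integral_Icc_scale diff_gt_0_iff_gt)
  also have "(\<integral>t. indicator {0..1} t * poly (jacobi_poly 0 k) t \<partial>lborel) = L2_inner (jac_weight 0) (poly (jacobi_poly 0 k)) (poly (jacobi_poly 0 0))"
    unfolding L2_inner_def by (subst integral_jac_weight) (auto simp: jacobi_poly_def)
  also have "\<dots> = (if k = 0 then 1 else 0)"
    using jacobi.orthogonal[of k 0 0] jacobi_poly_inner[of "jacobi_poly 0 0" 0 0] coeff_jacobi_poly[of 0 0] by simp
  finally show ?thesis using assms by simp
qed

lemma op_Q_eq: "op_Q c w j = w (0, j) / c j"
proof -
  let ?A = "\<lambda>i x. 1 / (1 - x) * (LBINT y:{0..1 - x}. triangle_jacobi i (x, y))"
  have A: "?A (k, n) = (\<lambda>x. indicator {..<1} x * (if k = 0 then jac10 n x else 0))" for k n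
  proof
    fix x :: real
    consider "x < 1" | "x = 1" | "1 < x" by linarith
    then show "?A (k, n) x = indicator {..<1} x * (if k = 0 then jac10 n x else 0)"
    proof cases
      case 1
      then show ?thesis unfolding inner_average_triangle_jacobi[OF 1] by simp
    next
      case 3
      then have "{0..1 - x} = {}" by auto
      then show ?thesis using 3 by (simp add: set_lebesgue_integral_def)
    qed simp
  qed
  have coeff: "coeff (jacobi_measure 1 0) (basis10 c) (?A (k, n)) j = (if k = 0 \<and> n = j then 1 / c j else 0)" for k n
  proof -
    let ?h = "\<lambda>x. indicator {..<1} x * (if k = 0 then jac10 n x else 0)"
    have [measurable]: "?h \<in> borel_measurable borel" by measurable
    have "coeff (jacobi_measure 1 0) (basis10 c) (?A (k, n)) j = coeff weight10 p ?h j"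
      unfolding A p_eq_basis10[symmetric] by (rule coeff_jacobi_measure_10) measurable
    also have "inner10 ?h (p j) = inner10 (\<lambda>x. (if k = 0 then 1 / c n else 0) * p n x) (p j)"
      unfolding L2_inner_def
    proof (rule integral_cong_AE)
      have "AE x in lborel. x \<noteq> (1 :: real)" by (rule AE_lborel_singleton)
      then have "AE x in weight10. x \<noteq> 1" unfolding jac_weight_def by (subst AE_density) auto
      with AE_jac_weight show "AE x in weight10. ?h x * p j x = (if k = 0 then 1 / c n else 0) * p n x * p j x"
        by eventually_elim (use c_nonzero[of n] in \<open>auto simp: p_def[of n] indicator_def\<close>)
    qed (simp_all, measurable)
    then have "coeff weight10 p ?h j = (if k = 0 then 1 / c n else 0) * (inner10 (p n) (p j) / inner10 (p j) (p j))"
      unfolding coeff_eq_inner by (simp only: L2_inner_cmult_left times_divide_eq_right)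
    also have "inner10 (p n) (p j) / inner10 (p j) (p j) = (if n = j then 1 else 0)"
      using orthogonal[of n j] inner_pos[of j] by auto
    finally show ?thesis by auto
  qed
  have "op_Q c w j = (\<Sum>\<^sub>\<infinity>i\<in>triangle_index. (if i = (0, j) then 1 / c j else 0) * w i)"
    unfolding op_Q_def coeff_op_def
  proof (rule infsum_cong)
    fix i :: "nat \<times> nat"
    obtain k n where i: "i = (k, n)" by (cases i)
    show "coeff (jacobi_measure 1 0) (basis10 c) (?A i) j * w i = (if i = (0, j) then 1 / c j else 0) * w i"
      unfolding i coeff by simp
  qed
  also have "\<dots> = (\<Sum>\<^sub>\<infinity>i\<in>{(0, j)}. (if i = (0, j) then 1 / c j else 0) * w i)"
    by (rule infsum_cong_neutral) (auto simp: triangle_index_def)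
  also have "\<dots> = w (0, j) / c j" by simp
  finally show ?thesis .
qed

definition moment :: "(real \<Rightarrow> real) \<Rightarrow> real poly \<Rightarrow> real" where
  "moment f h = L2_inner triangle_measure (\<lambda>z. poly h (fst z) * K (fst z) (snd z)) (\<lambda>z. f (snd z))"

lemma moment_linear:
  assumes f: "square_integrable weight10 f"
  shows "moment f (r + s) = moment f r + moment f s" "moment f (smult b r) = b * moment f r"
proof -
  have h: "square_integrable triangle_measure (\<lambda>z. poly r (fst z) * K (fst z) (snd z))" for r
  proof (rule square_integrable_K_mult)
    obtain C where "\<forall>x\<in>{0..1}. \<bar>poly r x\<bar> \<le> C" using poly_bounded_unit by blast
    then show "\<exists>C. \<forall>z\<in>T2. \<bar>poly r (fst z)\<bar> \<le> C" using T2_unit by (intro exI[of _ C]) fastforce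
  qed measurable
  have "(\<lambda>z. poly (r + s) (fst z) * K (fst z) (snd z)) = (\<lambda>z. poly r (fst z) * K (fst z) (snd z) + poly s (fst z) * K (fst z) (snd z))"
    by (simp add: distrib_right)
  then show "moment f (r + s) = moment f r + moment f s"
    unfolding moment_def using L2_inner_add_left[OF h[of r] h[of s] square_integrable_triangle_snd[OF f]] by simp
  have "(\<lambda>z. poly (smult b r) (fst z) * K (fst z) (snd z)) = (\<lambda>z. b * (poly r (fst z) * K (fst z) (snd z)))"
    by (simp add: mult.assoc)
  then show "moment f (smult b r) = b * moment f r"
    unfolding moment_def by (simp only: L2_inner_cmult_left)
qed

abbreviation ppoly :: "nat \<Rightarrow> real poly" where "ppoly j \<equiv> smult (c j) (jacobi_poly (Suc 0) j)"

lemma poly_ppoly: "poly (ppoly j) = p j"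
  by (simp add: p_def fun_eq_iff)

lemma norm_p: "inner10 (p j) (p j) = (c j)\<^sup>2 * inner10 (jac10 j) (jac10 j)"
  unfolding p_def power2_eq_square
  by (simp only: L2_inner_cmult_left L2_inner_commute[of _ "jac10 j" "\<lambda>x. c j * jac10 j x"] mult.assoc)

lemma average_eq:
  assumes f: "square_integrable weight10 f"
  shows "op_Q c (op_mult K (op_E c (an f))) j = moment f (ppoly j) / inner10 (p j) (p j)"
proof -
  have "op_Q c (op_mult K (op_E c (an f))) j = moment f (jacobi_poly (Suc 0) j) / inner10 (jac10 j) (jac10 j) / c j"
    unfolding op_Q_eq op_mult_eq[OF f] norm_triangle_jacobi_0 triangle_jacobi_0 moment_def ..
  also have "\<dots> = moment f (ppoly j) / inner10 (p j) (p j)"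
    unfolding norm_p moment_linear(2)[OF f] using c_nonzero[of j] by (simp add: power2_eq_square)
  finally show ?thesis .
qed

lemma coeff_mult_p:
  "coeff M q (poly (r * ppoly i)) j * (moment f (ppoly i) / inner10 (p i) (p i))
   = coeff M q (poly (r * jacobi_poly (Suc 0) i)) j * (moment f (jacobi_poly (Suc 0) i) / inner10 (jac10 i) (jac10 i))"
  if f: "square_integrable weight10 f" for M :: "real measure"
proof -
  have "poly (r * ppoly i) = (\<lambda>x. c i * poly (r * jacobi_poly (Suc 0) i) x)" by (simp add: fun_eq_iff)
  then have e: "L2_inner M (poly (r * ppoly i)) (q j) = c i * L2_inner M (poly (r * jacobi_poly (Suc 0) i)) (q j)"
    by (simp only: L2_inner_cmult_left)
  have "(b * x / t) * (b * m / (b\<^sup>2 * n)) = x / t * (m / n)" if "b \<noteq> 0" for b x t m n :: real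
    using that by (simp add: power2_eq_square)
  from this[OF c_nonzero] show ?thesis
    unfolding norm_p moment_linear(2)[OF f] coeff_eq_inner e .
qed

lemma op_J_eq:
  assumes f: "square_integrable weight10 f"
    and w: "\<And>j. w j = moment f (ppoly j) / inner10 (p j) (p j)"
  shows "op_J c w j = moment f ([:0, 1:] * ppoly j) / inner10 (p j) (p j)"
proof -
  let ?N = "inner10 (p j) (p j)"
  have eq: "coeff (jacobi_measure 1 0) (basis10 c) (\<lambda>x. x * basis10 c i x) j * w i
      = coeff weight10 jac10 (poly ([:0, 1:] * ppoly j)) i * moment f (jacobi_poly (Suc 0) i) * (1 / ?N)" for i
  proof -
    have e: "poly ([:0, 1:] * ppoly i) = (\<lambda>x. x * basis10 c i x)" for i by (simp add: fun_eq_iff basis10_eq)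
    have H: "coeff (jacobi_measure 1 0) (basis10 c) (\<lambda>x. x * basis10 c i x) j = coeff weight10 p (poly ([:0, 1:] * ppoly i)) j"
      unfolding e[symmetric] unfolding p_eq_basis10[symmetric]
      by (intro coeff_jacobi_measure_10 borel_measurable_poly p_borel)
    have "coeff (jacobi_measure 1 0) (basis10 c) (\<lambda>x. x * basis10 c i x) j * w i
        = coeff weight10 p (poly ([:0, 1:] * jacobi_poly (Suc 0) i)) j * (moment f (jacobi_poly (Suc 0) i) / inner10 (jac10 i) (jac10 i))"
      unfolding H w by (rule coeff_mult_p[OF f])
    moreover have "inner10 (poly ([:0, 1:] * jacobi_poly (Suc 0) i)) (p j) = inner10 (poly ([:0, 1:] * ppoly j)) (jac10 i)"
      by (simp add: L2_inner_def p_def mult_ac)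
    ultimately show ?thesis by (simp add: coeff_eq_inner)
  qed
  have "op_J c w j = (\<Sum>\<^sub>\<infinity>i\<in>UNIV. coeff weight10 jac10 (poly ([:0, 1:] * ppoly j)) i * moment f (jacobi_poly (Suc 0) i) * (1 / ?N))"
    unfolding op_J_def coeff_op_def eq ..
  also have "\<dots> = (\<Sum>\<^sub>\<infinity>i\<in>UNIV. coeff weight10 jac10 (poly ([:0, 1:] * ppoly j)) i * moment f (jacobi_poly (Suc 0) i)) * (1 / ?N)"
    by (rule infsum_cmult_left')
  also have "\<dots> = moment f ([:0, 1:] * ppoly j) * (1 / ?N)"
    using infsum_jacobi_expansion[of "moment f", OF moment_linear[OF f]] by simp
  finally show ?thesis by simp
qed

lemma op_L_eq:
  assumes f: "square_integrable weight10 f"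
    and w: "\<And>j. w j = moment f (ppoly j) / inner10 (p j) (p j)"
  shows "op_L c w j = moment f (jacobi_poly 0 j) / L2_inner (jac_weight 0) (poly (jacobi_poly 0 j)) (poly (jacobi_poly 0 j))"
proof -
  let ?l = "poly (jacobi_poly 0 j)"
  let ?N = "L2_inner (jac_weight 0) ?l ?l"
  have eq: "coeff (jacobi_measure 0 0) (jacobi01 0 0) (\<lambda>x. (1 - x) * basis10 c i x) j * w i
      = coeff weight10 jac10 (poly (jacobi_poly 0 j)) i * moment f (jacobi_poly (Suc 0) i) * (1 / ?N)" for i
  proof -
    have e: "poly ([:1, -1:] * ppoly i) = (\<lambda>x. (1 - x) * basis10 c i x)" for i by (simp add: fun_eq_iff basis10_eq algebra_simps)
    have H: "coeff (jacobi_measure 0 0) (jacobi01 0 0) (\<lambda>x. (1 - x) * basis10 c i x) j = coeff (jac_weight 0) (\<lambda>n. poly (jacobi_poly 0 n)) (poly ([:1, -1:] * ppoly i)) j"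
      unfolding e[symmetric] jacobi01_0_eq[abs_def] by (intro coeff_jacobi_measure_00 borel_measurable_poly)
    have "coeff (jacobi_measure 0 0) (jacobi01 0 0) (\<lambda>x. (1 - x) * basis10 c i x) j * w i
        = coeff (jac_weight 0) (\<lambda>n. poly (jacobi_poly 0 n)) (poly ([:1, -1:] * jacobi_poly (Suc 0) i)) j * (moment f (jacobi_poly (Suc 0) i) / inner10 (jac10 i) (jac10 i))"
      unfolding H w by (rule coeff_mult_p[OF f])
    moreover have "L2_inner (jac_weight 0) (poly ([:1, -1:] * jacobi_poly (Suc 0) i)) ?l = inner10 ?l (jac10 i)"
      unfolding L2_inner_def by (subst (1 2) integral_jac_weight) (auto intro!: Bochner_Integration.integral_cong simp: algebra_simps)
    ultimately show ?thesis by (simp add: coeff_eq_inner)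
  qed
  have "op_L c w j = (\<Sum>\<^sub>\<infinity>i\<in>UNIV. coeff weight10 jac10 ?l i * moment f (jacobi_poly (Suc 0) i) * (1 / ?N))"
    unfolding op_L_def coeff_op_def eq ..
  also have "\<dots> = (\<Sum>\<^sub>\<infinity>i\<in>UNIV. coeff weight10 jac10 ?l i * moment f (jacobi_poly (Suc 0) i)) * (1 / ?N)"
    by (rule infsum_cmult_left')
  also have "\<dots> = moment f (jacobi_poly 0 j) * (1 / ?N)"
    using infsum_jacobi_expansion[of "moment f", OF moment_linear[OF f]] by simp
  finally show ?thesis by simp
qed

lemma op_S_eq:
  fixes \<Phi> :: "real poly \<Rightarrow> real"
  assumes add: "\<And>r s. \<Phi> (r + s) = \<Phi> r + \<Phi> s" and smult: "\<And>b r. \<Phi> (smult b r) = b * \<Phi> r"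
    and v: "\<And>j. v j = \<Phi> (jacobi_poly 0 j) / L2_inner (jac_weight 0) (poly (jacobi_poly 0 j)) (poly (jacobi_poly 0 j))"
  shows "op_S c v j = \<Phi> ([:1, -1:] * ppoly j) / inner10 (p j) (p j)"
proof -
  let ?N = "inner10 (p j) (p j)"
  have eq: "coeff (jacobi_measure 1 0) (basis10 c) (jacobi01 0 0 i) j * v i
      = coeff (jac_weight 0) (\<lambda>n. poly (jacobi_poly 0 n)) (poly ([:1, -1:] * ppoly j)) i * \<Phi> (jacobi_poly 0 i) * (1 / ?N)" for i
  proof -
    have "coeff (jacobi_measure 1 0) (basis10 c) (jacobi01 0 0 i) j = coeff weight10 p (poly (jacobi_poly 0 i)) j"
      unfolding p_eq_basis10[symmetric] jacobi01_0_eq by (intro coeff_jacobi_measure_10 borel_measurable_poly p_borel)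
    moreover have "inner10 (poly (jacobi_poly 0 i)) (p j) = L2_inner (jac_weight 0) (poly ([:1, -1:] * ppoly j)) (poly (jacobi_poly 0 i))"
      unfolding L2_inner_def poly_ppoly[symmetric]
      by (subst (1 2) integral_jac_weight) (auto intro!: Bochner_Integration.integral_cong simp: algebra_simps)
    ultimately show ?thesis by (simp add: coeff_eq_inner v)
  qed
  have "op_S c v j = (\<Sum>\<^sub>\<infinity>i\<in>UNIV. coeff (jac_weight 0) (\<lambda>n. poly (jacobi_poly 0 n)) (poly ([:1, -1:] * ppoly j)) i * \<Phi> (jacobi_poly 0 i) * (1 / ?N))"
    unfolding op_S_def coeff_op_def eq ..
  also have "\<dots> = (\<Sum>\<^sub>\<infinity>i\<in>UNIV. coeff (jac_weight 0) (\<lambda>n. poly (jacobi_poly 0 n)) (poly ([:1, -1:] * ppoly j)) i * \<Phi> (jacobi_poly 0 i)) * (1 / ?N)"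
    by (rule infsum_cmult_left')
  also have "\<dots> = \<Phi> ([:1, -1:] * ppoly j) * (1 / ?N)"
    using infsum_jacobi_expansion[of \<Phi>, OF add smult] by simp
  finally show ?thesis by simp
qed

lemma volterra_1mx_eq:
  assumes f: "square_integrable weight10 f"
  shows "volterra_1mx c K (an f) j = moment f ([:1, -1:] * ppoly j) / inner10 (p j) (p j)"
proof -
  let ?w = "op_Q c (op_mult K (op_E c (an f)))"
  have w: "?w j = moment f (ppoly j) / inner10 (p j) (p j)" for j by (rule average_eq[OF f])
  have "poly ([:1, -1:] * ppoly j) = poly (ppoly j + smult (-1) ([:0, 1:] * ppoly j))"
    by (simp add: fun_eq_iff algebra_simps)
  then have "[:1, -1:] * ppoly j = ppoly j + smult (-1) ([:0, 1:] * ppoly j)"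
    by (simp only: poly_eq_poly_eq_iff)
  then have "moment f ([:1, -1:] * ppoly j) = moment f (ppoly j) - moment f ([:0, 1:] * ppoly j)"
    by (simp only: moment_linear[OF f])
  then show ?thesis
    unfolding volterra_1mx_def Let_def using w[of j] op_J_eq[OF f w, of j] by (simp add: diff_divide_distrib)
qed

lemma volterra_x_eq:
  assumes f: "square_integrable weight10 f"
  shows "op_S c (op_R (op_L c (op_Q c (op_mult K (op_E c (an f)))))) j
    = moment f (([:1, -1:] * ppoly j) \<circ>\<^sub>p [:1, -1:]) / inner10 (p j) (p j)"
proof (rule op_S_eq[of "\<lambda>h. moment f (h \<circ>\<^sub>p [:1, -1:])"])
  show "moment f ((r + s) \<circ>\<^sub>p [:1, -1:]) = moment f (r \<circ>\<^sub>p [:1, -1:]) + moment f (s \<circ>\<^sub>p [:1, -1:])" for r s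
    by (simp only: pcompose_add moment_linear[OF f])
  show "moment f (smult b r \<circ>\<^sub>p [:1, -1:]) = b * moment f (r \<circ>\<^sub>p [:1, -1:])" for b r
    by (simp only: pcompose_smult moment_linear[OF f])
  fix j
  let ?N = "L2_inner (jac_weight 0) (poly (jacobi_poly 0 j)) (poly (jacobi_poly 0 j))"
  have "poly (jacobi_poly 0 j \<circ>\<^sub>p [:1, -1:]) = poly (smult ((-1) ^ j) (jacobi_poly 0 j))"
    by (simp add: fun_eq_iff poly_pcompose jacobi_poly_reflect[symmetric])
  then have "jacobi_poly 0 j \<circ>\<^sub>p [:1, -1:] = smult ((-1) ^ j) (jacobi_poly 0 j)" by (simp only: poly_eq_poly_eq_iff)
  then show "op_R (op_L c (op_Q c (op_mult K (op_E c (an f))))) j = moment f (jacobi_poly 0 j \<circ>\<^sub>p [:1, -1:]) / ?N"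
    by (simp add: op_R_def op_L_eq[OF f average_eq[OF f]] moment_linear[OF f])
qed

end

section \<open>Convergence of the truncated systems\<close>

lemma square_integrable_jacobi_measure:
  assumes f: "f \<in> borel_measurable borel"
  shows "square_integrable (jacobi_measure 1 0) f \<longleftrightarrow> square_integrable weight10 f"
    and "L2_norm_on (jacobi_measure 1 0) f = norm10 f"
proof -
  have m: "(\<lambda>x. (f x)\<^sup>2) \<in> borel_measurable borel" using f by measurable
  have "f \<in> borel_measurable (jacobi_measure 1 0)"
    unfolding jacobi_measure_def using f by (simp add: measurable_restrict_space1)
  then show "square_integrable (jacobi_measure 1 0) f \<longleftrightarrow> square_integrable weight10 f"
    using integral_jacobi_measure(2)[OF m, of "Suc 0"] f by (simp add: square_integrable_def)
  show "L2_norm_on (jacobi_measure 1 0) f = norm10 f"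
    using integral_jacobi_measure(1)[OF m, of "Suc 0"] by (simp add: L2_norm_on_def)
qed

lemma basis10_borel: "basis10 c i \<in> borel_measurable borel"
proof -
  have "basis10 c i = (\<lambda>x. c i * jac10 i x)" by (rule ext) (rule basis10_eq)
  then show ?thesis by (simp only:) measurable
qed

lemma analysis_eq_coeff:
  "f \<in> borel_measurable borel \<Longrightarrow> analysis c f = coeff weight10 (basis10 c) f"
  unfolding analysis_def by (intro ext coeff_jacobi_measure_10 basis10_borel)

lemma jacobi_frame_of_analysis_bounded:
  assumes "analysis_synthesis_bounded c"
  shows "\<exists>B1 B2. jacobi_frame (basis10 c) c B1 B2"
proof -
  let ?M = "jacobi_measure 1 0"
  obtain C1 where C1: "\<And>f. square_integrable ?M f \<Longrightarrow>
      analysis c f \<in> ell2 \<and> ell2_norm (analysis c f) \<le> C1 * L2_norm_on ?M f"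
    using assms unfolding analysis_synthesis_bounded_def by blast
  obtain C2 where C2: "\<And>f. square_integrable ?M f \<Longrightarrow> L2_norm_on ?M f \<le> C2 * ell2_norm (analysis c f)"
    using assms unfolding analysis_synthesis_bounded_def by blast
  have onto: "\<exists>f. square_integrable ?M f \<and> analysis c f = v" if "v \<in> ell2" for v
    using assms that unfolding analysis_synthesis_bounded_def by blast
  have "jacobi_frame (basis10 c) c (max C1 1) (max C2 1)"
  proof
    show "basis10 c n = (\<lambda>x. c n * jac10 n x)" for n by (rule ext) (rule basis10_eq)
    show "c n \<noteq> 0" for n
    proof
      assume "c n = 0"
      then have 0: "analysis c f n = 0" for f by (simp add: analysis_def coeff_eq_inner L2_inner_def basis10_def)
      obtain f where "analysis c f = (\<lambda>i. if i = n then 1 else 0)" using onto[OF unit_in_ell2] by blast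
      with 0[of f] show False by simp
    qed
    show "0 < max C1 1" "0 < max C2 1" by auto
    fix f :: "real \<Rightarrow> real" assume f: "square_integrable weight10 f"
    have fb: "f \<in> borel_measurable borel" using square_integrable_measurable[OF f] by simp
    have fM: "square_integrable ?M f" using f square_integrable_jacobi_measure(1)[OF fb] by simp
    have an: "analysis c f = coeff weight10 (basis10 c) f" by (rule analysis_eq_coeff[OF fb])
    note C1' = C1[OF fM, unfolded an square_integrable_jacobi_measure(2)[OF fb]]
      and C2' = C2[OF fM, unfolded an square_integrable_jacobi_measure(2)[OF fb]]
    show "coeff weight10 (basis10 c) f \<in> ell2" using C1' by blast
    have "C1 * norm10 f \<le> max C1 1 * norm10 f" by (intro mult_right_mono) auto
    then show "ell2_norm (coeff weight10 (basis10 c) f) \<le> max C1 1 * norm10 f" using C1' by linarith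
    have "C2 * ell2_norm (coeff weight10 (basis10 c) f) \<le> max C2 1 * ell2_norm (coeff weight10 (basis10 c) f)"
      using C1' by (intro mult_right_mono ell2_norm_nonneg) auto
    then show "norm10 f \<le> max C2 1 * ell2_norm (coeff weight10 (basis10 c) f)" using C2' by linarith
  next
    fix v assume "v \<in> ell2"
    then obtain f where f: "square_integrable ?M f" "analysis c f = v" using onto by blast
    define h where "h = (\<lambda>x. indicator {0..1} x * f x)"
    have "f \<in> borel_measurable (restrict_space lborel {0..1})"
      using square_integrable_measurable[OF f(1)] by (simp add: jacobi_measure_def)
    then have hb: "h \<in> borel_measurable borel"
      unfolding h_def by (subst (asm) borel_measurable_restrict_space_iff) simp_all
    have space: "h x = f x" if "x \<in> space ?M" for x
      using that by (simp add: jacobi_measure_def space_restrict_space h_def)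
    have "square_integrable ?M h"
      using f(1) space unfolding square_integrable_def
      by (simp cong: measurable_cong Bochner_Integration.integrable_cong)
    moreover have "analysis c h = analysis c f"
      unfolding analysis_def coeff_eq_inner L2_inner_def using space
      by (simp cong: Bochner_Integration.integral_cong)
    ultimately show "\<exists>f. square_integrable weight10 f \<and> coeff weight10 (basis10 c) f = v"
      using f(2) square_integrable_jacobi_measure(1)[OF hb] analysis_eq_coeff[OF hb] by auto
  qed
  then show ?thesis by blast
qed

lemma (in ell2_operator) bounded_below_of_well_posed:
  assumes "well_posed A"
  shows "\<exists>D\<ge>0. \<forall>u\<in>ell2. ell2_norm u \<le> D * ell2_norm (\<lambda>i. u i - A u i)"
proof -
  have "\<forall>u\<in>ell2. \<forall>e>0. \<exists>d>0. \<forall>u'\<in>ell2. ell2_norm ((u' - A u') - (u - A u)) < d \<longrightarrow> ell2_norm (u' - u) < e"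
    using assms unfolding well_posed_def by (elim conjE)
  from this[rule_format, OF ell2_zero zero_less_one]
  obtain d where d: "0 < d" and cont: "\<And>u'. u' \<in> ell2 \<Longrightarrow>
      ell2_norm ((u' - A u') - ((\<lambda>i. 0) - A (\<lambda>i. 0))) < d \<Longrightarrow> ell2_norm (u' - (\<lambda>i. 0)) < 1"
    by blast
  have small: "ell2_norm u < 1" if "u \<in> ell2" "ell2_norm (\<lambda>i. u i - A u i) < d" for u
    using cont[OF that(1)] that(2) by (simp add: op_zero fun_diff_def)
  have "ell2_norm u \<le> 2 / d * ell2_norm (\<lambda>i. u i - A u i)" if u: "u \<in> ell2" for u
  proof (rule ccontr)
    let ?r = "ell2_norm (\<lambda>i. u i - A u i)"
    assume "\<not> ell2_norm u \<le> 2 / d * ?r"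
    then have big: "2 / d * ?r < ell2_norm u" by simp
    have r: "0 \<le> ?r" using u by (intro ell2_norm_nonneg ell2_diff' ell2_op)
    then have "0 \<le> 2 / d * ?r" using d by simp
    with big have pos: "0 < ell2_norm u" by linarith
    let ?t = "1 / ell2_norm u"
    have "(\<lambda>i. ?t * u i - A (\<lambda>i. ?t * u i) i) = (\<lambda>i. ?t * (u i - A u i))"
      unfolding op_cmult[OF u] by (simp only: right_diff_distrib)
    then have "ell2_norm (\<lambda>i. ?t * u i - A (\<lambda>i. ?t * u i) i) = \<bar>?t\<bar> * ?r"
      using ell2_norm_cmult[of "\<lambda>i. u i - A u i" ?t] u by (simp add: ell2_diff' ell2_op)
    also have "\<dots> < d"
    proof -
      have "2 * ?r / d < ell2_norm u" using big by simp
      then have "2 * ?r < ell2_norm u * d" using d by (simp only: pos_divide_less_eq)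
      then have "?r < d * ell2_norm u" using r by (simp only: mult.commute)
      then have "?r / ell2_norm u < d" using pos by (simp only: pos_divide_less_eq)
      then show ?thesis using pos by simp
    qed
    finally have "ell2_norm (\<lambda>i. ?t * u i) < 1" using u by (intro small ell2_cmult)
    then show False using ell2_norm_cmult[OF u, of ?t] pos by simp
  qed
  then show ?thesis using d by (intro exI[of _ "2 / d"]) auto
qed

lemma (in coefficient_operators) moment_integral:
  "moment f h = (\<integral>z. indicator T2 z * (poly h (fst z) * K (fst z) (snd z) * f (snd z)) \<partial>lborel)"
  unfolding moment_def L2_inner_triangle ..

lemma square_integrable_indicator_of_restrict:
  fixes K :: "real \<times> real \<Rightarrow> real"
  assumes K: "square_integrable (restrict_space lborel D) K" and D: "D \<in> sets borel"
  shows "square_integrable lborel (\<lambda>z. indicator D z * K z)"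
proof -
  have "(\<lambda>z. indicator D z * K z) \<in> borel_measurable lborel"
    using K D unfolding square_integrable_def by (subst (asm) borel_measurable_restrict_space_iff) simp_all
  moreover have "integrable lborel (\<lambda>z. indicator D z * (K z)\<^sup>2)"
    using K D unfolding square_integrable_def by (subst (asm) integrable_restrict_space) simp_all
  then have "integrable lborel (\<lambda>z. (indicator D z * K z)\<^sup>2)"
    by (rule Bochner_Integration.integrable_cong[THEN iffD1, rotated 2]) (auto simp: indicator_def)
  ultimately show ?thesis by (simp add: square_integrable_def)
qed

definition lower_triangle :: "(real \<times> real) set" where
  "lower_triangle = {(x, y). 0 \<le> x \<and> x \<le> 1 \<and> 0 \<le> y \<and> y \<le> x}"

lemma lower_triangle_reflect: "(1 - fst z, snd z) \<in> lower_triangle \<longleftrightarrow> z \<in> T2"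
  by (cases z) (auto simp: lower_triangle_def T2_def)

lemma lower_triangle_borel: "lower_triangle \<in> sets borel"
proof -
  have "lower_triangle = {z. 0 \<le> fst z} \<inter> {z. fst z \<le> 1} \<inter> {z. 0 \<le> snd z} \<inter> {z. snd z \<le> fst z}"
    by (auto simp: lower_triangle_def)
  moreover have "closed ({z. 0 \<le> fst z} \<inter> {z. fst z \<le> 1} \<inter> {z. 0 \<le> snd z} \<inter> {z :: real \<times> real. snd z \<le> fst z})"
    by (intro closed_Int closed_Collect_le continuous_intros)
  ultimately show ?thesis by (simp add: borel_closed)
qed

lemma marginal_T2:
  fixes g :: "real \<Rightarrow> real"
  assumes "g \<in> borel_measurable borel" "integrable weight10 g"
  shows "integrable lborel (\<lambda>z. indicator T2 z * g (snd z)) \<and>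
      (\<integral>z. indicator T2 z * g (snd z) \<partial>lborel) = (\<integral>x. g x \<partial>weight10)"
  using integral_triangle_snd[OF assms(1)] assms(2) by (simp add: integral_triangle integrable_triangle)

lemma marginal_lower_triangle:
  fixes g :: "real \<Rightarrow> real"
  assumes [measurable]: "g \<in> borel_measurable borel" and int: "integrable weight10 g"
  shows "integrable lborel (\<lambda>z. indicator lower_triangle z * g (snd z)) \<and>
      (\<integral>z. indicator lower_triangle z * g (snd z) \<partial>lborel) = (\<integral>x. g x \<partial>weight10)"
proof -
  have [measurable]: "lower_triangle \<in> sets borel" by (rule lower_triangle_borel)
  have m: "(\<lambda>z. indicator lower_triangle z * g (snd z)) \<in> borel_measurable borel" by measurable
  have "indicator lower_triangle (1 - fst z, snd z) = (indicator T2 z :: real)" for z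
    by (simp add: indicator_def lower_triangle_reflect)
  with integral_reflect_fst[OF m] marginal_T2[OF assms] show ?thesis by simp
qed

theorem (in volterra_kernel) truncated_systems_converge:
  assumes wp: "well_posed A"
    and small: "\<And>e. 0 < e \<Longrightarrow>
      \<forall>\<^sub>F n in sequentially. \<forall>u\<in>ell2. ell2_norm (A (tail n (A u))) \<le> e * ell2_norm u"
    and u: "u \<in> ell2" "u - A u = g"
  shows "(\<exists>C. \<forall>\<^sub>F n in sequentially.
            (\<exists>!v. truncated_solution A g n v) \<and>
            ell2_norm (u - sparse_solution A g n) \<le> C * ell2_norm (u - trunc n u)) \<and>
         (\<lambda>n. ell2_norm (u - trunc n u)) \<longlonglongrightarrow> 0 \<and>
         (\<lambda>n. ell2_norm (u - sparse_solution A g n)) \<longlonglongrightarrow> 0"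
proof -
  obtain B where B: "\<forall>u\<in>ell2. ell2_norm (A u) \<le> B * ell2_norm u" using A_bounded by blast
  obtain D where D: "0 \<le> D" "\<forall>u\<in>ell2. ell2_norm u \<le> D * ell2_norm (\<lambda>i. u i - A u i)"
    using bounded_below_of_well_posed[OF wp] by blast
  show ?thesis by (rule truncation_converges[OF bspec[OF D(2)] D(1) bspec[OF B] small u])
qed

lemma volterra_kernel_lower_triangle:
  assumes frame: "jacobi_frame (basis10 c) c B1 B2"
    and K: "square_integrable (restrict_space lborel lower_triangle) (\<lambda>(x, y). K x y)"
    and A: "\<And>u. u \<in> ell2 \<Longrightarrow> volterra_x c K u \<in> ell2"
  shows "\<exists>k. volterra_kernel (basis10 c) c B1 B2 lower_triangle k (volterra_x c K) \<and>
    volterra_kernel.finite_on k UNIV"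
proof -
  interpret jacobi_frame "basis10 c" c B1 B2 by (rule frame)
  define k where "k z = indicator lower_triangle z * K (fst z) (snd z)" for z
  have [measurable]: "lower_triangle \<in> sets borel" by (rule lower_triangle_borel)
  have sk: "square_integrable lborel k"
    using square_integrable_indicator_of_restrict[OF K lower_triangle_borel] by (simp add: k_def[abs_def] case_prod_beta')
  then have [measurable]: "k \<in> borel_measurable borel" using square_integrable_measurable by fastforce
  have kT: "indicator T2 z * K (1 - fst z) (snd z) = k (1 - fst z, snd z)" for z
    by (simp add: k_def indicator_def lower_triangle_reflect)
  have reflected: "square_integrable triangle_measure (\<lambda>(x, y). K (1 - x) y)"
  proof -
    have "(\<lambda>z. k (1 - fst z, snd z)) \<in> borel_measurable borel"
      using reflect_measurable by (rule measurable_compose) measurable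
    then have "(\<lambda>z. K (1 - fst z) (snd z)) \<in> borel_measurable triangle_measure"
      by (subst borel_measurable_restrict_space_iff) (simp_all add: kT)
    moreover have "(\<lambda>z. (k z)\<^sup>2) \<in> borel_measurable borel" by measurable
    from integral_reflect_fst(2)[OF this] have "integrable lborel (\<lambda>z. (k (1 - fst z, snd z))\<^sup>2)"
      using sk by (simp add: square_integrable_def)
    then have "integrable triangle_measure (\<lambda>z. (K (1 - fst z) (snd z))\<^sup>2)"
      unfolding integrable_triangle kT[symmetric]
      by (rule Bochner_Integration.integrable_cong[THEN iffD1, rotated 2]) (auto simp: indicator_def)
    ultimately show ?thesis by (simp add: square_integrable_def case_prod_beta')
  qed
  interpret coefficient_operators "basis10 c" c B1 B2 "\<lambda>x y. K (1 - x) y"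
    by unfold_locales (rule reflected)
  have repr: "volterra_x c K (an f) j = (\<integral>z. k z * f (snd z) * (basis10 c j (fst z) * (1 - fst z)) \<partial>lborel)
      / inner10 (basis10 c j) (basis10 c j)" if f: "square_integrable weight10 f" for f j
  proof -
    let ?g = "\<lambda>z. k z * f (snd z) * (basis10 c j (fst z) * (1 - fst z))"
    have [measurable]: "f \<in> borel_measurable borel" using square_integrable_measurable[OF f] by simp
    have [measurable]: "basis10 c j \<in> borel_measurable borel" by (rule basis10_borel)
    have "moment f (([:1, -1:] * ppoly j) \<circ>\<^sub>p [:1, -1:]) = (\<integral>z. ?g (1 - fst z, snd z) \<partial>lborel)"
      unfolding moment_integral
    proof (intro Bochner_Integration.integral_cong refl)
      fix z :: "real \<times> real"
      have "poly (([:1, -1:] * ppoly j) \<circ>\<^sub>p [:1, -1:]) (fst z) = fst z * basis10 c j (1 - fst z)"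
        by (simp add: poly_pcompose basis10_eq algebra_simps)
      then show "indicator T2 z * (poly (([:1, -1:] * ppoly j) \<circ>\<^sub>p [:1, -1:]) (fst z) * K (1 - fst z) (snd z) * f (snd z)) = ?g (1 - fst z, snd z)"
        using kT[of z] by (simp add: algebra_simps)
    qed
    also have "\<dots> = (\<integral>z. ?g z \<partial>lborel)" by (rule integral_reflect_fst(1)) measurable
    finally show ?thesis unfolding volterra_x_def volterra_x_eq[OF f] by simp
  qed
  have vk: "volterra_kernel (basis10 c) c B1 B2 lower_triangle k (volterra_x c K)"
  proof
    show "lower_triangle \<subseteq> {0..1} \<times> {0..1}" by (auto simp: lower_triangle_def)
    show "k z = 0" if "z \<notin> lower_triangle" for z using that by (simp add: k_def)
  qed (use sk A repr marginal_lower_triangle lower_triangle_borel in auto)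
  have "integrable lborel (\<lambda>z. (k z)\<^sup>2 * (1 - fst z) / (1 - snd z) * indicator UNIV (snd z))"
  proof (rule Bochner_Integration.integrable_bound)
    show "integrable lborel (\<lambda>z. (k z)\<^sup>2)" using sk by (simp add: square_integrable_def)
    show "AE z in lborel. norm ((k z)\<^sup>2 * (1 - fst z) / (1 - snd z) * indicator UNIV (snd z)) \<le> norm ((k z)\<^sup>2)"
    proof (intro AE_I2)
      fix z :: "real \<times> real"
      show "norm ((k z)\<^sup>2 * (1 - fst z) / (1 - snd z) * indicator UNIV (snd z)) \<le> norm ((k z)\<^sup>2)"
      proof (cases "z \<in> lower_triangle")
        case True
        then have "0 \<le> (1 - fst z) / (1 - snd z)" "(1 - fst z) / (1 - snd z) \<le> 1"
          by (auto simp: lower_triangle_def divide_le_eq_1 zero_le_divide_iff)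
        then have "(k z)\<^sup>2 * ((1 - fst z) / (1 - snd z)) \<le> (k z)\<^sup>2 * 1" "0 \<le> (k z)\<^sup>2 * ((1 - fst z) / (1 - snd z))"
          by (intro mult_left_mono mult_nonneg_nonneg; simp)+
        then have "\<bar>(k z)\<^sup>2 * ((1 - fst z) / (1 - snd z))\<bar> \<le> \<bar>(k z)\<^sup>2 * 1\<bar>" by linarith
        then show ?thesis by simp
      qed (simp add: k_def)
    qed
  qed measurable
  then have "volterra_kernel.finite_on k UNIV"
    unfolding volterra_kernel.finite_on_def[OF vk] by simp
  with vk show ?thesis by blast
qed

lemma volterra_kernel_T2:
  assumes frame: "jacobi_frame (basis10 c) c B1 B2"
    and K: "square_integrable triangle_measure (\<lambda>(x, y). K x y)"
    and A: "\<And>u. u \<in> ell2 \<Longrightarrow> volterra_1mx c K u \<in> ell2"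
  shows "\<exists>k. volterra_kernel (basis10 c) c B1 B2 T2 k (volterra_1mx c K) \<and>
    (\<forall>d. 0 < d \<longrightarrow> d < 1 \<longrightarrow> volterra_kernel.finite_on k {..1 - d})"
proof -
  interpret jacobi_frame "basis10 c" c B1 B2 by (rule frame)
  interpret coefficient_operators "basis10 c" c B1 B2 K
    by unfold_locales (rule K)
  define k where "k z = indicator T2 z * K (fst z) (snd z)" for z
  have sk: "square_integrable lborel k"
    using square_integrable_indicator_of_restrict[OF K T2_borel] by (simp add: k_def[abs_def] case_prod_beta')
  then have [measurable]: "k \<in> borel_measurable borel" using square_integrable_measurable by fastforce
  have repr: "volterra_1mx c K (an f) j = (\<integral>z. k z * f (snd z) * (basis10 c j (fst z) * (1 - fst z)) \<partial>lborel)
      / inner10 (basis10 c j) (basis10 c j)" if f: "square_integrable weight10 f" for f j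
  proof -
    have "moment f ([:1, -1:] * ppoly j) = (\<integral>z. k z * f (snd z) * (basis10 c j (fst z) * (1 - fst z)) \<partial>lborel)"
      unfolding moment_integral
      by (intro Bochner_Integration.integral_cong refl) (simp add: k_def basis10_eq algebra_simps)
    then show ?thesis unfolding volterra_1mx_eq[OF f] by simp
  qed
  have vk: "volterra_kernel (basis10 c) c B1 B2 T2 k (volterra_1mx c K)"
  proof
    show "k z = 0" if "z \<notin> T2" for z using that by (simp add: k_def)
  qed (use sk A repr marginal_T2 T2_borel T2_unit in auto)
  have "volterra_kernel.finite_on k {..1 - d}" if d: "0 < d" "d < 1" for d
  proof -
    have "integrable lborel (\<lambda>z. (k z)\<^sup>2 * (1 - fst z) / (1 - snd z) * indicator {..1 - d} (snd z))"
    proof (rule Bochner_Integration.integrable_bound)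
      show "integrable lborel (\<lambda>z. (k z)\<^sup>2 * (1 / d))" using sk by (simp add: square_integrable_def)
      show "AE z in lborel. norm ((k z)\<^sup>2 * (1 - fst z) / (1 - snd z) * indicator {..1 - d} (snd z)) \<le> norm ((k z)\<^sup>2 * (1 / d))"
      proof (intro AE_I2)
        fix z :: "real \<times> real"
        show "norm ((k z)\<^sup>2 * (1 - fst z) / (1 - snd z) * indicator {..1 - d} (snd z)) \<le> norm ((k z)\<^sup>2 * (1 / d))"
        proof (cases "z \<in> T2 \<and> snd z \<le> 1 - d")
          case True
          then have z: "0 \<le> fst z" "fst z \<le> 1" "d \<le> 1 - snd z" by (auto simp: T2_def)
          then have "(1 - fst z) / (1 - snd z) \<le> 1 / d" using d by (intro frac_le) auto
          moreover have "0 \<le> (1 - fst z) / (1 - snd z)" using z d by (intro divide_nonneg_nonneg) auto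
          ultimately have "(k z)\<^sup>2 * ((1 - fst z) / (1 - snd z)) \<le> (k z)\<^sup>2 * (1 / d)" "0 \<le> (k z)\<^sup>2 * ((1 - fst z) / (1 - snd z))"
            by (intro mult_left_mono mult_nonneg_nonneg; simp)+
          then have "\<bar>(k z)\<^sup>2 * ((1 - fst z) / (1 - snd z))\<bar> \<le> \<bar>(k z)\<^sup>2 * (1 / d)\<bar>" by linarith
          then show ?thesis using True by simp
        qed (auto simp: k_def indicator_def)
      qed
    qed measurable
    then show ?thesis unfolding volterra_kernel.finite_on_def[OF vk] by simp
  qed
  with vk show ?thesis by blast
qed

theorem corollary5p5:
  fixes c :: "nat \<Rightarrow> real" and K :: "real \<Rightarrow> real \<Rightarrow> real"
    and A :: "(nat \<Rightarrow> real) \<Rightarrow> (nat \<Rightarrow> real)" and g u :: "nat \<Rightarrow> real"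
  assumes "analysis_synthesis_bounded c"
    and "(A = volterra_x c K \<and>
          square_integrable (restrict_space lborel {(x, y). 0 \<le> x \<and> x \<le> 1 \<and> 0 \<le> y \<and> y \<le> x})
            (\<lambda>(x, y). K x y))
       \<or> (A = volterra_1mx c K \<and>
          square_integrable (restrict_space lborel T2) (\<lambda>(x, y). K x y))"
    and "well_posed A"
    and "g \<in> ell2" and "u \<in> ell2" and "u - A u = g"
  shows "(\<exists>C. \<forall>\<^sub>F n in sequentially.
            (\<exists>!v. truncated_solution A g n v) \<and>
            ell2_norm (u - sparse_solution A g n) \<le> C * ell2_norm (u - trunc n u)) \<and>
         (\<lambda>n. ell2_norm (u - trunc n u)) \<longlonglongrightarrow> 0 \<and>
         (\<lambda>n. ell2_norm (u - sparse_solution A g n)) \<longlonglongrightarrow> 0"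
proof -
  obtain B1 B2 where frame: "jacobi_frame (basis10 c) c B1 B2"
    using jacobi_frame_of_analysis_bounded[OF assms(1)] by blast
  have ell2: "\<And>u. u \<in> ell2 \<Longrightarrow> A u \<in> ell2" using assms(3) by (simp add: well_posed_def)
  from assms(2) show ?thesis
  proof (elim disjE conjE)
    assume A: "A = volterra_x c K"
      and K: "square_integrable (restrict_space lborel {(x, y). 0 \<le> x \<and> x \<le> 1 \<and> 0 \<le> y \<and> y \<le> x}) (\<lambda>(x, y). K x y)"
    obtain k where k: "volterra_kernel (basis10 c) c B1 B2 lower_triangle k A"
      and fin: "volterra_kernel.finite_on k UNIV"
      using volterra_kernel_lower_triangle[OF frame K[folded lower_triangle_def] ell2[unfolded A]] unfolding A by blast
    interpret volterra_kernel "basis10 c" c B1 B2 lower_triangle k A by (rule k)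
    show ?thesis
      using assms(3) tail_iterate_small_of_finite[OF fin] assms(5,6) by (rule truncated_systems_converge)
  next
    assume A: "A = volterra_1mx c K" and K: "square_integrable triangle_measure (\<lambda>(x, y). K x y)"
    obtain k where k: "volterra_kernel (basis10 c) c B1 B2 T2 k A"
      and fin: "\<And>d. 0 < d \<Longrightarrow> d < 1 \<Longrightarrow> volterra_kernel.finite_on k {..1 - d}"
      using volterra_kernel_T2[OF frame K ell2[unfolded A]] unfolding A by blast
    interpret volterra_kernel "basis10 c" c B1 B2 T2 k A by (rule k)
    have D: "x + y \<le> 1" if "(x, y) \<in> T2" for x y using that by (simp add: T2_def)
    show ?thesis
      using assms(3) tail_iterate_small_of_corner[OF fin D] assms(5,6) by (rule truncated_systems_converge)
  qed
qed

end
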